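(* For any finite nonempty set $A\subseteq\mathbb{Z}$ and any positive integer $N$ the following hold. 1. If $(T_1^N)$ and $(T_2^N)$ hold for $A$, then $A$ tiles $\mathbb{Z}_N$. 2. If $A$ tiles $\mathbb{Z}_N$, then $(T_1^N)$ holds for $A$. 3. If the implication ($A$ tiles $\mathbb{Z}$ $\Longrightarrow$ $(T_1)$ and $(T_2)$) is true, then the implication ($A$ tiles $\mathbb{Z}_N$ $\Longrightarrow$ $(T_1^N)$ and $(T_2^N)$) is true. 4. If $|A|$ has at most two distinct prime factors and $A$ tiles $\mathbb{Z}_N$, then $(T_1^N)$ and $(T_2^N)$ hold for $A$. 5. There is an algorithm which, given $N$ and $A$, decides whether $(T_1^N)$ and $(T_2^N)$ hold for $A$ in time polynomial in $N$. Consequently, when $|A|$ has at most two distinct prime factors, this algorithm decides whether $A$ tiles $\mathbb{Z}_N$.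
   Context: $\mathbb{Z}_N=\mathbb{Z}/N\mathbb{Z}$. For $G=\mathbb{Z}$ or $G=\mathbb{Z}_N$, a finite set $A\subseteq\mathbb{Z}$ tiles $G$ (by translation) if there is $B\subseteq G$ such that every $g\in G$ has a unique representation $g=a+b$ with $a\in A$, $b\in B$ (for $G=\mathbb{Z}_N$ the sum is taken modulo $N$; uniqueness forces the elements of $A$ to be distinct modulo $N$). Normalization: all notions involved are invariant under translating $A$, so $A$ is taken to consist of nonnegative integers with $0\in A$. Put $A(X)=\sum_{a\in A}X^a$. Let $\Phi_n(X)$ be the $n$-th cyclotomic polynomial. Prime powers are $p^a$ with $p$ prime and $a\ge 1$. Let $S_A$ be the set of prime powers $p^a$ with $\Phi_{p^a}(X)\mid A(X)$, and let $S_A^N$ be the set of prime powers $p^a$ dividing $N$ with $\Phi_{p^a}(X)\mid A(X)$. $(T_1)$: $A(1)=\prod_{s\in S_A}\Phi_s(1)$. $(T_2)$: if $s_1,\dots,s_m\in S_A$ are powers of distinct primes, then $\Phi_{s_1\cdots s_m}(X)\mid A(X)$. $(T_1^N)$: $A(1)=\prod_{s\in S_A^N}\Phi_s(1)$. $(T_2^N)$: if $s_1,\dots,s_m\in S_A^N$ are powers of distinct primes, then $\Phi_{s_1\cdots s_m}(X)\mid A(X)$. In item 5 the input $A$ is given as a subset of $\mathbb{Z}_N$, i.e. $A\subseteq\{0,1,\dots,N-1\}$. *)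

theory Defs
  imports
    Complex_Main
    "HOL-Computational_Algebra.Computational_Algebra"
    "HOL-Number_Theory.Cong"
    "HOL-Number_Theory.Prime_Powers"
begin

section \<open>Tilings\<close>

definition tiles_int :: "int set \<Rightarrow> bool" where
  "tiles_int A \<longleftrightarrow>
     (\<exists>B. \<forall>g. \<exists>!x. x \<in> A \<times> B \<and> fst x + snd x = g)"

text \<open>
  Elements of \<open>\<int>/N\<close> are represented by their residues in \<open>{0..<N}\<close>. The first component of the unique
  pair ranges over the integer set \<open>A\<close> itself, so two elements of \<open>A\<close> that are congruent modulo \<open>N\<close>
  violate uniqueness.
\<close>
definition tiles_mod :: "nat \<Rightarrow> int set \<Rightarrow> bool" where
  "tiles_mod N A \<longleftrightarrow>
     (\<exists>B \<subseteq> {0..<int N}. \<forall>g \<in> {0..<int N}.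
        \<exists>!x. x \<in> A \<times> B \<and> [fst x + snd x = g] (mod int N))"


section \<open>Cyclotomic polynomials\<close>

definition primitive_roots_unity :: "nat \<Rightarrow> complex set" where
  "primitive_roots_unity n = {z. z ^ n = 1 \<and> (\<forall>m. 0 < m \<and> m < n \<longrightarrow> z ^ m \<noteq> 1)}"

text \<open>
  The description is meaningful for \<open>n > 0\<close>: see \<open>of_int_cyclotomic\<close> below, which shows that the product
  on the right-hand side has integer coefficients.
\<close>
definition cyclotomic :: "nat \<Rightarrow> int poly" where
  "cyclotomic n =
     (THE P. map_poly of_int P = (\<Prod>z\<in>primitive_roots_unity n. [:- z, 1:]))"

lemma finite_primitive_roots_unity:
  assumes "n > 0"
  shows "finite (primitive_roots_unity n)"
  using finite_roots_unity[of n, where 'a = complex] assms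
  by (auto simp: primitive_roots_unity_def intro: finite_subset[rotated])

lemma map_poly_of_int_mult:
  "map_poly of_int (p * q) =
     (map_poly of_int p * map_poly of_int q :: 'a :: comm_ring_1 poly)"
  by (rule poly_eqI) (simp add: coeff_map_poly coeff_mult)

lemma map_poly_of_int_add:
  "map_poly of_int (p + q) =
     (map_poly of_int p + map_poly of_int q :: 'a :: comm_ring_1 poly)"
  by (rule poly_eqI) (simp add: coeff_map_poly)

lemma map_poly_of_int_prod:
  "map_poly of_int (\<Prod>i\<in>I. p i) =
     (\<Prod>i\<in>I. map_poly of_int (p i) :: 'a :: comm_ring_1 poly)"
  by (induction I rule: infinite_finite_induct) (simp_all add: map_poly_of_int_mult)

lemma map_poly_of_int_inject:
  "map_poly of_int p = (map_poly of_int q :: 'a :: ring_char_0 poly) \<Longrightarrow> p = q"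
  by (auto simp: poly_eq_iff coeff_map_poly)

lemma prod_linear_roots_unity:
  assumes "n > 0"
  shows "(\<Prod>z\<in>{z :: complex. z ^ n = 1}. [:- z, 1:]) = monom 1 n - 1"
    (is "?P = ?Q")
proof -
  let ?R = "{z :: complex. z ^ n = 1}"
  have fin: "finite ?R" and card: "card ?R = n"
    using assms by (auto intro: finite_roots_unity card_roots_unity_eq)
  have deg: "degree (\<Prod>z\<in>?R. [:- z, 1:]) = n"
    using card by (subst degree_prod_sum_eq) auto
  have "lead_coeff (\<Prod>z\<in>?R. [:- z, 1:]) = 1"
    by (simp add: lead_coeff_prod)
  with deg have lc: "coeff ?P n = 1"
    by simp
  show ?thesis
  proof (rule poly_eqI_degree_lead_coeff[where n = n and A = ?R])
    show "coeff ?P n = coeff ?Q n"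
      using lc assms by simp
    show "degree ?P \<le> n"
      using deg by simp
    show "degree ?Q \<le> n"
      by (intro degree_diff_le degree_monom_le) auto
    show "n \<le> card ?R"
      using card by simp
    show "poly ?P z = poly ?Q z" if "z \<in> ?R" for z
    proof -
      have "(\<Prod>w\<in>?R. poly [:- w, 1:] z) = 0"
        using fin that by (intro prod_zero) auto
      with that show ?thesis
        by (simp add: poly_prod poly_monom)
    qed
  qed
qed

lemma roots_unity_eq_UN_primitive:
  assumes "n > 0"
  shows "{z :: complex. z ^ n = 1} = (\<Union>d\<in>{d. d dvd n}. primitive_roots_unity d)"
proof (intro equalityI subsetI)
  fix z :: complex
  assume z: "z \<in> {z. z ^ n = 1}"
  define d where "d = (LEAST m. m > 0 \<and> z ^ m = 1)"
  have d: "d > 0" "z ^ d = 1"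
    using LeastI[of "\<lambda>m. m > 0 \<and> z ^ m = 1" n] z assms by (auto simp: d_def)
  have min: "z ^ m \<noteq> 1" if "0 < m" "m < d" for m
    using not_less_Least[of m "\<lambda>m. m > 0 \<and> z ^ m = 1"] that by (auto simp: d_def)
  have "z ^ n = z ^ (d * (n div d) + n mod d)" by simp
  also have "\<dots> = z ^ (n mod d)"
    by (simp only: power_add power_mult d power_one mult_1_left)
  finally have "z ^ (n mod d) = 1" using z by simp
  with min[of "n mod d"] d have "n mod d = 0" by force
  then have "d dvd n" by (simp add: dvd_eq_mod_eq_0)
  moreover have "z \<in> primitive_roots_unity d"
    using d min by (simp add: primitive_roots_unity_def)
  ultimately show "z \<in> (\<Union>d\<in>{d. d dvd n}. primitive_roots_unity d)" by blast
next
  fix z :: complex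
  assume "z \<in> (\<Union>d\<in>{d. d dvd n}. primitive_roots_unity d)"
  then obtain d k where "n = d * k" "z ^ d = 1"
    by (auto simp: primitive_roots_unity_def dvd_def)
  then show "z \<in> {z. z ^ n = 1}"
    by (simp add: power_mult)
qed

lemma primitive_roots_unity_disjoint:
  assumes "d > 0" "e > 0" "d \<noteq> e"
  shows "primitive_roots_unity d \<inter> primitive_roots_unity e = {}"
proof (cases "d < e")
  case True
  then show ?thesis using assms(1) by (auto simp: primitive_roots_unity_def)
next
  case False
  with assms have "e < d" by simp
  then show ?thesis using assms(2) by (auto simp: primitive_roots_unity_def)
qed

lemma prod_primitive_roots_unity:
  assumes "n > 0"
  shows "(\<Prod>d | d dvd n. \<Prod>z\<in>primitive_roots_unity d. [:- z, 1:]) = monom 1 n - 1"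
proof -
  have pos: "d > 0" if "d \<in> {d. d dvd n}" for d
    using that assms dvd_pos_nat by simp
  have "(\<Prod>z\<in>{z :: complex. z ^ n = 1}. [:- z, 1:]) =
        (\<Prod>d | d dvd n. \<Prod>z\<in>primitive_roots_unity d. [:- z, 1:])"
    unfolding roots_unity_eq_UN_primitive[OF assms]
  proof (rule prod.UNION_disjoint)
    show "finite {d. d dvd n}"
      using assms by simp
    show "\<forall>d\<in>{d. d dvd n}. finite (primitive_roots_unity d)"
      using pos finite_primitive_roots_unity by blast
    show "\<forall>d\<in>{d. d dvd n}. \<forall>e\<in>{d. d dvd n}. d \<noteq> e \<longrightarrow>
        primitive_roots_unity d \<inter> primitive_roots_unity e = {}"
      using pos primitive_roots_unity_disjoint by blast
  qed
  then show ?thesis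
    using prod_linear_roots_unity[OF assms] by simp
qed

lemma ex_int_poly_primitive_roots_unity:
  assumes "n > 0"
  shows "\<exists>P :: int poly. map_poly of_int P = (\<Prod>z\<in>primitive_roots_unity n. [:- z, 1:])"
  using assms
proof (induction n rule: less_induct)
  case (less n)
  let ?c = "\<lambda>d. \<Prod>z\<in>primitive_roots_unity d. [:- z, 1 :: complex:]"
  let ?D = "{d. d dvd n \<and> d < n}"
  let ?h = "map_poly of_int :: int poly \<Rightarrow> complex poly"
  have finD: "finite ?D" by simp
  have "\<forall>d\<in>?D. \<exists>P. ?h P = ?c d"
    using less by (auto intro: dvd_pos_nat)
  then obtain P where P: "\<And>d. d \<in> ?D \<Longrightarrow> ?h (P d) = ?c d" by metis
  define Q where "Q = (\<Prod>d\<in>?D. P d)"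
  have hQ: "?h Q = (\<Prod>d\<in>?D. ?c d)"
    unfolding Q_def map_poly_of_int_prod by (rule prod.cong) (auto simp: P)
  have "lead_coeff (?h Q) = 1"
    unfolding hQ by (simp add: lead_coeff_prod)
  moreover have deg: "degree (?h p) = degree p" for p
    by (rule degree_map_poly) auto
  ultimately have lcQ: "lead_coeff Q = 1"
    by (simp add: coeff_map_poly)
  then have Q0: "Q \<noteq> 0" by auto
  obtain T R where TR: "pseudo_divmod (monom 1 n - 1) Q = (T, R)"
    by (cases "pseudo_divmod (monom 1 n - 1) Q")
  have eq: "monom 1 n - 1 = Q * T + R" and R: "R = 0 \<or> degree R < degree Q"
    using pseudo_divmod[OF Q0 TR] lcQ by auto
  have "{d. d dvd n} = insert n ?D"
    using less.prems by (auto dest: dvd_imp_le)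
  then have "monom 1 n - 1 = ?c n * ?h Q"
    using prod_primitive_roots_unity[OF less.prems] finD hQ by simp
  moreover have "monom 1 n - 1 = ?h (monom 1 n - 1)"
    by (rule poly_eqI) (simp add: coeff_map_poly)
  ultimately have "?c n * ?h Q = ?h Q * ?h T + ?h R"
    using eq by (simp only: map_poly_of_int_mult map_poly_of_int_add)
  then have hR: "?h R = ?h Q * (?c n - ?h T)"
    by (simp add: algebra_simps)
  have "?c n - ?h T = 0"
  proof (rule ccontr)
    assume ne: "?c n - ?h T \<noteq> 0"
    have hQ0: "?h Q \<noteq> 0" using \<open>lead_coeff (?h Q) = 1\<close> by auto
    have "degree (?h R) = degree (?h Q) + degree (?c n - ?h T)"
      unfolding hR using hQ0 ne by (rule degree_mult_eq)
    moreover have "R \<noteq> 0" using hR ne hQ0 by auto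
    ultimately show False using R deg[of R] deg[of Q] by linarith
  qed
  then show ?case by (intro exI[of _ T]) simp
qed

lemma of_int_cyclotomic:
  assumes "n > 0"
  shows "map_poly of_int (cyclotomic n) = (\<Prod>z\<in>primitive_roots_unity n. [:- z, 1:])"
proof -
  have "\<exists>!P :: int poly. map_poly of_int P = (\<Prod>z\<in>primitive_roots_unity n. [:- z, 1:])"
  proof (rule ex_ex1I)
    show "\<exists>P :: int poly. map_poly of_int P = (\<Prod>z\<in>primitive_roots_unity n. [:- z, 1:])"
      using ex_int_poly_primitive_roots_unity[OF assms] .
  next
    fix P Q :: "int poly"
    assume "map_poly of_int P = (\<Prod>z\<in>primitive_roots_unity n. [:- z, 1:])"
      "map_poly of_int Q = (\<Prod>z\<in>primitive_roots_unity n. [:- z, 1:])"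
    then show "P = Q"
      using map_poly_of_int_inject[where 'a = complex, of P Q] by simp
  qed
  from theI'[OF this] show ?thesis
    unfolding cyclotomic_def .
qed


section \<open>The Coven--Meyerowitz conditions\<close>

text \<open>
  The translate of \<open>A\<close> with least element \<open>0\<close> gives a polynomial for every finite nonempty set of
  integers.
\<close>
definition mask_poly :: "int set \<Rightarrow> int poly" where
  "mask_poly A = (\<Sum>a\<in>A. monom 1 (nat (a - Min A)))"

definition S_set :: "int set \<Rightarrow> nat set" where
  "S_set A = {s. primepow s \<and> cyclotomic s dvd mask_poly A}"

definition S_set_mod :: "nat \<Rightarrow> int set \<Rightarrow> nat set" where
  "S_set_mod N A = {s. primepow s \<and> s dvd N \<and> cyclotomic s dvd mask_poly A}"

definition cond_T1 :: "nat set \<Rightarrow> int set \<Rightarrow> bool" where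
  "cond_T1 S A \<longleftrightarrow> poly (mask_poly A) 1 = (\<Prod>s\<in>S. poly (cyclotomic s) 1)"

text \<open>
  Elements \<open>s\<^sub>1, \<dots>, s\<^sub>m\<close> of \<open>S\<close> that are powers of distinct primes are given by the finite set \<open>P\<close> of these
  primes and the exponents \<open>e\<close>. The empty product is excluded (\<open>m \<ge> 1\<close>): it would demand that
  \<open>\<Phi>\<^sub>1 = X - 1\<close> divides \<open>A(X)\<close>, which is impossible since \<open>A(1) = |A|\<close>.
\<close>
definition cond_T2 :: "nat set \<Rightarrow> int set \<Rightarrow> bool" where
  "cond_T2 S A \<longleftrightarrow>
     (\<forall>P e. finite P \<and> P \<noteq> {} \<and> (\<forall>p\<in>P. prime p \<and> e p \<ge> 1 \<and> p ^ e p \<in> S) \<longrightarrow>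
        cyclotomic (\<Prod>p\<in>P. p ^ e p) dvd mask_poly A)"

abbreviation T1 :: "int set \<Rightarrow> bool" where "T1 A \<equiv> cond_T1 (S_set A) A"
abbreviation T2 :: "int set \<Rightarrow> bool" where "T2 A \<equiv> cond_T2 (S_set A) A"

abbreviation T1_mod :: "nat \<Rightarrow> int set \<Rightarrow> bool" where
  "T1_mod N A \<equiv> cond_T1 (S_set_mod N A) A"
abbreviation T2_mod :: "nat \<Rightarrow> int set \<Rightarrow> bool" where
  "T2_mod N A \<equiv> cond_T2 (S_set_mod N A) A"


section \<open>Algorithms and running time\<close>

text \<open>
  Algorithms are structured programs for a random access machine with natural number registers and an
  indirectly addressed memory. The only arithmetic operations are addition and truncated subtraction,
  and each executed instruction or test costs one unit of time. A run of \<open>t\<close> steps only creates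
  numbers of \<open>O(t)\<close> more bits than the input and the constants of the program have, so that polynomial
  time in this unit-cost model agrees with polynomial time on Turing machines.
\<close>

type_synonym reg = nat

datatype com =
    Skip
  | Const reg nat
  | Add reg reg reg
  | Sub reg reg reg
  | Load reg reg    \<comment> \<open>\<open>Load i j\<close>: register \<open>i\<close> := memory cell addressed by register \<open>j\<close>\<close>
  | Store reg reg   \<comment> \<open>\<open>Store i j\<close>: memory cell addressed by register \<open>i\<close> := register \<open>j\<close>\<close>
  | Seq com com
  | IfPos reg com com
  | WhilePos reg com

type_synonym state = "(reg \<Rightarrow> nat) \<times> (nat \<Rightarrow> nat)"

text \<open>\<open>exec c s t s'\<close>: started in state \<open>s\<close>, program \<open>c\<close> halts in state \<open>s'\<close> after \<open>t\<close> steps.\<close>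
inductive exec :: "com \<Rightarrow> state \<Rightarrow> nat \<Rightarrow> state \<Rightarrow> bool" where
  Skip: "exec Skip s 1 s"
| Const: "exec (Const i n) (r, m) 1 (r(i := n), m)"
| Add: "exec (Add i j k) (r, m) 1 (r(i := r j + r k), m)"
| Sub: "exec (Sub i j k) (r, m) 1 (r(i := r j - r k), m)"
| Load: "exec (Load i j) (r, m) 1 (r(i := m (r j)), m)"
| Store: "exec (Store i j) (r, m) 1 (r, m(r i := r j))"
| Seq: "exec c s t s' \<Longrightarrow> exec c' s' t' s'' \<Longrightarrow> exec (Seq c c') s (t + t') s''"
| IfTrue: "r i > 0 \<Longrightarrow> exec c (r, m) t s' \<Longrightarrow> exec (IfPos i c c') (r, m) (1 + t) s'"
| IfFalse: "r i = 0 \<Longrightarrow> exec c' (r, m) t s' \<Longrightarrow> exec (IfPos i c c') (r, m) (1 + t) s'"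
| WhileFalse: "r i = 0 \<Longrightarrow> exec (WhilePos i c) (r, m) 1 (r, m)"
| WhileTrue: "r i > 0 \<Longrightarrow> exec c (r, m) t s' \<Longrightarrow> exec (WhilePos i c) s' t' s'' \<Longrightarrow>
    exec (WhilePos i c) (r, m) (1 + t + t') s''"

inductive_cases exec_SkipE: "exec Skip s t s'"
inductive_cases exec_ConstE: "exec (Const i n) s t s'"
inductive_cases exec_AddE: "exec (Add i j k) s t s'"
inductive_cases exec_SubE: "exec (Sub i j k) s t s'"
inductive_cases exec_LoadE: "exec (Load i j) s t s'"
inductive_cases exec_StoreE: "exec (Store i j) s t s'"
inductive_cases exec_SeqE: "exec (Seq c c') s t s'"
inductive_cases exec_IfE: "exec (IfPos i c c') s t s'"
inductive_cases exec_WhileE: "exec (WhilePos i c) s t s'"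

lemmas exec_elims = exec_SkipE exec_ConstE exec_AddE exec_SubE exec_LoadE exec_StoreE exec_SeqE
  exec_IfE

lemma exec_deterministic:
  "exec c s t s' \<Longrightarrow> exec c s u s'' \<Longrightarrow> u = t \<and> s'' = s'"
proof (induction arbitrary: u s'' rule: exec.induct)
  case (Seq c s t s' c' t' s1)
  from Seq.prems obtain t1 s2 t2
    where "exec c s t1 s2" "exec c' s2 t2 s''" "u = t1 + t2" by (rule exec_SeqE)
  with Seq.IH(1)[of t1 s2] Seq.IH(2)[of t2 s''] show ?case by simp
next
  case (IfTrue r i c m t s' c')
  from IfTrue.prems IfTrue.hyps obtain t1 where "exec c (r, m) t1 s''" "u = 1 + t1"
    by (elim exec_IfE) auto
  with IfTrue.IH[of t1 s''] show ?case by simp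
next
  case (IfFalse r i c' m t s' c)
  from IfFalse.prems IfFalse.hyps obtain t1 where "exec c' (r, m) t1 s''" "u = 1 + t1"
    by (elim exec_IfE) auto
  with IfFalse.IH[of t1 s''] show ?case by simp
next
  case (WhileFalse r i c m)
  from WhileFalse.prems show ?case by (rule exec_WhileE) (use WhileFalse.hyps in simp_all)
next
  case (WhileTrue r i c m t s' t' s1)
  from WhileTrue.prems obtain t1 s2 t2
    where "exec c (r, m) t1 s2" "exec (WhilePos i c) s2 t2 s''" "u = 1 + t1 + t2"
    by (rule exec_WhileE) (use WhileTrue.hyps in auto)
  with WhileTrue.IH(1)[of t1 s2] WhileTrue.IH(2)[of t2 s''] show ?case by simp
qed (erule exec_elims; simp)+

text \<open>
  On input \<open>N\<close> and \<open>A \<subseteq> {0..<N}\<close>, register \<open>0\<close> holds \<open>N\<close>, memory cells \<open>0, \<dots>, N - 1\<close> hold the indicator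
  function of \<open>A\<close>, and everything else is \<open>0\<close>.
\<close>
definition input_state :: "nat \<Rightarrow> int set \<Rightarrow> state" where
  "input_state N A = ((\<lambda>i. if i = 0 then N else 0), (\<lambda>j. if int j \<in> A then 1 else 0))"

text \<open>The answer, \<open>1\<close> for yes and \<open>0\<close> for no, is left in register \<open>0\<close>.\<close>
definition decides_within :: "com \<Rightarrow> state \<Rightarrow> nat \<Rightarrow> bool \<Rightarrow> bool" where
  "decides_within c s b Q \<longleftrightarrow>
     (\<exists>t \<le> b. \<exists>r m. exec c s t (r, m) \<and> r 0 = (if Q then 1 else 0))"

end

theory Submission
  imports Defs "HOL-Library.FuncSet"
begin

text \<open>
  A pair of families \<open>A\<close>, \<open>B\<close> tiles \<open>\<int>/N\<close> if and only if \<open>|A| |B| = N\<close> and \<open>A(z) B(z) = 0\<close> for all \<open>z \<noteq> 1\<close> with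
  \<open>z\<^sup>N = 1\<close>. Under the two conditions a complement of \<open>A\<close> is a product of polynomials \<open>\<Phi>\<^sub>s(X\<^sup>t)\<close>. Conversely, in a
  tiling every prime power \<open>s\<close> dividing \<open>N\<close> belongs to \<open>S\<^sub>A\<close> or \<open>S\<^sub>B\<close>, the primes below \<open>S\<^sub>A\<close> have a product that
  divides \<open>|A|\<close>, likewise for \<open>B\<close>, and the primes below all \<open>s\<close> have the product \<open>N\<close>; this forces equality.

  A tile may be dilated by any number coprime to its size (Tijdeman). Hence the primes that do not divide
  \<open>|A|\<close> can be removed from \<open>N\<close>. If \<open>N\<close> has at most two prime factors, one of the tiles lies in a single class
  modulo a prime \<open>l\<close> dividing \<open>N\<close> (Sands), and the tiling decomposes into tilings of \<open>\<int>/(N/l)\<close>, to which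
  induction applies.

  For the algorithm, \<open>\<Phi>\<^sub>d\<close> divides \<open>A(X)\<close> if and only if the sum of \<open>|A(z)|\<^sup>2\<close> over the primitive \<open>d\<close>-th roots of
  unity vanishes. The sum over all \<open>d\<close>-th roots of unity is \<open>d\<close> times the number of pairs in \<open>A\<close> that are
  congruent modulo \<open>d\<close>, so that the sums over primitive roots are natural numbers that can be tabulated
  recursively.
\<close>

section \<open>Roots of unity\<close>

text \<open>Tiles are indexed families of integers rather than sets: a dilation keeps the index set
  and hence the size, and the distinctness of the dilated residues comes out as a conclusion. The
  induction for two primes lives on exclusion: a prime power dividing N belongs to only one of the
  two sets, so a vanishing known in the large tiling can be carried down to the smaller ones. Item 3
  combines two facts: a complement modulo N repeats periodically over the integers, and (T2) passes
  to the subset S_A^N of S_A; (T1^N) comes from item 2. The machine only adds and subtracts, so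
  products, divisibility and primality are all loops. The criteria are therefore brought into a form
  with bounded sums and quantifiers: (T1^N) compares, prime by prime, the number of prime powers
  dividing |A| with the number of those in S_A^N, and exact powers are described by divisibility.
  One compiler for such terms yields the program, its correctness and its polynomial running time
  together.\<close>

lemma primitive_roots_unity_iff:
  assumes "n > 0"
  shows "z \<in> primitive_roots_unity n \<longleftrightarrow> (\<forall>m. z ^ m = 1 \<longleftrightarrow> n dvd m)"
proof
  assume z: "z \<in> primitive_roots_unity n"
  show "\<forall>m. z ^ m = 1 \<longleftrightarrow> n dvd m"
  proof (intro allI iffI)
    fix m assume "z ^ m = 1"
    have "z ^ m = z ^ (n * (m div n) + m mod n)" by simp
    also have "\<dots> = z ^ (m mod n)"
      using z by (simp only: power_add power_mult) (simp add: primitive_roots_unity_def)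
    finally have "z ^ (m mod n) = 1" using \<open>z ^ m = 1\<close> by simp
    moreover have "m mod n < n" using assms by simp
    ultimately have "m mod n = 0" using z unfolding primitive_roots_unity_def by fastforce
    then show "n dvd m" by (simp add: dvd_eq_mod_eq_0)
  next
    fix m assume "n dvd m"
    then show "z ^ m = 1" using z by (auto simp: primitive_roots_unity_def power_mult)
  qed
next
  assume z: "\<forall>m. z ^ m = 1 \<longleftrightarrow> n dvd m"
  then have "z ^ n = 1" by simp
  moreover have "z ^ m \<noteq> 1" if "0 < m" "m < n" for m
    using z that by (auto dest: dvd_imp_le)
  ultimately show "z \<in> primitive_roots_unity n" by (simp add: primitive_roots_unity_def)
qed

lemma primitive_root_power_eq_1_iff:
  "n > 0 \<Longrightarrow> z \<in> primitive_roots_unity n \<Longrightarrow> z ^ m = 1 \<longleftrightarrow> n dvd m"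
  by (simp add: primitive_roots_unity_iff)

lemma primitive_root_power_eq_1: "z \<in> primitive_roots_unity n \<Longrightarrow> z ^ n = 1"
  by (simp add: primitive_roots_unity_def)

lemma root_unity_nonzero: "(z :: complex) ^ n = 1 \<Longrightarrow> n > 0 \<Longrightarrow> z \<noteq> 0"
  by (auto simp: power_0_left)

lemma root_unity_powi_cong:
  fixes z :: complex
  assumes "z ^ n = 1" "n > 0" "[a = b] (mod int n)"
  shows "z powi a = z powi b"
proof -
  from assms(3) obtain k where k: "b = a + int n * k"
    by (auto simp: cong_iff_lin)
  have "z powi b = z powi a * (z powi int n) powi k"
    using root_unity_nonzero[OF assms(1,2)] unfolding k
    by (simp add: power_int_add power_int_mult)
  then show ?thesis using assms(1) by simp
qed

lemma primitive_root_powi_eq_1_iff: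
  assumes "n > 0" "z \<in> primitive_roots_unity n"
  shows "z powi k = 1 \<longleftrightarrow> int n dvd k"
proof -
  have "z powi k = z powi (k mod int n)"
    using assms by (intro root_unity_powi_cong[of _ n]) (auto simp: primitive_roots_unity_def)
  also have "\<dots> = z ^ nat (k mod int n)"
    using assms(1) by (simp add: power_int_def)
  also have "\<dots> = 1 \<longleftrightarrow> n dvd nat (k mod int n)"
    using assms by (rule primitive_root_power_eq_1_iff)
  also have "\<dots> \<longleftrightarrow> int n dvd k mod int n"
    using assms(1) by (metis int_dvd_int_iff nat_0_le of_nat_0_less_iff pos_mod_sign)
  finally show ?thesis by (simp add: dvd_mod_iff)
qed

lemma primitive_root_cis: "n > 0 \<Longrightarrow> cis (2 * pi / real n) \<in> primitive_roots_unity n"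
proof -
  assume n: "n > 0"
  let ?f = "\<lambda>k. cis (2 * pi * real k / real n)"
  have inj: "inj_on ?f {..<n}" using bij_betw_roots_unity[OF n] by (simp add: bij_betw_def)
  have pow: "cis (2 * pi / real n) ^ k = ?f k" for k
    by (simp add: DeMoivre mult_ac)
  have "cis (2 * pi / real n) ^ m \<noteq> 1" if "0 < m" "m < n" for m
    using inj_onD[OF inj, of m 0] that pow by auto
  then show ?thesis using n by (simp add: primitive_roots_unity_def DeMoivre)
qed

lemma primitive_roots_unity_nonempty: "n > 0 \<Longrightarrow> primitive_roots_unity n \<noteq> {}"
  using primitive_root_cis by blast

lemma powers_of_primitive_root:
  assumes "n > 0" "z \<in> primitive_roots_unity n"
  shows "(\<lambda>k. z ^ k) ` {..<n} = {w. w ^ n = 1}"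
proof (rule card_subset_eq)
  show "finite {w :: complex. w ^ n = 1}" using assms by (intro finite_roots_unity) auto
  have z1: "z ^ n = 1" using assms by (simp add: primitive_roots_unity_def)
  show "(\<lambda>k. z ^ k) ` {..<n} \<subseteq> {w. w ^ n = 1}"
    using z1 by (auto simp: power_mult[symmetric] mult.commute[of _ n] power_mult[of z n])
  have "inj_on (\<lambda>k. z ^ k) {..<n}"
  proof (rule linorder_inj_onI)
    fix a b assume ab: "a < b" "a \<in> {..<n}" "b \<in> {..<n}"
    have "z ^ b = z ^ a * z ^ (b - a)" using ab by (simp flip: power_add)
    moreover have "z ^ (b - a) \<noteq> 1"
      using ab primitive_root_power_eq_1_iff[OF assms] by (auto dest: dvd_imp_le)
    ultimately show "z ^ a \<noteq> z ^ b" using root_unity_nonzero[OF z1 assms(1)] by simp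
  qed auto
  then show "card ((\<lambda>k. z ^ k) ` {..<n}) = card {w :: complex. w ^ n = 1}"
    using assms by (simp add: card_image card_roots_unity_eq)
qed

lemma primitive_root_power:
  assumes "n > 0" "z \<in> primitive_roots_unity n"
  shows "z ^ k \<in> primitive_roots_unity (n div gcd n k)"
proof -
  let ?g = "gcd n k"
  have g: "?g > 0" using assms by simp
  then have pos: "n div ?g > 0" using assms by (simp add: div_greater_zero_iff dvd_imp_le)
  have "(z ^ k) ^ m = 1 \<longleftrightarrow> n div ?g dvd m" for m
  proof -
    have "(z ^ k) ^ m = 1 \<longleftrightarrow> n dvd k * m"
      using assms by (simp add: primitive_root_power_eq_1_iff flip: power_mult)
    also have "\<dots> \<longleftrightarrow> ?g * (n div ?g) dvd ?g * ((k div ?g) * m)"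
      by (simp only: mult.assoc[symmetric] dvd_mult_div_cancel gcd_dvd1 gcd_dvd2)
    also have "\<dots> \<longleftrightarrow> n div ?g dvd (k div ?g) * m"
      using g by (rule nat_mult_dvd_cancel1)
    also have "\<dots> \<longleftrightarrow> n div ?g dvd m"
      using assms by (intro coprime_dvd_mult_right_iff) (auto intro: div_gcd_coprime)
    finally show ?thesis .
  qed
  with pos show ?thesis by (simp add: primitive_roots_unity_iff)
qed

text \<open>This supplies the exponent of the dilation that moves one primitive root to another: the
  order of \<open>z ^ r\<close> is n / gcd(n, r), so it equals n only for r coprime to n.\<close>

lemma primitive_roots_conjugate:
  assumes "n > 0" "z \<in> primitive_roots_unity n" "w \<in> primitive_roots_unity n"
  obtains r where "coprime r n" "w = z ^ r"
proof -
  have "w \<in> (\<lambda>k. z ^ k) ` {..<n}"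
    using powers_of_primitive_root[OF assms(1,2)] assms(3) by (simp add: primitive_roots_unity_def)
  then obtain r where r: "w = z ^ r" by auto
  have "w \<in> primitive_roots_unity (n div gcd n r)"
    unfolding r using assms by (intro primitive_root_power)
  moreover have "n div gcd n r > 0" using assms by (simp add: div_greater_zero_iff dvd_imp_le)
  ultimately have "n div gcd n r = n"
    using primitive_roots_unity_disjoint[of "n div gcd n r" n] assms by blast
  then have "gcd n r = 1" using assms(1) by (metis div_eq_dividend_iff)
  with r that show ?thesis by (metis coprime_commute coprime_iff_gcd_eq_1)
qed

lemma sum_roots_unity_powi:
  assumes "n > 0"
  shows "(\<Sum>z | z ^ n = (1 :: complex). z powi k) = (if int n dvd k then of_nat n else 0)"
proof (cases "int n dvd k")
  case True
  have "z powi k = 1" if "z ^ n = 1" for z :: complex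
    using root_unity_powi_cong[of z n k 0] that True assms by (simp add: cong_0_iff)
  then have "(\<Sum>z | z ^ n = (1 :: complex). z powi k) = (\<Sum>z | z ^ n = (1 :: complex). 1)"
    by (intro sum.cong) auto
  then show ?thesis using True assms by (simp add: card_roots_unity_eq)
next
  case False
  obtain w where w: "w \<in> primitive_roots_unity n"
    using primitive_roots_unity_nonempty[OF assms] by blast
  have w0: "w \<noteq> 0" and w1: "w ^ n = 1"
    using w assms by (auto simp: primitive_roots_unity_def power_0_left)
  let ?S = "\<Sum>z | z ^ n = (1 :: complex). z powi k"
  \<comment> \<open>Multiplication by the primitive root w permutes the roots and multiplies the sum
    by \<open>w powi k\<close>, a factor different from 1.\<close>
  have "bij_betw (\<lambda>z. w * z) {z. z ^ n = 1} {z. z ^ n = 1}"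
    by (rule bij_betwI[where g = "\<lambda>z. z / w"]) (use w0 w1 in \<open>auto simp: power_mult_distrib power_divide\<close>)
  then have "?S = (\<Sum>z | z ^ n = (1 :: complex). (w * z) powi k)"
    by (rule sum.reindex_bij_betw[symmetric])
  also have "\<dots> = w powi k * ?S"
    by (simp add: power_int_mult_distrib sum_distrib_left)
  finally have "(1 - w powi k) * ?S = 0" by (simp add: algebra_simps)
  moreover have "w powi k \<noteq> 1"
    using False w assms by (simp add: primitive_root_powi_eq_1_iff)
  ultimately show ?thesis using False by simp
qed

section \<open>Exponential sums\<close>

text \<open>The sum runs over indices, so values of f may repeat, and integer powers admit negative
  exponents; translation becomes multiplication by a power of z.\<close>

definition char_sum :: "('a \<Rightarrow> int) \<Rightarrow> 'a set \<Rightarrow> complex \<Rightarrow> complex" where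
  "char_sum f I z = (\<Sum>x\<in>I. z powi f x)"

text \<open>As the primitive roots are simple roots of \<Phi>_n, this is divisibility by \<Phi>_n
  once the exponents are shifted to be nonnegative
  (\<open>cyclotomic_dvd_mask_poly_iff\<close>).\<close>

definition vanishes :: "('a \<Rightarrow> int) \<Rightarrow> 'a set \<Rightarrow> nat \<Rightarrow> bool" where
  "vanishes f I n \<longleftrightarrow> (\<forall>z\<in>primitive_roots_unity n. char_sum f I z = 0)"

lemma char_sum_1 [simp]: "char_sum f I 1 = of_nat (card I)"
  by (simp add: char_sum_def)

text \<open>Fourier inversion on the cyclic group of order N: by orthogonality the sum over z keeps
  exactly the indices with \<open>f x\<close> congruent to c.\<close>

lemma fourier_count:
  assumes "N > 0" "finite I"
  shows "(\<Sum>z | z ^ N = (1 :: complex). z powi (- c) * char_sum f I z) =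
    of_nat (N * card {x \<in> I. [f x = c] (mod int N)})"
proof -
  have nz: "z \<noteq> 0" if "z ^ N = 1" for z :: complex
    using that assms(1) by (rule root_unity_nonzero)
  have "(\<Sum>z | z ^ N = (1 :: complex). z powi (- c) * char_sum f I z) =
      (\<Sum>z | z ^ N = (1 :: complex). \<Sum>x\<in>I. z powi (f x - c))"
    using nz by (intro sum.cong) (auto simp: char_sum_def sum_distrib_left power_int_diff
        power_int_minus field_simps)
  also have "\<dots> = (\<Sum>x\<in>I. \<Sum>z | z ^ N = (1 :: complex). z powi (f x - c))"
    by (rule sum.swap)
  also have "\<dots> = (\<Sum>x\<in>I. if [f x = c] (mod int N) then of_nat N else 0)"
    using assms(1) by (intro sum.cong refl) (simp only: sum_roots_unity_powi cong_iff_dvd_diff)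
  also have "\<dots> = of_nat (N * card {x \<in> I. [f x = c] (mod int N)})"
    using assms(2) by (simp add: sum.If_cases Int_def mult.commute)
  finally show ?thesis .
qed

lemma char_sum_times:
  assumes "z \<noteq> 0"
  shows "char_sum f I z * char_sum g J z = char_sum (\<lambda>(x, y). f x + g y) (I \<times> J) z"
  using assms
  by (simp add: char_sum_def sum_product sum.cartesian_product power_int_add case_prod_unfold)

lemma char_sum_shift: "z \<noteq> 0 \<Longrightarrow> char_sum (\<lambda>x. f x + k) I z = z powi k * char_sum f I z"
  by (simp add: char_sum_def power_int_add sum_distrib_left mult.commute)

lemma char_sum_dilate: "char_sum (\<lambda>x. int r * f x) I z = char_sum f I (z ^ r)"
  by (simp add: char_sum_def power_int_mult)

lemma vanishes_shift: 
  assumes "n > 0"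
  shows "vanishes (\<lambda>x. f x + k) I n \<longleftrightarrow> vanishes f I n"
proof -
  have "z \<noteq> 0" if "z \<in> primitive_roots_unity n" for z
    using root_unity_nonzero[of z n] that assms by (simp add: primitive_roots_unity_def)
  then show ?thesis by (auto simp: vanishes_def char_sum_shift)
qed

section \<open>Tilings by indexed families\<close>

text \<open>Uniqueness is asked of index pairs, which excludes congruent values at distinct indices.
  Letting c range over all integers avoids representatives of residues.\<close>

definition tiling :: "nat \<Rightarrow> ('a \<Rightarrow> int) \<Rightarrow> 'a set \<Rightarrow> ('b \<Rightarrow> int) \<Rightarrow> 'b set \<Rightarrow> bool" where
  "tiling N f I g J \<longleftrightarrow> N > 0 \<and> finite I \<and> finite J \<and>
     (\<forall>c. \<exists>!x. x \<in> I \<times> J \<and> [f (fst x) + g (snd x) = c] (mod int N))"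

lemma tilingD:
  assumes "tiling N f I g J"
  shows "N > 0" "finite I" "finite J"
  using assms by (auto simp: tiling_def)

lemma tiling_inj:
  assumes "tiling N f I g J" "x \<in> I" "x' \<in> I" "y \<in> J" "y' \<in> J"
    "[f x + g y = f x' + g y'] (mod int N)"
  shows "x = x' \<and> y = y'"
proof -
  have "\<exists>!p. p \<in> I \<times> J \<and> [f (fst p) + g (snd p) = f x' + g y'] (mod int N)"
    using assms(1) unfolding tiling_def by blast
  then have "(x, y) = (x', y')"
    by (rule ex1E) (metis (no_types, lifting) assms(2-6) SigmaI cong_refl fst_conv snd_conv)
  then show ?thesis by simp
qed

lemma tiling_ex:
  assumes "tiling N f I g J"
  obtains x y where "x \<in> I" "y \<in> J" "[f x + g y = c] (mod int N)"
  using assms unfolding tiling_def by (metis mem_Times_iff)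

lemma tiling_iff:
  "tiling N f I g J \<longleftrightarrow> N > 0 \<and> finite I \<and> finite J \<and>
     (\<forall>c. \<exists>x\<in>I. \<exists>y\<in>J. [f x + g y = c] (mod int N)) \<and>
     (\<forall>x\<in>I. \<forall>x'\<in>I. \<forall>y\<in>J. \<forall>y'\<in>J. [f x + g y = f x' + g y'] (mod int N) \<longrightarrow> x = x' \<and> y = y')"
  (is "?L \<longleftrightarrow> ?R")
proof
  assume ?L
  then show ?R
    by (meson tilingD tiling_ex tiling_inj)
next
  assume R: ?R
  have "\<exists>!x. x \<in> I \<times> J \<and> [f (fst x) + g (snd x) = c] (mod int N)" for c
  proof -
    obtain x y where xy: "x \<in> I" "y \<in> J" "[f x + g y = c] (mod int N)" using R by meson
    show ?thesis
    proof (rule ex1I[of _ "(x, y)"])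
      fix p assume p: "p \<in> I \<times> J \<and> [f (fst p) + g (snd p) = c] (mod int N)"
      then have "[f (fst p) + g (snd p) = f x + g y] (mod int N)"
        using xy(3) by (meson cong_sym cong_trans)
      then have "fst p = x \<and> snd p = y"
        using R p xy by (auto simp: mem_Times_iff)
      then show "p = (x, y)" by (simp add: prod_eq_iff)
    qed (use xy in auto)
  qed
  with R show ?L unfolding tiling_def by blast
qed

lemma tiling_commute: "tiling N f I g J \<Longrightarrow> tiling N g J f I"
  unfolding tiling_iff by (simp add: add.commute) meson

lemma tiling_shift:
  assumes "tiling N f I g J"
  shows "tiling N (\<lambda>x. f x + k) I g J"
  unfolding tiling_iff
proof (intro conjI ballI allI impI)
  fix c
  obtain x y where "x \<in> I" "y \<in> J" "[f x + g y = c - k] (mod int N)"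
    using tiling_ex[OF assms] by metis
  moreover from this(3) have "[f x + k + g y = c] (mod int N)"
    by (simp add: cong_iff_dvd_diff algebra_simps)
  ultimately show "\<exists>x\<in>I. \<exists>y\<in>J. [f x + k + g y = c] (mod int N)" by blast
next
  fix x x' y y' assume *: "x \<in> I" "x' \<in> I" "y \<in> J" "y' \<in> J" "[f x + k + g y = f x' + k + g y'] (mod int N)"
  have "[f x + g y = f x' + g y'] (mod int N)"
    using *(5) by (simp add: cong_iff_dvd_diff algebra_simps)
  from tiling_inj[OF assms *(1-4) this] show "x = x'" "y = y'" by auto
qed (use tilingD[OF assms] in auto)

lemma tiling_char_sum:
  assumes "tiling N f I g J" "z ^ N = 1"
  shows "char_sum f I z * char_sum g J z = (if z = 1 then of_nat N else 0)"
proof -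
  have N: "N > 0" using assms by (simp add: tiling_def)
  have z0: "z \<noteq> 0" using assms(2) N by (rule root_unity_nonzero)
  let ?h = "\<lambda>p. nat ((f (fst p) + g (snd p)) mod int N)"
  have bij: "bij_betw ?h (I \<times> J) {..<N}"
  proof (rule bij_betwI')
    fix p q assume pq: "p \<in> I \<times> J" "q \<in> I \<times> J"
    have "?h p = ?h q \<longleftrightarrow> [f (fst p) + g (snd p) = f (fst q) + g (snd q)] (mod int N)"
      using N by (simp add: cong_def eq_nat_nat_iff)
    also have "\<dots> \<longleftrightarrow> p = q"
      using tiling_inj[OF assms(1), of "fst p" "fst q" "snd p" "snd q"] pq
      by (auto simp: prod_eq_iff)
    finally show "?h p = ?h q \<longleftrightarrow> p = q" .
  next
    fix p assume "p \<in> I \<times> J"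
    show "?h p \<in> {..<N}" using N by (simp add: nat_less_iff)
  next
    fix k assume k: "k \<in> {..<N}"
    obtain x y where "x \<in> I" "y \<in> J" "[f x + g y = int k] (mod int N)"
      using tiling_ex[OF assms(1)] by metis
    then show "\<exists>p\<in>I \<times> J. k = ?h p"
      using k by (intro bexI[of _ "(x, y)"]) (auto simp: cong_def)
  qed
  have "char_sum f I z * char_sum g J z = (\<Sum>p\<in>I \<times> J. z powi (f (fst p) + g (snd p)))"
    using z0 by (simp add: char_sum_times case_prod_unfold) (simp add: char_sum_def)
  also have "\<dots> = (\<Sum>p\<in>I \<times> J. z ^ ?h p)"
  proof (rule sum.cong)
    fix p
    have "z powi (f (fst p) + g (snd p)) = z powi ((f (fst p) + g (snd p)) mod int N)"
      by (rule root_unity_powi_cong[OF assms(2) N]) simp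
    then show "z powi (f (fst p) + g (snd p)) = z ^ ?h p"
      using N by (simp add: power_int_def)
  qed simp
  also have "\<dots> = (\<Sum>k<N. z ^ k)"
    using bij by (rule sum.reindex_bij_betw)
  also have "\<dots> = (if z = 1 then of_nat N else 0)"
    using assms(2) by (simp add: geometric_sum)
  finally show ?thesis .
qed

lemma tiling_card: "tiling N f I g J \<Longrightarrow> card I * card J = N"
  using tiling_char_sum[of N f I g J 1] by (simp flip: of_nat_mult)

text \<open>The product of the two sums belongs to the family of all \<open>f x + g y\<close>. The
  values N at 1 and 0 elsewhere are the transform of the constant function 1, so inversion returns
  the count 1 for every residue.\<close>

lemma tiling_iff_char_sum:
  assumes "N > 0" "finite I" "finite J"
  shows "tiling N f I g J \<longleftrightarrow> card I * card J = N \<and>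
    (\<forall>z. z ^ N = 1 \<longrightarrow> z \<noteq> 1 \<longrightarrow> char_sum f I z * char_sum g J z = 0)"
proof (intro iffI conjI allI impI)
  assume *: "card I * card J = N \<and>
    (\<forall>z. z ^ N = 1 \<longrightarrow> z \<noteq> 1 \<longrightarrow> char_sum f I z * char_sum g J z = 0)"
  have "\<exists>!x. x \<in> I \<times> J \<and> [f (fst x) + g (snd x) = c] (mod int N)" for c
  proof -
    let ?h = "\<lambda>p. f (fst p) + g (snd p)"
    have "of_nat (N * card {p \<in> I \<times> J. [?h p = c] (mod int N)}) =
        (\<Sum>z | z ^ N = (1 :: complex). z powi (- c) * char_sum ?h (I \<times> J) z)"
      using assms by (intro fourier_count[symmetric]) auto
    also have "\<dots> = (\<Sum>z | z ^ N = (1 :: complex). if z = 1 then of_nat N else 0)"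
    proof (rule sum.cong)
      fix z assume z: "z \<in> {z :: complex. z ^ N = 1}"
      then have z0: "z \<noteq> 0" using assms(1) root_unity_nonzero by blast
      show "z powi (- c) * char_sum ?h (I \<times> J) z = (if z = 1 then of_nat N else 0)"
      proof (cases "z = 1")
        case True
        then show ?thesis using * by (auto simp: card_cartesian_product)
      next
        case False
        have "char_sum f I z * char_sum g J z = 0" using False * z by simp
        then have "char_sum ?h (I \<times> J) z = 0"
          using char_sum_times[OF z0, of f I g J] by (simp add: case_prod_unfold)
        then show ?thesis using False by simp
      qed
    qed simp
    also have "\<dots> = of_nat N"
      using finite_roots_unity[of N, where 'a = complex] assms(1) by (subst sum.delta) auto
    finally have "card {p \<in> I \<times> J. [?h p = c] (mod int N)} = 1"
      using assms(1) by (simp flip: of_nat_mult)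
    then obtain p where p: "{p \<in> I \<times> J. [?h p = c] (mod int N)} = {p}"
      by (auto simp: card_1_singleton_iff)
    have iff: "x \<in> I \<times> J \<and> [f (fst x) + g (snd x) = c] (mod int N) \<longleftrightarrow> x = p" for x
      using p by (cases x) (simp add: set_eq_iff)
    show ?thesis unfolding iff by simp
  qed
  then show "tiling N f I g J" using assms unfolding tiling_def by blast
qed (simp_all add: tiling_char_sum tiling_card)

section \<open>The Frobenius congruence and the dilation of tiles\<close>

lemma power_prime_add:
  fixes a b :: "'a :: comm_ring_1"
  assumes "prime r"
  shows "\<exists>w. (a + b) ^ r = a ^ r + b ^ r + of_nat r * w"
proof -
  have r: "r > 0" using assms prime_gt_0_nat by blast
  have "(a + b) ^ r = (\<Sum>k\<le>r. of_nat (r choose k) * a ^ k * b ^ (r - k))"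
    by (rule binomial_ring)
  also have "{..r} = insert 0 (insert r {0<..<r})" using r by auto
  also have "(\<Sum>k\<in>\<dots>. of_nat (r choose k) * a ^ k * b ^ (r - k)) =
      a ^ r + b ^ r + (\<Sum>k\<in>{0<..<r}. of_nat (r choose k) * a ^ k * b ^ (r - k))"
    using r by simp
  also have "(\<Sum>k\<in>{0<..<r}. of_nat (r choose k) * a ^ k * b ^ (r - k)) =
      (\<Sum>k\<in>{0<..<r}. of_nat r * (of_nat ((r choose k) div r) * a ^ k * b ^ (r - k)))"
  proof (rule sum.cong)
    fix k assume "k \<in> {0<..<r}"
    then have "r dvd r choose k" using assms by (intro dvd_choose_prime) auto
    then have "of_nat (r choose k) = (of_nat r * of_nat ((r choose k) div r) :: 'a)"
      by (simp flip: of_nat_mult)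
    then show "of_nat (r choose k) * a ^ k * b ^ (r - k) =
        of_nat r * (of_nat ((r choose k) div r) * a ^ k * b ^ (r - k))"
      by (simp add: mult.assoc)
  qed simp
  finally show ?thesis by (auto simp: sum_distrib_left[symmetric])
qed

lemma power_prime_sum:
  fixes a :: "'i \<Rightarrow> 'a :: comm_ring_1"
  assumes "prime r" "finite I"
  shows "\<exists>w. (\<Sum>i\<in>I. a i) ^ r = (\<Sum>i\<in>I. a i ^ r) + of_nat r * w"
  using assms(2)
proof (induction I rule: finite_induct)
  case empty
  then show ?case using assms(1) by (auto simp: power_0_left intro!: exI[of _ 0])
next
  case (insert i I)
  obtain w where w: "(\<Sum>i\<in>I. a i) ^ r = (\<Sum>i\<in>I. a i ^ r) + of_nat r * w"
    using insert.IH by blast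
  obtain v where v: "(a i + (\<Sum>i\<in>I. a i)) ^ r = a i ^ r + (\<Sum>i\<in>I. a i) ^ r + of_nat r * v"
    using power_prime_add[OF assms(1)] by blast
  show ?case
    using insert.hyps v w by (auto simp: algebra_simps intro!: exI[of _ "v + w"])
qed

text \<open>The Frobenius congruence for integer polynomials, evaluated at roots of unity. One
  integer polynomial V serves for all z; this uniformity is what makes the error an integer multiple
  of r after Fourier inversion.\<close>

lemma char_sum_power_prime:
  assumes "N > 0" "finite I" "prime r"
  shows "\<exists>V :: int poly. \<forall>z. z ^ N = 1 \<longrightarrow> char_sum f I z ^ r =
    char_sum (\<lambda>x. int r * f x) I z + of_nat r * (\<Sum>i\<le>degree V. of_int (coeff V i) * z ^ i)"
proof -
  \<comment> \<open>Reducing the exponents modulo N gives a polynomial and does not change the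
    values at N-th roots of unity.\<close>
  define P where "P = (\<Sum>x\<in>I. monom (1 :: int) (nat (f x mod int N)))"
  define ev :: "int poly \<Rightarrow> complex \<Rightarrow> complex" where "ev p z = poly (map_poly of_int p) z" for p z
  have ev: "ev p z = (\<Sum>i\<le>degree p. of_int (coeff p i) * z ^ i)" for p z
    by (simp add: ev_def poly_altdef degree_map_poly coeff_map_poly)
  have ev_add: "ev (p + q) z = ev p z + ev q z" for p q z
    by (simp add: ev_def map_poly_of_int_add)
  have ev_mult: "ev (p * q) z = ev p z * ev q z" for p q z
    by (simp add: ev_def map_poly_of_int_mult)
  have ev_power: "ev (p ^ k) z = ev p z ^ k" for p k z
    by (induction k) (simp_all add: ev_mult, simp add: ev_def)
  have ev_0: "ev 0 z = 0" for z by (simp add: ev_def)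
  have ev_sum: "ev (\<Sum>x\<in>I. q x) z = (\<Sum>x\<in>I. ev (q x) z)" for q z
    using assms(2) by (induction I rule: finite_induct) (simp_all add: ev_add ev_0)
  have ev_monom: "ev (monom 1 k) z = z ^ k" for k z
    by (simp add: ev_def map_poly_monom poly_monom)
  have ev_nat: "ev (of_nat k) z = of_nat k" for k z
    by (simp add: ev_def of_nat_poly map_poly_pCons)
  obtain V where V: "P ^ r = (\<Sum>x\<in>I. monom (1 :: int) (nat (f x mod int N)) ^ r) + of_nat r * V"
    unfolding P_def using power_prime_sum[OF assms(3,2)] by blast
  show ?thesis
  proof (intro exI[of _ V] allI impI)
    fix z :: complex assume z: "z ^ N = 1"
    have powmod: "z ^ nat (f x mod int N) = z powi f x" for x
    proof -
      have "z powi f x = z powi (f x mod int N)"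
        by (rule root_unity_powi_cong[OF z assms(1)]) simp
      then show ?thesis using assms(1) by (simp add: power_int_def)
    qed
    have "char_sum f I z ^ r = ev (P ^ r) z"
      by (simp add: ev_power P_def ev_sum ev_monom char_sum_def powmod)
    also have "\<dots> = (\<Sum>x\<in>I. (z powi f x) ^ r) + of_nat r * ev V z"
      unfolding V by (simp only: ev_add ev_mult ev_sum ev_power ev_monom ev_nat powmod)
    also have "(\<Sum>x\<in>I. (z powi f x) ^ r) = char_sum (\<lambda>x. int r * f x) I z"
      unfolding char_sum_def
      by (intro sum.cong) (simp_all add: mult.commute[of "int r"] power_int_mult)
    finally show "char_sum f I z ^ r = char_sum (\<lambda>x. int r * f x) I z +
        of_nat r * (\<Sum>i\<le>degree V. of_int (coeff V i) * z ^ i)" by (simp only: ev)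
  qed
qed

text \<open>
  Dilation of one tile by a number coprime to its size (Tijdeman). For a prime \<open>r\<close> the Frobenius congruence
  \<open>A(X)\<^sup>r \<equiv> A(X\<^sup>r)\<close> modulo \<open>r\<close> shows that every residue is represented a number of times that
  is congruent to \<open>|A|\<^sup>r\<^sup>-\<^sup>1\<close>, hence to \<open>1\<close>, modulo \<open>r\<close>; in particular, at least once.
\<close>

lemma tiling_dilate_prime:
  assumes til: "tiling N f I g J" and r: "prime r" "coprime r (card I)"
  shows "tiling N (\<lambda>x. int r * f x) I g J"
proof -
  note N = tilingD(1)[OF til] and fin = tilingD(2,3)[OF til]
  obtain V :: "int poly" where V: "\<And>z. z ^ N = 1 \<Longrightarrow> char_sum f I z ^ r =
      char_sum (\<lambda>x. int r * f x) I z + of_nat r * (\<Sum>i\<le>degree V. of_int (coeff V i) * z ^ i)"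
    using char_sum_power_prime[OF N fin(1) r(1)] by blast
  define ev :: "complex \<Rightarrow> complex" where "ev z = (\<Sum>i\<le>degree V. of_int (coeff V i) * z ^ i)" for z
  note key = V[folded ev_def]
  define cnt where "cnt c = card {p \<in> I \<times> J. [int r * f (fst p) + g (snd p) = c] (mod int N)}" for c
  have cnt_pos: "cnt c > 0" for c
  proof -
    let ?h = "\<lambda>(x, y). int r * f x + g y"
    \<comment> \<open>Inverting the error term gives N * W: the monomial of degree i in V shifts g
      by i, and the shifted family is counted at c.\<close>
    define W where "W = (\<Sum>i\<le>degree V. coeff V i *
        int (card {y \<in> J. [g y + int i = c] (mod int N)}))"
    have nz: "z \<noteq> 0" if "z ^ N = 1" for z :: complex
      using that N by (rule root_unity_nonzero)
    have "of_nat (N * cnt c) =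
        (\<Sum>z | z ^ N = (1 :: complex). z powi (- c) * char_sum ?h (I \<times> J) z)"
      using fin fourier_count[OF N, of "I \<times> J" c ?h] by (simp add: cnt_def case_prod_unfold)
    also have "\<dots> = (\<Sum>z | z ^ N = (1 :: complex).
        (if z = 1 then of_nat (N * card I ^ (r - 1)) else 0) -
        of_nat r * (z powi (- c) * (ev z * char_sum g J z)))"
    proof (rule sum.cong)
      fix z assume "z \<in> {z :: complex. z ^ N = 1}"
      then have z: "z ^ N = 1" by simp
      have r0: "r > 0" using r(1) prime_gt_0_nat by blast
      have "char_sum ?h (I \<times> J) z = char_sum (\<lambda>x. int r * f x) I z * char_sum g J z"
        using nz[OF z] by (simp add: char_sum_times)
      also have "\<dots> = char_sum f I z ^ r * char_sum g J z - of_nat r * (ev z * char_sum g J z)"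
        using key[OF z] by (simp add: algebra_simps)
      also have "char_sum f I z ^ r * char_sum g J z =
          char_sum f I z ^ (r - 1) * (char_sum f I z * char_sum g J z)"
        using r0 by (cases r) simp_all
      also have "\<dots> = (if z = 1 then of_nat (N * card I ^ (r - 1)) else 0)"
        by (simp only: tiling_char_sum[OF til z]) auto
      finally have *: "char_sum ?h (I \<times> J) z =
          (if z = 1 then of_nat (N * card I ^ (r - 1)) else 0) -
          of_nat r * (ev z * char_sum g J z)" .
      show "z powi (- c) * char_sum ?h (I \<times> J) z =
          (if z = 1 then of_nat (N * card I ^ (r - 1)) else 0) -
          of_nat r * (z powi (- c) * (ev z * char_sum g J z))"
        unfolding * by (simp add: algebra_simps)
    qed simp
    also have "\<dots> = of_nat (N * card I ^ (r - 1)) -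
        of_nat r * (\<Sum>z | z ^ N = (1 :: complex). z powi (- c) * (ev z * char_sum g J z))"
      using finite_roots_unity[of N, where 'a = complex] N
      by (simp add: sum_subtractf sum_distrib_left)
    also have "(\<Sum>z | z ^ N = (1 :: complex). z powi (- c) * (ev z * char_sum g J z)) =
        (\<Sum>z | z ^ N = (1 :: complex). \<Sum>i\<le>degree V. of_int (coeff V i) *
          (z powi (- c) * char_sum (\<lambda>y. g y + int i) J z))"
      using nz by (intro sum.cong refl)
        (simp add: ev_def sum_distrib_left sum_distrib_right char_sum_shift mult_ac)
    also have "\<dots> = (\<Sum>i\<le>degree V. of_int (coeff V i) * (\<Sum>z | z ^ N = (1 :: complex).
          z powi (- c) * char_sum (\<lambda>y. g y + int i) J z))"
      by (subst sum.swap) (simp add: sum_distrib_left)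
    also have "\<dots> = of_int (int N * W)"
      by (simp only: fourier_count[OF N fin(2)])
        (simp add: W_def sum_distrib_left algebra_simps)
    finally have "(of_int (int (N * cnt c)) :: complex) =
        of_int (int (N * card I ^ (r - 1)) - int r * (int N * W))"
      by simp
    then have "int N * int (cnt c) = int N * (int (card I ^ (r - 1)) - int r * W)"
      unfolding of_int_eq_iff by (simp add: algebra_simps)
    \<comment> \<open>Modulo r the count is |I|^(r - 1), which the prime r does not divide.\<close>
    then have "int (cnt c) = int (card I ^ (r - 1)) - int r * W" using N by simp
    moreover have "\<not> int r dvd int (card I ^ (r - 1))"
    proof
      assume "int r dvd int (card I ^ (r - 1))"
      then have "r dvd card I ^ (r - 1)" by (simp only: int_dvd_int_iff)
      then have "r dvd card I" using r(1) prime_dvd_power by blast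
      then show False using r by (metis coprime_absorb_left not_prime_unit)
    qed
    ultimately have "cnt c \<noteq> 0"
      by (metis dvd_triv_left eq_iff_diff_eq_0 of_nat_0)
    then show ?thesis by simp
  qed
  have "(\<Sum>c<N. cnt (int c)) = card I * card J"
  proof -
    have "I \<times> J = (\<Union>c\<in>{..<N}. {p \<in> I \<times> J. [int r * f (fst p) + g (snd p) = int c] (mod int N)})"
    proof (intro equalityI subsetI)
      fix p assume "p \<in> I \<times> J"
      then show "p \<in> (\<Union>c\<in>{..<N}. {p \<in> I \<times> J. [int r * f (fst p) + g (snd p) = int c] (mod int N)})"
        using N by (auto simp: nat_less_iff
            intro!: bexI[of _ "nat ((int r * f (fst p) + g (snd p)) mod int N)"])
    qed auto
    then have "card (I \<times> J) = card \<dots>" by (rule arg_cong)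
    also have "\<dots> = (\<Sum>c<N. cnt (int c))"
      unfolding cnt_def
    proof (rule card_UN_disjoint)
      show "\<forall>i\<in>{..<N}. \<forall>j\<in>{..<N}. i \<noteq> j \<longrightarrow>
          {p \<in> I \<times> J. [int r * f (fst p) + g (snd p) = int i] (mod int N)} \<inter>
          {p \<in> I \<times> J. [int r * f (fst p) + g (snd p) = int j] (mod int N)} = {}"
      proof (intro ballI impI)
        fix i j assume ij: "i \<in> {..<N}" "j \<in> {..<N}" "i \<noteq> j"
        have False if "[a = int i] (mod int N)" "[a = int j] (mod int N)" for a
          using ij that by (simp add: cong_def)
        then show "{p \<in> I \<times> J. [int r * f (fst p) + g (snd p) = int i] (mod int N)} \<inter>
          {p \<in> I \<times> J. [int r * f (fst p) + g (snd p) = int j] (mod int N)} = {}" by blast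
      qed
    qed (use fin in auto)
    finally show ?thesis by (simp add: card_cartesian_product)
  qed
  \<comment> \<open>N positive counts whose sum is |I| |J| = N must all be 1.\<close>
  then have sum: "(\<Sum>c<N. cnt (int c)) = (\<Sum>c<N. 1)" using tiling_card[OF til] by simp
  have cnt1: "cnt (int c) = 1" if "c < N" for c
    using sum_mono_inv[of "\<lambda>_. 1" "{..<N}" "\<lambda>c. cnt (int c)" c] sum cnt_pos that
    by (simp add: Suc_le_eq)
  have "\<exists>!p. p \<in> I \<times> J \<and> [int r * f (fst p) + g (snd p) = c] (mod int N)" for c
  proof -
    have "cnt c = cnt (c mod int N)" by (simp add: cnt_def cong_def)
    also have "\<dots> = 1" using cnt1[of "nat (c mod int N)"] N by (simp add: nat_less_iff)
    finally obtain p where p: "{p \<in> I \<times> J. [int r * f (fst p) + g (snd p) = c] (mod int N)} = {p}"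
      unfolding cnt_def by (auto simp: card_1_singleton_iff)
    have iff: "x \<in> I \<times> J \<and> [int r * f (fst x) + g (snd x) = c] (mod int N) \<longleftrightarrow> x = p" for x
      using p by (cases x) (simp add: set_eq_iff)
    show ?thesis unfolding iff by simp
  qed
  then show ?thesis using N fin unfolding tiling_def by blast
qed

text \<open>The prime factors of r are applied one at a time. The index set I does not change, so
  coprimality to \<open>card I\<close> persists.\<close>

lemma tiling_dilate:
  assumes "tiling N f I g J" "r > 0" "coprime r (card I)"
  shows "tiling N (\<lambda>x. int r * f x) I g J"
  using assms(2,3)
proof (induction r rule: prime_divisors_induct)
  case (factor p r)
  then have "tiling N (\<lambda>x. int r * f x) I g J" "coprime p (card I)" by auto
  from tiling_dilate_prime[OF this(1) factor.hyps this(2)] show ?case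
    by (simp add: mult.assoc)
qed (use assms(1) in auto)

text \<open>An exponent between primitive d-th roots is determined only modulo d, while dilation
  needs a number coprime to the size of the tile, a divisor of N. The Chinese remainder theorem
  prescribes r modulo d and 1 modulo the primes of N outside d.\<close>

lemma coprime_lift:
  fixes r d N :: nat
  assumes "coprime r d" "d dvd N" "N > 0"
  shows "\<exists>s > 0. coprime s N \<and> [s = r] (mod d)"
proof -
  define Q where "Q = \<Prod>{q \<in> prime_factors N. \<not> q dvd d}"
  have "coprime d Q"
    unfolding Q_def by (intro prod_coprime_right) (auto simp: prime_imp_coprime coprime_commute in_prime_factors_iff)
  then obtain s where s: "[s = r] (mod d)" "[s = 1] (mod Q)"
    using binary_chinese_remainder_nat by blast
  have "coprime s N"
  proof (rule ccontr)
    assume "\<not> coprime s N"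
    then obtain q where q: "prime q" "q dvd s" "q dvd N"
      using prime_factor_nat[of "gcd s N"] by (auto simp: coprime_iff_gcd_eq_1)
    show False
    proof (cases "q dvd d")
      case True
      then have "q dvd r" using s(1) q(2) by (meson cong_dvd_iff cong_dvd_modulus_nat)
      with True assms(1) q(1) show False by (meson coprime_common_divisor not_prime_unit)
    next
      case False
      then have "q dvd Q"
        unfolding Q_def using q assms(3) by (intro dvd_prod_eqI) (auto simp: in_prime_factors_iff)
      then have "q dvd 1" using s(2) q(2) by (meson cong_dvd_iff cong_dvd_modulus_nat)
      with q(1) show False by simp
    qed
  qed
  \<comment> \<open>Adding N preserves the residue modulo d and coprimality to N, and makes the
    number positive.\<close>
  moreover have "[s + N = r] (mod d)" 
    using cong_add[OF s(1), of N 0] assms(2) by (simp add: cong_0_iff)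
  ultimately show ?thesis using assms(3) by (intro exI[of _ "s + N"]) (simp add: coprime_iff_gcd_eq_1)
qed

text \<open>
  This replaces the irreducibility of \<open>\<Phi>\<^sub>d\<close>: if \<open>A(w\<^sup>s) \<noteq> 0\<close> and \<open>B(w) \<noteq> 0\<close> for primitive \<open>d\<close>-th roots of unity \<open>w\<close> and
  \<open>w\<^sup>s\<close>, then the tiling obtained from the dilation of \<open>A\<close> by \<open>s\<close> violates \<open>A(w\<^sup>s) B(w) = 0\<close>.
\<close>

lemma tiling_vanishes:
  assumes til: "tiling N f I g J" and d: "d dvd N" "d > 1"
  shows "vanishes f I d \<or> vanishes g J d"
proof (rule ccontr)
  assume "\<not> ?thesis"
  then obtain z w where z: "z \<in> primitive_roots_unity d" "char_sum f I z \<noteq> 0"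
    and w: "w \<in> primitive_roots_unity d" "char_sum g J w \<noteq> 0"
    by (auto simp: vanishes_def)
  note N = tilingD(1)[OF til]
  obtain r where r: "coprime r d" "z = w ^ r"
    using primitive_roots_conjugate[OF _ w(1) z(1)] d by auto
  obtain s where s: "s > 0" "coprime s N" "[s = r] (mod d)"
    using coprime_lift[OF r(1) d(1) N] by blast
  have "coprime s (card I)"
    using s(2) tiling_card[OF til] by auto
  from tiling_dilate[OF til s(1) this]
  have til': "tiling N (\<lambda>x. int s * f x) I g J" .
  have wN: "w ^ N = 1" and w1: "w \<noteq> 1"
    using w(1) d primitive_root_power_eq_1_iff[of d w N] primitive_root_power_eq_1_iff[of d w 1]
    by auto
  have "w ^ s = w ^ r"
    using root_unity_powi_cong[of w d "int s" "int r"] s(3) w(1) d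
    by (simp add: cong_int_iff primitive_roots_unity_def)
  then have "char_sum (\<lambda>x. int s * f x) I w = char_sum f I z"
    by (simp add: char_sum_dilate r(2))
  with tiling_char_sum[OF til' wN] w1 z(2) w(2) show False by simp
qed

section \<open>Divisibility by cyclotomic polynomials\<close>

lemma prod_linear_dvd_iff:
  fixes q :: "'a :: field poly"
  assumes "finite Z"
  shows "(\<Prod>z\<in>Z. [:- z, 1:]) dvd q \<longleftrightarrow> (\<forall>z\<in>Z. poly q z = 0)"
proof
  assume "(\<Prod>z\<in>Z. [:- z, 1:]) dvd q"
  then obtain k where k: "q = (\<Prod>z\<in>Z. [:- z, 1:]) * k" by (elim dvdE)
  have "(\<Prod>w\<in>Z. poly [:- w, 1:] z) = 0" if "z \<in> Z" for z
    using assms that by (intro prod_zero) auto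
  then show "\<forall>z\<in>Z. poly q z = 0" by (simp add: k poly_prod)
next
  show "\<forall>z\<in>Z. poly q z = 0 \<Longrightarrow> (\<Prod>z\<in>Z. [:- z, 1:]) dvd q"
    using assms
  proof (induction Z arbitrary: q rule: finite_induct)
    case (insert w Z)
    then obtain k where k: "q = (\<Prod>z\<in>Z. [:- z, 1:]) * k" by (metis dvdE insertI2)
    have "poly (\<Prod>z\<in>Z. [:- z, 1:]) w \<noteq> 0"
      using insert.hyps by (auto simp: poly_prod)
    moreover have "poly q w = 0" using insert.prems by simp
    ultimately have "poly k w = 0" by (simp add: k)
    then have "[:- w, 1:] dvd k" by (simp add: poly_eq_0_iff_dvd)
    then have "[:- w, 1:] * (\<Prod>z\<in>Z. [:- z, 1:]) dvd q"
      unfolding k by (metis dvd_refl mult.commute mult_dvd_mono)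
    then show ?case using insert.hyps by (subst prod.insert)
  qed simp
qed

text \<open>Pseudo-division by a monic polynomial is division with remainder over the integers. If Q
  divides P over the complex numbers, it divides the remainder, whose degree is too small unless it
  is 0.\<close>

lemma of_int_poly_dvd_iff_monic:
  fixes P Q :: "int poly"
  assumes "lead_coeff Q = 1"
  shows "(map_poly of_int Q :: complex poly) dvd map_poly of_int P \<longleftrightarrow> Q dvd P"
proof
  let ?h = "map_poly of_int :: int poly \<Rightarrow> complex poly"
  have deg: "degree (?h p) = degree p" for p by (rule degree_map_poly) auto
  have Q0: "Q \<noteq> 0" using assms by auto
  obtain T R where TR: "pseudo_divmod P Q = (T, R)" by (cases "pseudo_divmod P Q")
  have eq: "P = Q * T + R" and R: "R = 0 \<or> degree R < degree Q"
    using pseudo_divmod[OF Q0 TR] assms by auto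
  assume "?h Q dvd ?h P"
  then have dvd: "?h Q dvd ?h R"
    by (simp add: eq map_poly_of_int_add map_poly_of_int_mult dvd_add_right_iff)
  have "?h R = 0"
  proof (rule ccontr)
    assume nz: "?h R \<noteq> 0"
    then have "degree Q \<le> degree R" using dvd_imp_degree_le[OF dvd] deg by simp
    with nz R show False by auto
  qed
  then have "R = 0" using map_poly_of_int_inject[of R 0, where 'a = complex] by simp
  with eq show "Q dvd P" by simp
next
  assume "Q dvd P"
  then show "(map_poly of_int Q :: complex poly) dvd map_poly of_int P"
    by (auto simp: map_poly_of_int_mult)
qed

lemma lead_coeff_cyclotomic: "n > 0 \<Longrightarrow> lead_coeff (cyclotomic n) = 1"
proof -
  assume n: "n > 0"
  have "lead_coeff (map_poly of_int (cyclotomic n) :: complex poly) = 1"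
    by (simp only: of_int_cyclotomic[OF n]) (simp add: lead_coeff_prod)
  moreover have "degree (map_poly of_int (cyclotomic n) :: complex poly) = degree (cyclotomic n)"
    by (rule degree_map_poly) auto
  ultimately show ?thesis by (simp add: coeff_map_poly)
qed

text \<open>Distinct orders give disjoint sets of simple roots, so vanishing on all of them yields
  divisibility by the whole product and not just by each factor.\<close>

lemma prod_cyclotomic_dvd_iff:
  assumes "finite D" "\<And>d. d \<in> D \<Longrightarrow> d > 0"
  shows "(\<Prod>d\<in>D. cyclotomic d) dvd P \<longleftrightarrow>
    (\<forall>d\<in>D. \<forall>z\<in>primitive_roots_unity d. poly (map_poly of_int P) z = 0)"
proof -
  have "(\<Prod>d\<in>D. cyclotomic d) dvd P \<longleftrightarrow>
      (map_poly of_int (\<Prod>d\<in>D. cyclotomic d) :: complex poly) dvd map_poly of_int P"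
    using assms by (intro of_int_poly_dvd_iff_monic[symmetric])
      (simp add: lead_coeff_prod lead_coeff_cyclotomic)
  also have "(map_poly of_int (\<Prod>d\<in>D. cyclotomic d) :: complex poly) =
      (\<Prod>d\<in>D. \<Prod>z\<in>primitive_roots_unity d. [:- z, 1:])"
    unfolding map_poly_of_int_prod using assms(2) by (intro prod.cong) (simp_all add: of_int_cyclotomic)
  also have "\<dots> = (\<Prod>z\<in>(\<Union>d\<in>D. primitive_roots_unity d). [:- z, 1:])"
    using assms finite_primitive_roots_unity primitive_roots_unity_disjoint
    by (intro prod.UNION_disjoint[symmetric]) auto
  also have "\<dots> dvd map_poly of_int P \<longleftrightarrow>
      (\<forall>z\<in>(\<Union>d\<in>D. primitive_roots_unity d). poly (map_poly of_int P) z = 0)"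
    using assms finite_primitive_roots_unity by (intro prod_linear_dvd_iff) auto
  finally show ?thesis by blast
qed

text \<open>For s = p * m the roots of X^s - 1 are those of X^m - 1 and the primitive ones, so
  \<Phi>_s is the sum of X^(m i) over i < p.\<close>

lemma poly_cyclotomic_primepow:
  assumes "primepow s"
  shows "poly (cyclotomic s) 1 = int (aprimedivisor s)"
proof -
  obtain p k where p: "prime p" "k > 0" "s = p ^ k"
    using assms by (auto simp: primepow_def)
  define m where "m = p ^ (k - 1)"
  have m: "m > 0" "s = p * m" "s > 0"
    using p prime_gt_0_nat[OF p(1)] by (auto simp: m_def simp flip: power_Suc)
  have split: "{z :: complex. z ^ s = 1} = {z. z ^ m = 1} \<union> primitive_roots_unity s"
  proof (intro equalityI subsetI)
    fix z :: complex assume "z \<in> {z. z ^ s = 1}"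
    then obtain d where d: "d dvd s" "z \<in> primitive_roots_unity d"
      using roots_unity_eq_UN_primitive[OF m(3)] by auto
    then obtain j where j: "j \<le> k" "d = p ^ j" using p by (auto simp: divides_primepow_nat)
    \<comment> \<open>Every divisor of p^k other than p^k itself divides p^(k - 1).\<close>
    have "d = s \<or> d dvd m"
    proof (cases "j = k")
      case False
      then show ?thesis using j unfolding m_def by (simp add: le_imp_power_dvd)
    qed (use j p in auto)
    then show "z \<in> {z. z ^ m = 1} \<union> primitive_roots_unity s"
      using d(2) by (auto simp: primitive_roots_unity_def power_mult)
  qed (auto simp: m(2) primitive_roots_unity_def power_mult mult.commute[of p])
  have disj: "{z :: complex. z ^ m = 1} \<inter> primitive_roots_unity s = {}"
    using m p(1) prime_gt_1_nat[OF p(1)] by (auto simp: primitive_roots_unity_def)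
  have finm: "finite {z :: complex. z ^ m = 1}"
    using m(1) by (intro finite_roots_unity) auto
  have "(monom 1 m - 1) * (\<Prod>z\<in>primitive_roots_unity s. [:- z, 1:]) = (monom 1 s - 1 :: complex poly)"
    unfolding prod_linear_roots_unity[OF m(1), symmetric] prod_linear_roots_unity[OF m(3), symmetric]
      split
    using finm finite_primitive_roots_unity[OF m(3)] disj
    by (rule prod.union_disjoint[symmetric])
  also have "\<dots> = (monom 1 m - 1) * (\<Sum>i<p. monom 1 m ^ i)"
    using power_diff_1_eq[of "monom (1 :: complex) m" p]
    unfolding m(2) by (simp add: monom_power mult.commute)
  finally have prod: "(monom 1 m - 1) * (\<Prod>z\<in>primitive_roots_unity s. [:- z, 1:]) =
    (monom 1 m - 1) * (\<Sum>i<p. monom (1 :: complex) m ^ i)" .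
  have "coeff (monom 1 m - 1 :: complex poly) m = 1" using m(1) by simp
  then have "(monom 1 m - 1 :: complex poly) \<noteq> 0" by (metis coeff_0 zero_neq_one)
  with prod have "(\<Prod>z\<in>primitive_roots_unity s. [:- z, 1:]) = (\<Sum>i<p. monom (1 :: complex) m ^ i)"
    by (simp only: mult_cancel_left) simp
  then have "poly (map_poly of_int (cyclotomic s)) (1 :: complex) = of_nat p"
    by (simp add: of_int_cyclotomic[OF m(3)] poly_sum poly_monom)
  moreover have "poly (map_poly of_int (cyclotomic s)) (1 :: complex) = of_int (poly (cyclotomic s) 1)"
    by (simp add: poly_altdef degree_map_poly coeff_map_poly)
  ultimately have "poly (cyclotomic s) 1 = int p"
    by (metis of_int_eq_iff of_int_of_nat_eq)
  then show ?thesis using p by (simp add: aprimedivisor_prime_power)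
qed

section \<open>Evaluation at 1: vanishing at prime powers and the size of a tile\<close>

lemma poly_sum_monom_eq_char_sum:
  assumes "finite I" "\<And>x. x \<in> I \<Longrightarrow> m \<le> f x"
  shows "poly (map_poly of_int (\<Sum>x\<in>I. monom 1 (nat (f x - m)))) z = char_sum (\<lambda>x. f x + (- m)) I z"
proof -
  have "poly (map_poly of_int (\<Sum>x\<in>I. monom 1 (nat (f x - m)))) z = (\<Sum>x\<in>I. z ^ nat (f x - m))"
    using assms(1)
    by (induction I rule: finite_induct)
      (simp_all add: map_poly_of_int_add map_poly_monom poly_monom)
  also have "\<dots> = char_sum (\<lambda>x. f x + (- m)) I z"
    unfolding char_sum_def using assms(2) by (intro sum.cong) (simp_all add: power_int_def)
  finally show ?thesis .
qed

text \<open>The product of the \<Phi>_s divides the shifted mask polynomial with an integral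
  quotient; evaluating at 1 turns this into a divisibility of integers.\<close>

lemma prod_aprimedivisor_dvd_card:
  assumes I: "finite I" and S: "finite S" "\<And>s. s \<in> S \<Longrightarrow> primepow s \<and> vanishes f I s"
  shows "(\<Prod>s\<in>S. aprimedivisor s) dvd card I"
proof (cases "I = {}")
  case False
  define m where "m = Min (f ` I)"
  define P where "P = (\<Sum>x\<in>I. monom (1 :: int) (nat (f x - m)))"
  have ev: "poly (map_poly of_int P) z = char_sum (\<lambda>x. f x + (- m)) I z" for z :: complex
    unfolding P_def m_def using I by (intro poly_sum_monom_eq_char_sum) auto
  have "(\<Prod>s\<in>S. cyclotomic s) dvd P"
  proof (subst prod_cyclotomic_dvd_iff)
    show "\<forall>d\<in>S. \<forall>z\<in>primitive_roots_unity d. poly (map_poly of_int P) z = 0"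
      unfolding ev using S(2) vanishes_shift[of _ f "- m" I] primepow_gt_0_nat
      by (auto simp: vanishes_def)
  qed (use S primepow_gt_0_nat in auto)
  then obtain Q where Q: "P = (\<Prod>s\<in>S. cyclotomic s) * Q" by (elim dvdE)
  have "int (card I) = poly P 1" by (simp add: P_def poly_sum poly_monom)
  also have "\<dots> = int (\<Prod>s\<in>S. aprimedivisor s) * poly Q 1"
    unfolding Q using S(2) by (simp add: poly_prod poly_cyclotomic_primepow)
  finally have "int (\<Prod>s\<in>S. aprimedivisor s) dvd int (card I)" by simp
  then show ?thesis by (simp only: int_dvd_int_iff)
qed simp

text \<open>Each prime p is counted once for every p^j dividing n with j positive.\<close>

lemma prod_aprimedivisor_primepow_factors:
  "n > 0 \<Longrightarrow> (\<Prod>s\<in>primepow_factors n. aprimedivisor s) = (n :: nat)"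
  using aprimedivisor_primepow_factors_conv_prime_factorization[of n]
    prod_mset_prime_factorization_nat[of n]
  by (simp add: prod_unfold_prod_mset)

text \<open>The first claim is (T1) for the tile. The exclusion in the second drives the inductive
  step for two primes.\<close>

lemma tiling_primepow:
  assumes til: "tiling N f I g J"
  defines "S \<equiv> {s \<in> primepow_factors N. vanishes f I s}"
  shows "card I = (\<Prod>s\<in>S. aprimedivisor s)"
    and "\<And>s. s \<in> primepow_factors N \<Longrightarrow> \<not> (vanishes f I s \<and> vanishes g J s)"
proof -
  let ?p = "aprimedivisor :: nat \<Rightarrow> nat"
  note N = tilingD(1)[OF til] and fin = tilingD(2,3)[OF til]
  define T where "T = {s \<in> primepow_factors N. vanishes g J s}"
  have finF: "finite (primepow_factors N)" using N by (simp add: finite_primepow_factors)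
  then have finST: "finite S" "finite T" by (auto simp: S_def T_def)
  have pp: "primepow s" if "s \<in> S \<union> T" for s using that by (auto simp: S_def T_def primepow_factors_def)
  have gt: "?p s > 1" if "s \<in> S \<union> T" for s
    using pp[OF that] prime_gt_1_nat by (auto simp: primepow_def aprimedivisor_prime_power)
  have un: "primepow_factors N = S \<union> T"
  proof -
    have "vanishes f I s \<or> vanishes g J s" if "s \<in> primepow_factors N" for s
      using that tiling_vanishes[OF til] primepow_gt_Suc_0 by (auto simp: primepow_factors_def)
    then show ?thesis by (auto simp: S_def T_def)
  qed
  have le: "prod ?p S \<le> card I" "prod ?p T \<le> card J"
  proof -
    have "card I > 0" "card J > 0"
      using tiling_card[OF til] N by (auto intro: Nat.gr0I)
    moreover have "prod ?p S dvd card I" "prod ?p T dvd card J"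
      using fin finST pp by (auto intro!: prod_aprimedivisor_dvd_card simp: S_def T_def)
    ultimately show "prod ?p S \<le> card I" "prod ?p T \<le> card J" by (auto intro: dvd_imp_le)
  qed
  \<comment> \<open>Prime powers in both sets are counted twice on the right. Since the right side
    is at most N, the product over the intersection is at most 1, and all its factors exceed
    1.\<close>
  have "N * prod ?p (S \<inter> T) = prod ?p S * prod ?p T"
    using prod.union_inter[OF finST, of ?p] prod_aprimedivisor_primepow_factors[OF N] un by simp
  also have "\<dots> \<le> card I * card J" using le by (intro mult_mono) auto
  also have "\<dots> = N" by (rule tiling_card[OF til])
  finally have le1: "prod ?p (S \<inter> T) \<le> 1" using N by simp
  have inter: "S \<inter> T = {}"
  proof (rule ccontr)
    assume "S \<inter> T \<noteq> {}"
    then obtain s where s: "s \<in> S \<inter> T" by blast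
    have "prod ?p (S \<inter> T) > 0"
      by (rule prod_pos) (metis IntD1 UnI1 gt less_trans zero_less_one)
    then have "?p s \<le> prod ?p (S \<inter> T)"
      using s finST by (intro dvd_imp_le dvd_prodI) auto
    then show False using le1 gt[of s] s by auto
  qed
  then show "\<not> (vanishes f I s \<and> vanishes g J s)" if "s \<in> primepow_factors N" for s
    using that by (auto simp: S_def T_def)
  have eq: "prod ?p S * prod ?p T = card I * card J"
    using prod.union_disjoint[OF finST inter, of ?p] prod_aprimedivisor_primepow_factors[OF N] un
      tiling_card[OF til] by simp
  show "card I = prod ?p S"
  proof (rule ccontr)
    assume "card I \<noteq> prod ?p S"
    then have "prod ?p S < card I" using le by simp
    moreover have "card J > 0" using tiling_card[OF til] N by (auto intro: Nat.gr0I)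
    ultimately have "prod ?p S * card J < card I * card J" by simp
    moreover have "prod ?p S * prod ?p T \<le> prod ?p S * card J" using le(2) by simp
    ultimately show False using eq by simp
  qed
qed

section \<open>Tilings of cyclic groups whose order has two prime factors\<close>

text \<open>As d divides every value of g, a sum is congruent to k modulo d exactly when
  \<open>f x\<close> is. Hence this class of I and J together tile the coset of k, which is rescaled
  by d.\<close>

lemma tiling_subtiling:
  assumes til: "tiling N f I g J" and d: "d dvd N" and g: "\<And>y. y \<in> J \<Longrightarrow> int d dvd g y"
  shows "tiling (N div d) (\<lambda>x. (f x - k) div int d) {x \<in> I. [f x = k] (mod int d)}
    (\<lambda>y. g y div int d) J"
proof -
  note N = tilingD(1)[OF til] and fin = tilingD(2,3)[OF til]
  have d0: "d > 0" using d N dvd_pos_nat by blast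
  let ?M = "int (N div d)" and ?f = "\<lambda>x. (f x - k) div int d" and ?g = "\<lambda>y. g y div int d"
  let ?I = "{x \<in> I. [f x = k] (mod int d)}"
  have NM: "int N = int d * ?M" using d by (simp flip: of_nat_mult)
  have f_eq: "f x = k + int d * ?f x" if "x \<in> ?I" for x
    using that by (simp add: cong_iff_dvd_diff)
  have g_eq: "g y = int d * ?g y" if "y \<in> J" for y
    using g[OF that] by simp
  have scale: "[int d * a = int d * b] (mod int N) \<longleftrightarrow> [a = b] (mod ?M)" for a b
    using d0 by (simp add: NM cong_iff_dvd_diff flip: right_diff_distrib)
  show ?thesis
    unfolding tiling_iff
  proof (intro conjI ballI allI impI)
    show "N div d > 0" using d N d0 by (simp add: div_greater_zero_iff dvd_imp_le)
  next
    fix c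
    obtain x y where xy: "x \<in> I" "y \<in> J" "[f x + g y = k + int d * c] (mod int N)"
      using tiling_ex[OF til] by metis
    have "[f x + g y = k + int d * c] (mod int d)"
      using cong_dvd_modulus[OF xy(3)] d by simp
    moreover have "[f x + g y = f x] (mod int d)"
      using g[OF xy(2)] by (simp add: cong_iff_dvd_diff)
    moreover have "[k + int d * c = k] (mod int d)"
      by (simp add: cong_iff_dvd_diff)
    ultimately have "[f x = k] (mod int d)" by (meson cong_sym cong_trans)
    then have x: "x \<in> ?I" using xy by simp
    have "[(k + int d * ?f x) + int d * ?g y = k + int d * c] (mod int N)"
      using xy(3) f_eq[OF x] g_eq[OF xy(2)] by simp
    then have "[int d * (?f x + ?g y) = int d * c] (mod int N)"
      by (simp add: cong_iff_dvd_diff algebra_simps)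
    then have "[?f x + ?g y = c] (mod ?M)" by (simp only: scale)
    then show "\<exists>x\<in>?I. \<exists>y\<in>J. [?f x + ?g y = c] (mod ?M)" using x xy(2) by blast
  next
    fix x x' y y'
    assume *: "x \<in> ?I" "x' \<in> ?I" "y \<in> J" "y' \<in> J" "[?f x + ?g y = ?f x' + ?g y'] (mod ?M)"
    then have "[int d * (?f x + ?g y) = int d * (?f x' + ?g y')] (mod int N)"
      by (simp only: scale)
    then have "[(k + int d * ?f x) + int d * ?g y = (k + int d * ?f x') + int d * ?g y'] (mod int N)"
      by (simp add: cong_iff_dvd_diff algebra_simps)
    then have "[f x + g y = f x' + g y'] (mod int N)"
      using f_eq[OF *(1)] f_eq[OF *(2)] g_eq[OF *(3)] g_eq[OF *(4)] by simp
    from tiling_inj[OF til _ _ *(3,4) this] * show "x = x'" "y = y'" by auto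
  qed (use fin in auto)
qed

text \<open>Take a, b that differ modulo p. If they agree modulo q, take c that differs from a,
  hence from b, modulo q; modulo p it cannot agree with both. With three primes this fails: the
  residues (0,0,0), (0,1,1), (1,0,1), (1,1,0) agree pairwise in one place.\<close>

lemma unit_difference:
  fixes f :: "'a \<Rightarrow> int"
  assumes p: "\<nexists>k. \<forall>x\<in>I. [f x = k] (mod int p)" and q: "\<nexists>k. \<forall>x\<in>I. [f x = k] (mod int q)"
  shows "\<exists>x\<in>I. \<exists>x'\<in>I. \<not> [f x = f x'] (mod int p) \<and> \<not> [f x = f x'] (mod int q)"
proof -
  obtain a where a: "a \<in> I" using p by blast
  obtain b where b: "b \<in> I" "\<not> [f b = f a] (mod int p)" using p by blast
  show ?thesis
  proof (cases "[f b = f a] (mod int q)")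
    case True
    obtain c where c: "c \<in> I" "\<not> [f c = f a] (mod int q)" using q by blast
    then have "\<not> [f c = f b] (mod int q)" using True by (simp add: cong_def)
    show ?thesis
    proof (cases "[f c = f a] (mod int p)")
      case True
      then have "\<not> [f c = f b] (mod int p)" using b(2) by (simp add: cong_def)
      then show ?thesis using b(1) c(1) \<open>\<not> [f c = f b] (mod int q)\<close> by blast
    qed (use a c in blast)
  qed (use a b in blast)
qed

lemma coprime_int_if_two_primes:
  assumes "\<And>r. prime r \<Longrightarrow> r dvd N \<Longrightarrow> r = p \<or> r = q"
    "\<not> int p dvd u" "\<not> int q dvd u"
  shows "coprime u (int N)"
proof (rule ccontr)
  assume "\<not> coprime u (int N)"
  then obtain c where c: "c dvd u" "c dvd int N" "\<not> is_unit c" by (rule not_coprimeE)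
  have "nat \<bar>c\<bar> \<noteq> 1" using c(3) by auto
  then obtain r where r: "prime r" "r dvd nat \<bar>c\<bar>" using prime_factor_nat by blast
  from r(2) have rc: "int r dvd c" by simp
  then have "r dvd N" using c(2) dvd_trans int_dvd_int_iff by blast
  then have "r = p \<or> r = q" using assms(1) r(1) by blast
  moreover have "int r dvd u" using rc c(1) by (rule dvd_trans)
  ultimately show False using assms(2,3) by blast
qed

text \<open>
  Sands' theorem. Otherwise both tiles have a difference that is a unit modulo \<open>N\<close>, and dilating one tile
  by the quotient of these units yields a tiling with a common difference.
\<close>

lemma sands:
  assumes til: "tiling N f I g J"
    and pq: "prime p" "prime q" "p dvd N" "q dvd N"
    and primes: "\<And>r. prime r \<Longrightarrow> r dvd N \<Longrightarrow> r = p \<or> r = q"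
  shows "\<exists>l\<in>{p, q}. (\<exists>k. \<forall>x\<in>I. [f x = k] (mod int l)) \<or> (\<exists>k. \<forall>y\<in>J. [g y = k] (mod int l))"
proof (rule ccontr)
  assume neg: "\<not> ?thesis"
  note N = tilingD(1)[OF til]
  have N1: "N > 1" using pq N by (metis dvd_imp_le le_trans not_less prime_gt_1_nat le_antisym less_irrefl_nat)
  have coprime: "coprime (a - b) (int N)"
    if "\<not> [a = b] (mod int p)" "\<not> [a = b] (mod int q)" for a b
    using coprime_int_if_two_primes[of N p q "a - b"] primes that by (simp add: cong_iff_dvd_diff)
  obtain x x' where x: "x \<in> I" "x' \<in> I" "coprime (f x - f x') (int N)"
    using unit_difference[of I f p q] neg coprime by blast
  obtain y y' where y: "y \<in> J" "y' \<in> J" "coprime (g y - g y') (int N)"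
    using unit_difference[of J g p q] neg coprime by blast
  let ?u = "f x - f x'" and ?v = "g y - g y'"
  obtain w where w: "[?u * w = 1] (mod int N)"
    using cong_solve_coprime_int[OF x(3)] by blast
  define r where "r = nat ((w * ?v) mod int N)"
  have r_eq: "int r = (w * ?v) mod int N" using N by (simp add: r_def)
  have "coprime w (int N)"
    using w by (metis cong_imp_coprime cong_sym coprime_1_left coprime_mult_left_iff)
  then have "coprime (w * ?v) (int N)" using y(3) by simp
  then have "coprime (int r) (int N)"
    unfolding r_eq by (metis cong_imp_coprime cong_mod_left cong_refl cong_sym)
  then have r: "coprime r N" by simp
  have "r > 0" using r N1 by (auto intro: Nat.gr0I)
  moreover have "coprime r (card I)" using r tiling_card[OF til] by auto
  ultimately have til': "tiling N (\<lambda>x. int r * f x) I g J" by (rule tiling_dilate[OF til])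
  have "[int r * ?u = w * ?v * ?u] (mod int N)"
    unfolding r_eq by (intro cong_mult) auto
  also have "w * ?v * ?u = ?u * w * ?v" by simp
  also have "[?u * w * ?v = 1 * ?v] (mod int N)" using w by (intro cong_mult) auto
  \<comment> \<open>The equation r * (f x - f x') = g y - g y' rearranged: one residue is
    represented twice.\<close>
  finally have "[int r * f x + g y' = int r * f x' + g y] (mod int N)"
    by (simp add: cong_iff_dvd_diff algebra_simps)
  from tiling_inj[OF til' x(1,2) y(2,1) this] have "x = x'" by simp
  with x(3) N1 show False by simp
qed

text \<open>This is (T2^N) indexed by the product d of the chosen prime powers: they are recovered
  as the exact powers of the primes dividing d. The form with d suits the passage from N to N /
  l.\<close>

definition products_vanish :: "nat \<Rightarrow> ('a \<Rightarrow> int) \<Rightarrow> 'a set \<Rightarrow> bool" where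
  "products_vanish N f I \<longleftrightarrow> (\<forall>d. d dvd N \<longrightarrow> d > 1 \<longrightarrow>
     (\<forall>p. prime p \<longrightarrow> p dvd d \<longrightarrow> vanishes f I (p ^ multiplicity p d)) \<longrightarrow> vanishes f I d)"

lemma products_vanish_shift:
  assumes "N > 0"
  shows "products_vanish N (\<lambda>x. f x + k) I \<longleftrightarrow> products_vanish N f I"
proof -
  have "vanishes (\<lambda>x. f x + k) I (p ^ m) \<longleftrightarrow> vanishes f I (p ^ m)" if "prime p" for p m
    using that prime_gt_0_nat by (intro vanishes_shift) auto
  moreover have "vanishes (\<lambda>x. f x + k) I d \<longleftrightarrow> vanishes f I d" if "d > 1" for d
    using that by (intro vanishes_shift) auto
  ultimately show ?thesis unfolding products_vanish_def by (metis (no_types, lifting))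
qed

text \<open>If z has order n, then \<open>z ^ l\<close> has order n / gcd(n, l); this places that
  order below N / l.\<close>

lemma div_gcd_prime_dvd:
  fixes n l N :: nat
  assumes "prime l" "l dvd N" "n dvd N"
  shows "n div gcd n l dvd N div l"
proof (cases "l dvd n")
  case True
  then have "gcd n l = l" by (simp add: gcd_nat.absorb2)
  then show ?thesis using True assms by (simp add: div_dvd_div)
next
  case False
  then have "coprime n l" using assms(1) by (simp add: prime_imp_coprime coprime_commute)
  moreover from this have "n dvd N div l"
    using assms by (metis coprime_dvd_mult_left_iff dvd_div_mult_self)
  ultimately show ?thesis by simp
qed

text \<open>The exact prime powers of d / gcd(d, l) are the numbers s / gcd(s, l) for those s of d,
  except that a part equal to l disappears. So descent at prime powers gives descent at d. It is
  applied both to f with one of its classes and to g with g / l.\<close>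

lemma products_vanish_lift:
  assumes l: "prime l" "l dvd N" and PV: "products_vanish (N div l) h' K"
    and comp: "\<And>s. primepow s \<Longrightarrow> s dvd N \<Longrightarrow> s \<noteq> l \<Longrightarrow> vanishes h I s \<Longrightarrow>
      vanishes h' K (s div gcd s l)"
    and d: "d dvd N" "d > 1" "d \<noteq> l"
    and van: "\<And>p. prime p \<Longrightarrow> p dvd d \<Longrightarrow> vanishes h I (p ^ multiplicity p d)"
  shows "vanishes h' K (d div gcd d l)"
proof -
  define d' where "d' = d div gcd d l"
  have g: "gcd d l = 1 \<or> gcd d l = l"
    using l(1) by (metis gcd_dvd2 prime_nat_iff)
  have dd: "d = d' * gcd d l" by (simp add: d'_def)
  have d'1: "d' > 1"
  proof -
    have "d' \<noteq> 0" using dd d by (metis mult_0 not_one_less_zero)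
    moreover have "d' \<noteq> 1" using dd g d by auto
    ultimately show ?thesis by simp
  qed
  have "d' dvd N div l" unfolding d'_def using l d(1) by (rule div_gcd_prime_dvd)
  moreover have "vanishes h' K (r ^ multiplicity r d')" if r: "prime r" "r dvd d'" for r
  proof -
    let ?s = "r ^ multiplicity r d"
    have rd: "r dvd d" using r(2) dd by (metis dvd_mult2)
    have m: "multiplicity r d > 0" using r(1) rd d by (simp add: prime_multiplicity_gt_zero_iff)
    have sN: "?s dvd N" using d(1) multiplicity_dvd dvd_trans by blast
    have pp: "primepow ?s" using r m by simp
    \<comment> \<open>If r = l still divides d', the part of d at l is at least l^2 and loses one
      factor l; the parts at other primes stay the same.\<close>
    have "?s \<noteq> l \<and> ?s div gcd ?s l = r ^ multiplicity r d'"
    proof (cases "r = l")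
      case True
      have "gcd d l = l" using rd True by (simp add: gcd_nat.absorb2)
      then have dd': "d = d' * l" using dd by simp
      have m': "multiplicity l d = Suc (multiplicity l d')"
        using l(1) d'1 unfolding dd' by (simp add: prime_elem_multiplicity_mult_distrib)
      have "multiplicity l d' > 0" using r True d'1 by (simp add: prime_multiplicity_gt_zero_iff)
      then have "l ^ Suc (multiplicity l d') \<noteq> l ^ 1"
        using prime_gt_1_nat[OF l(1)] by (subst power_inject_exp) auto
      then show ?thesis using True m' l(1) prime_gt_0_nat[OF l(1)] by (simp add: gcd_nat.absorb2)
    next
      case False
      then have cop: "coprime r l" using r(1) l(1) by (simp add: primes_coprime)
      then have "coprime ?s l" by simp
      moreover have "multiplicity r d' = multiplicity r d"
      proof -
        have "multiplicity r (gcd d l) = 0"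
          using g False r(1) l(1) by (auto intro!: not_dvd_imp_multiplicity_0 dest: primes_dvd_imp_eq)
        then have "multiplicity r (d' * gcd d l) = multiplicity r d'"
          using r(1) d'1 l(1) by (subst prime_elem_multiplicity_mult_distrib) auto
        then show ?thesis using dd by simp
      qed
      moreover have "?s \<noteq> l"
        using m cop by (metis coprime_power_left_iff coprime_self l(1) not_prime_unit nat_neq_iff)
      ultimately show ?thesis by simp
    qed
    with comp[OF pp sN _ van[OF r(1) rd]] show ?thesis by simp
  qed
  ultimately show ?thesis using PV d'1 unfolding products_vanish_def d'_def by blast
qed

text \<open>The sum of f at z combines the sums of its classes modulo l at \<open>z ^ l\<close>, and
  that of g is the sum of g / l at \<open>z ^ l\<close>. So vanishing at n / gcd(n, l) climbs to n.
  Prime powers are taken down, the induction hypothesis forms the product there, and the result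
  climbs back.\<close>

lemma products_vanish_step:
  fixes f :: "'a \<Rightarrow> int" and g :: "'b \<Rightarrow> int"
  assumes til: "tiling N f I g J" and l: "prime l" "l dvd N"
    and g: "\<And>y. y \<in> J \<Longrightarrow> int l dvd g y"
    and IH: "\<And>(f' :: 'a \<Rightarrow> int) I' (g' :: 'b \<Rightarrow> int). tiling (N div l) f' I' g' J \<Longrightarrow>
      products_vanish (N div l) f' I' \<and> products_vanish (N div l) g' J"
  shows "products_vanish N f I" "products_vanish N g J"
proof -
  note N = tilingD(1)[OF til] and fin = tilingD(2,3)[OF til]
  define Ik where "Ik k = {x \<in> I. [f x = k] (mod int l)}" for k
  define fk where "fk k x = (f x - k) div int l" for k x
  define g' where "g' y = g y div int l" for y
  have l0: "l > 0" using l(1) prime_gt_0_nat by blast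
  have til': "tiling (N div l) (fk k) (Ik k) g' J" for k
    using tiling_subtiling[OF til l(2) g] unfolding Ik_def fk_def g'_def .
  have g_eq: "g y = int l * g' y" if "y \<in> J" for y using g[OF that] by (simp add: g'_def)
  have sum_g: "char_sum g J z = char_sum g' J (z ^ l)" for z
    using g_eq by (simp add: char_sum_def power_int_mult)
  have sum_f: "char_sum f I z = (\<Sum>k<l. z ^ k * char_sum (fk (int k)) (Ik (int k)) (z ^ l))"
    if "z \<noteq> 0" for z
  proof -
    have "I = (\<Union>k\<in>{..<l}. Ik (int k))"
    proof (intro equalityI subsetI)
      fix x assume "x \<in> I"
      then show "x \<in> (\<Union>k\<in>{..<l}. Ik (int k))"
        using l0 by (intro UN_I[of "nat (f x mod int l)"]) (auto simp: Ik_def nat_less_iff)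
    qed (auto simp: Ik_def)
    then have "char_sum f I z = (\<Sum>x\<in>(\<Union>k\<in>{..<l}. Ik (int k)). z powi f x)"
      by (simp add: char_sum_def)
    also have "\<dots> = (\<Sum>k<l. \<Sum>x\<in>Ik (int k). z powi f x)"
    proof (rule sum.UNION_disjoint)
      show "\<forall>i\<in>{..<l}. \<forall>j\<in>{..<l}. i \<noteq> j \<longrightarrow> Ik (int i) \<inter> Ik (int j) = {}"
        by (auto simp: Ik_def cong_def)
    qed (use fin in \<open>auto simp: Ik_def\<close>)
    also have "\<dots> = (\<Sum>k<l. z ^ k * char_sum (fk (int k)) (Ik (int k)) (z ^ l))"
    proof (rule sum.cong)
      fix k
      have "f x = int k + int l * fk (int k) x" if "x \<in> Ik (int k)" for x
        using that by (simp add: Ik_def fk_def cong_iff_dvd_diff)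
      then show "(\<Sum>x\<in>Ik (int k). z powi f x) =
          z ^ k * char_sum (fk (int k)) (Ik (int k)) (z ^ l)"
        using that by (simp add: char_sum_def sum_distrib_left power_int_add power_int_mult)
    qed simp
    finally show ?thesis .
  qed
  have up_g: "vanishes g J n" if "n > 0" "vanishes g' J (n div gcd n l)" for n
    using that primitive_root_power[of n _ l] by (auto simp: vanishes_def sum_g)
  have up_f: "vanishes f I n" if "n > 0" "\<And>k. vanishes (fk k) (Ik k) (n div gcd n l)" for n
    unfolding vanishes_def
  proof
    fix z assume z: "z \<in> primitive_roots_unity n"
    then have "z \<noteq> 0" using that(1) root_unity_nonzero by (auto simp: primitive_roots_unity_def)
    moreover have "char_sum (fk k) (Ik k) (z ^ l) = 0" for k
      using that primitive_root_power[OF that(1) z, of l] by (auto simp: vanishes_def)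
    ultimately show "char_sum f I z = 0" by (simp add: sum_f)
  qed
  have comp: "(vanishes f I s \<longrightarrow> vanishes (fk k) (Ik k) (s div gcd s l)) \<and>
      (vanishes g J s \<longrightarrow> vanishes g' J (s div gcd s l))"
    if s: "primepow s" "s dvd N" "s \<noteq> l" for s k
  proof -
    have s0: "s > 0" using s primepow_gt_0_nat by blast
    have excl: "\<not> (vanishes f I s \<and> vanishes g J s)"
      using tiling_primepow(2)[OF til] s by (simp add: primepow_factors_def)
    have dvd: "s div gcd s l dvd N div l" using l s(2) by (intro div_gcd_prime_dvd)
    have "s div gcd s l > 1"
    proof -
      have "gcd s l = 1 \<or> gcd s l = l" using l(1) by (metis gcd_dvd2 prime_nat_iff)
      moreover have "s = s div gcd s l * gcd s l" by simp
      ultimately have "s div gcd s l \<noteq> 1" "s div gcd s l \<noteq> 0"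
        using s(3) s0 primepow_gt_Suc_0[OF s(1)] by (metis mult_1 mult_0 less_irrefl_nat One_nat_def)+
      then show ?thesis by simp
    qed
    \<comment> \<open>In each small tiling the class or g / l vanishes. If f vanishes at s, then g /
      l cannot, since this would climb to g against exclusion. If g vanishes at s, some class fails
      to vanish, since otherwise f would vanish too.\<close>
    then have or: "vanishes (fk k) (Ik k) (s div gcd s l) \<or> vanishes g' J (s div gcd s l)" for k
      using tiling_vanishes[OF til' dvd] by simp
    show ?thesis
      using or up_g[OF s0] up_f[OF s0] excl by blast
  qed
  have PV: "products_vanish (N div l) (fk k) (Ik k)" "products_vanish (N div l) g' J" for k
    using IH[OF til'] by auto
  show "products_vanish N f I"
    unfolding products_vanish_def
  proof (intro allI impI)
    fix d assume d: "d dvd N" "1 < d"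
      and van: "\<forall>p. prime p \<longrightarrow> p dvd d \<longrightarrow> vanishes f I (p ^ multiplicity p d)"
    show "vanishes f I d"
    proof (cases "d = l")
      case True
      then show ?thesis using van l(1) by (auto simp: multiplicity_self)
    next
      case False
      have "vanishes (fk k) (Ik k) (d div gcd d l)" for k
        using products_vanish_lift[OF l PV(1)[of k], where h = f and I = I and d = d] comp d False van by blast
      then show ?thesis using up_f d by simp
    qed
  qed
  \<comment> \<open>At an l-th root of unity every term of g is 1, so the sum is |J|. This rules out
    d = l for g, the one divisor that does not descend.\<close>
  have "\<not> vanishes g J l"
  proof
    assume *: "vanishes g J l"
    obtain z where z: "z \<in> primitive_roots_unity l"
      using primitive_roots_unity_nonempty[OF l0] by blast
    then have "char_sum g J z = of_nat (card J)" by (simp add: sum_g primitive_root_power_eq_1)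
    then have "card J = 0" using * z by (simp add: vanishes_def)
    then show False using tiling_card[OF til] N by simp
  qed
  then show "products_vanish N g J"
    unfolding products_vanish_def
  proof (intro allI impI)
    fix d assume *: "\<not> vanishes g J l" and d: "d dvd N" "1 < d"
      and van: "\<forall>p. prime p \<longrightarrow> p dvd d \<longrightarrow> vanishes g J (p ^ multiplicity p d)"
    have "d \<noteq> l" using * van l(1) by (auto simp: multiplicity_self)
    then have "vanishes g' J (d div gcd d l)"
      using products_vanish_lift[OF l PV(2), where h = g and I = J and d = d] comp d van by blast
    then show "vanishes g J d" using up_g d by simp
  qed
qed

lemma products_vanish_step_cong:
  fixes f :: "'a \<Rightarrow> int" and g :: "'b \<Rightarrow> int"
  assumes til: "tiling N f I g J" and l: "prime l" "l dvd N"
    and g: "\<And>y. y \<in> J \<Longrightarrow> [g y = k] (mod int l)"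
    and IH: "\<And>(f' :: 'a \<Rightarrow> int) I' (g' :: 'b \<Rightarrow> int). tiling (N div l) f' I' g' J \<Longrightarrow>
      products_vanish (N div l) f' I' \<and> products_vanish (N div l) g' J"
  shows "products_vanish N f I \<and> products_vanish N g J"
proof -
  have til': "tiling N f I (\<lambda>y. g y + (- k)) J"
    by (rule tiling_commute[OF tiling_shift[OF tiling_commute[OF til]]])
  have dvd: "int l dvd g y + (- k)" if "y \<in> J" for y
    using g[OF that] by (simp add: cong_iff_dvd_diff)
  have "products_vanish N f I" "products_vanish N (\<lambda>y. g y + (- k)) J"
    using products_vanish_step[OF til' l dvd IH] by simp_all
  then show ?thesis using products_vanish_shift[OF tilingD(1)[OF til], of g "- k" J] by (simp only: simp_thms)
qed

text \<open>Both tiles are treated together, because the one lying in a single class modulo l may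
  change from one step to the next.\<close>

lemma products_vanish_two_primes:
  fixes f :: "'a \<Rightarrow> int" and g :: "'b \<Rightarrow> int"
  assumes "tiling N f I g J" "\<And>r. prime r \<Longrightarrow> r dvd N \<Longrightarrow> r = p \<or> r = q"
  shows "products_vanish N f I \<and> products_vanish N g J"
  using assms
proof (induction N arbitrary: f I g J rule: less_induct)
  case (less N)
  note til = less.prems(1) and primes = less.prems(2)
  note N = tilingD(1)[OF til]
  show ?case
  proof (cases "N = 1")
    case True
    then show ?thesis by (simp add: products_vanish_def)
  next
    case False
    then obtain r where r: "prime r" "r dvd N" using prime_factor_nat by blast
    \<comment> \<open>Actual prime divisors of N, with p' = q' when N is a prime power.\<close>
    obtain p' q' where pq: "prime p'" "prime q'" "p' dvd N" "q' dvd N"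
      "\<And>r. prime r \<Longrightarrow> r dvd N \<Longrightarrow> r = p' \<or> r = q'"
      using r primes by metis
    obtain l where l: "l \<in> {p', q'}" and
      cls: "(\<exists>k. \<forall>x\<in>I. [f x = k] (mod int l)) \<or> (\<exists>k. \<forall>y\<in>J. [g y = k] (mod int l))"
      using sands[OF til pq] by blast
    have l': "prime l" "l dvd N" using l pq by auto
    have lt: "N div l < N" using N prime_gt_1_nat[OF l'(1)] by (intro div_less_dividend) auto
    have IH: "products_vanish (N div l) f' I' \<and> products_vanish (N div l) g' J'"
      if "tiling (N div l) f' I' g' J'" for f' :: "'a \<Rightarrow> int" and I' and g' :: "'b \<Rightarrow> int" and J'
    proof -
      have "N div l dvd N" using l'(2) by (metis dvd_div_mult_self dvd_triv_left)
      then have "r = p \<or> r = q" if "prime r" "r dvd N div l" for r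
        using primes that dvd_trans by blast
      from less.IH[OF lt that this] show ?thesis .
    qed
    from cls show ?thesis
    proof
      assume "\<exists>k. \<forall>y\<in>J. [g y = k] (mod int l)"
      then obtain k where "\<And>y. y \<in> J \<Longrightarrow> [g y = k] (mod int l)" by blast
      from products_vanish_step_cong[OF til l' this IH] show ?thesis .
    next
      assume "\<exists>k. \<forall>x\<in>I. [f x = k] (mod int l)"
      then obtain k where k: "\<And>x. x \<in> I \<Longrightarrow> [f x = k] (mod int l)" by blast
      have "products_vanish (N div l) g' J' \<and> products_vanish (N div l) f' I"
        if "tiling (N div l) g' J' f' I" for f' :: "'a \<Rightarrow> int" and g' :: "'b \<Rightarrow> int" and J'
        using IH[OF tiling_commute[OF that]] by blast
      from products_vanish_step_cong[OF tiling_commute[OF til] l' k this] show ?thesis by blast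
    qed
  qed
qed

text \<open>Only I has restricted prime factors, so only its complement may change: removing a prime
  from N keeps the family f on I itself.\<close>

lemma products_vanish_card_prime_factors:
  fixes f :: "'a \<Rightarrow> int" and g :: "'b \<Rightarrow> int"
  assumes "tiling N f I g J" "card (prime_factors (card I)) \<le> 2"
  shows "products_vanish N f I"
  using assms(1)
proof (induction N arbitrary: g J rule: less_induct)
  case (less N)
  note til = less.prems
  note N = tilingD(1)[OF til] and fin = tilingD(2,3)[OF til]
  have cI: "card I > 0" using tiling_card[OF til] N by (auto intro: Nat.gr0I)
  show ?case
  proof (cases "\<exists>l. prime l \<and> l dvd N \<and> \<not> l dvd card I")
    case True
    then obtain l where l: "prime l" "l dvd N" "\<not> l dvd card I" by blast
    have l0: "l > 0" using l(1) prime_gt_0_nat by blast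
    \<comment> \<open>After dilation by l all values of the first tile are divisible by l, so it
      plays the part of J in \<open>tiling_subtiling\<close>; dividing by l restores f.\<close>
    have "tiling N (\<lambda>x. int l * f x) I g J"
      using l l0 by (intro tiling_dilate[OF til]) (auto intro: prime_imp_coprime)
    from tiling_subtiling[OF tiling_commute[OF this] l(2), of 0]
    have "tiling (N div l) (\<lambda>x. g x div int l) {x \<in> J. [g x = 0] (mod int l)} f I"
      using l0 by simp
    from less.IH[OF _ tiling_commute[OF this]]
    have PV: "products_vanish (N div l) f I"
      using N prime_gt_1_nat[OF l(1)] by simp
    show ?thesis
      unfolding products_vanish_def
    proof (intro allI impI)
      fix d assume d: "d dvd N" "1 < d"
        and van: "\<forall>p. prime p \<longrightarrow> p dvd d \<longrightarrow> vanishes f I (p ^ multiplicity p d)"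
      \<comment> \<open>Vanishing at a power of l would force l to divide |I|. The divisors that
        matter therefore survive in N / l.\<close>
      have "\<not> l dvd d"
      proof
        assume ld: "l dvd d"
        let ?s = "l ^ multiplicity l d"
        have "multiplicity l d > 0" using l(1) ld d by (simp add: prime_multiplicity_gt_zero_iff)
        then have "primepow ?s" "aprimedivisor ?s = l"
          using l(1) by (simp_all add: aprimedivisor_prime_power)
        then have "l dvd card I"
          using prod_aprimedivisor_dvd_card[OF fin(1), of "{?s}" f] van l(1) ld by auto
        with l(3) show False by simp
      qed
      then have "coprime d l" using prime_imp_coprime[OF l(1)] coprime_commute by blast
      then have "d dvd N div l" using div_gcd_prime_dvd[OF l(1,2) d(1)] by simp
      then show "vanishes f I d" using PV d van unfolding products_vanish_def by blast
    qed
  next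
    case False
    then have sub: "prime_factors N \<subseteq> prime_factors (card I)"
      using cI by (auto simp: in_prime_factors_iff)
    have "card (prime_factors N) \<le> 2"
      using card_mono[OF _ sub] assms(2) by simp
    then obtain p q where "prime_factors N \<subseteq> {p, q}"
    proof -
      assume *: "card (prime_factors N) \<le> 2" and that: "\<And>p q. prime_factors N \<subseteq> {p, q} \<Longrightarrow> thesis"
      have "card (prime_factors N) = 0 \<or> card (prime_factors N) = 1 \<or> card (prime_factors N) = 2"
        using * by linarith
      then show thesis using that by (auto simp: card_1_singleton_iff card_2_iff)
    qed
    then have "r = p \<or> r = q" if "prime r" "r dvd N" for r
      using that N by (auto simp: in_prime_factors_iff)
    then show ?thesis using products_vanish_two_primes[OF til] by blast
  qed
qed

section \<open>The Coven--Meyerowitz conditions in terms of exponential sums\<close>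

lemma cyclotomic_dvd_mask_poly_iff:
  assumes "finite A" "n > 0"
  shows "cyclotomic n dvd mask_poly A \<longleftrightarrow> vanishes (\<lambda>a. a) A n"
proof -
  have "poly (map_poly of_int (mask_poly A)) z = char_sum (\<lambda>a. a + (- Min A)) A z" for z :: complex
    unfolding mask_poly_def using assms(1) by (intro poly_sum_monom_eq_char_sum) auto
  then have "cyclotomic n dvd mask_poly A \<longleftrightarrow> vanishes (\<lambda>a. a + (- Min A)) A n"
    using prod_cyclotomic_dvd_iff[of "{n}" "mask_poly A"] assms(2) by (simp add: vanishes_def)
  then show ?thesis using vanishes_shift[OF assms(2), of "\<lambda>a. a" "- Min A" A] by blast
qed

lemma S_set_mod_eq:
  assumes "finite A"
  shows "S_set_mod N A = {s \<in> primepow_factors N. vanishes (\<lambda>a. a) A s}"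
  using assms cyclotomic_dvd_mask_poly_iff primepow_gt_0_nat
  by (auto simp: S_set_mod_def primepow_factors_def)

lemma T1_mod_iff: "T1_mod N A \<longleftrightarrow> card A = (\<Prod>s\<in>S_set_mod N A. aprimedivisor s)"
proof -
  have "poly (mask_poly A) 1 = int (card A)"
    by (simp add: mask_poly_def poly_sum poly_monom)
  moreover have "(\<Prod>s\<in>S_set_mod N A. poly (cyclotomic s) 1) = int (\<Prod>s\<in>S_set_mod N A. aprimedivisor s)"
    unfolding of_nat_prod
    by (intro prod.cong) (simp_all add: S_set_mod_def poly_cyclotomic_primepow)
  ultimately show ?thesis unfolding cond_T1_def by (simp only: of_nat_eq_iff)
qed

text \<open>Unique factorization: a nonempty choice of powers of distinct primes, all dividing N, is
  the same as a divisor d > 1 of N.\<close>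

lemma T2_mod_iff:
  assumes "finite A" "N > 0"
  shows "T2_mod N A \<longleftrightarrow> products_vanish N (\<lambda>a. a) A"
proof
  let ?f = "\<lambda>a :: int. a"
  assume T2: "T2_mod N A"
  show "products_vanish N ?f A"
    unfolding products_vanish_def
  proof (intro allI impI)
    fix d assume d: "d dvd N" "1 < d"
      and van: "\<forall>p. prime p \<longrightarrow> p dvd d \<longrightarrow> vanishes ?f A (p ^ multiplicity p d)"
    let ?P = "prime_factors d"
    have ne: "?P \<noteq> {}" using d(2) by (auto simp: prime_factorization_empty_iff)
    have mem: "prime p \<and> multiplicity p d \<ge> 1 \<and> p ^ multiplicity p d \<in> S_set_mod N A"
      if "p \<in> ?P" for p
    proof -
      have p: "prime p" "p dvd d" using that by (auto simp: in_prime_factors_iff)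
      then have m: "multiplicity p d \<ge> 1"
        using d(2) by (simp add: Suc_le_eq prime_multiplicity_gt_zero_iff)
      have "p ^ multiplicity p d dvd N" using multiplicity_dvd d(1) by (rule dvd_trans)
      then show ?thesis
        using p m van assms(1) by (auto simp: S_set_mod_eq primepow_factors_def)
    qed
    have "finite ?P \<and> ?P \<noteq> {} \<and>
        (\<forall>p\<in>?P. prime p \<and> multiplicity p d \<ge> 1 \<and> p ^ multiplicity p d \<in> S_set_mod N A)"
      using ne mem by blast
    then have "cyclotomic (\<Prod>p\<in>?P. p ^ multiplicity p d) dvd mask_poly A"
      by (rule mp[OF spec[OF spec[OF T2[unfolded cond_T2_def], of ?P], of "\<lambda>p. multiplicity p d"]])
    moreover have "(\<Prod>p\<in>?P. p ^ multiplicity p d) = d"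
      using d(2) by (intro prime_factorization_nat[symmetric]) simp
    ultimately show "vanishes ?f A d"
      using d(2) assms(1) by (simp add: cyclotomic_dvd_mask_poly_iff)
  qed
next
  let ?f = "\<lambda>a :: int. a"
  assume PV: "products_vanish N ?f A"
  show "T2_mod N A"
    unfolding cond_T2_def
  proof (intro allI impI)
    fix P and e :: "nat \<Rightarrow> nat"
    assume "finite P \<and> P \<noteq> {} \<and> (\<forall>p\<in>P. prime p \<and> 1 \<le> e p \<and> p ^ e p \<in> S_set_mod N A)"
    then have P: "finite P" "P \<noteq> {}" and
      mem: "\<And>p. p \<in> P \<Longrightarrow> prime p" "\<And>p. p \<in> P \<Longrightarrow> 1 \<le> e p" "\<And>p. p \<in> P \<Longrightarrow> p ^ e p \<in> S_set_mod N A"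
      by auto
    define d where "d = (\<Prod>p\<in>P. p ^ e p)"
    have mult: "multiplicity p d = (if p \<in> P then e p else 0)" if "prime p" for p
      unfolding d_def using P mem(1) that by (intro multiplicity_prod_prime_powers) auto
    have d0: "d > 0" unfolding d_def using mem(1) prime_gt_0_nat by (intro prod_pos) auto
    have "d dvd N"
    proof (rule multiplicity_le_imp_dvd)
      fix p :: nat assume p: "prime p"
      show "multiplicity p d \<le> multiplicity p N"
      proof (cases "p \<in> P")
        case True
        then have "p ^ e p dvd N" using mem(3) by (simp add: S_set_mod_def)
        then have "e p \<le> multiplicity p N"
          by (rule multiplicity_geI[rotated 2]) (use prime_gt_1_nat[OF p] assms(2) in simp_all)
        then show ?thesis using True p mult by simp
      qed (simp add: mult[OF p])
    qed (use d0 in simp)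
    moreover have "d > 1"
    proof -
      obtain p where p: "p \<in> P" using P by blast
      then have "multiplicity p d \<noteq> 0" using mult[OF mem(1)[OF p]] mem(2)[OF p] by simp
      then have "d \<noteq> 1" by auto
      then show ?thesis using d0 by simp
    qed
    moreover have "vanishes ?f A (p ^ multiplicity p d)" if p: "prime p" "p dvd d" for p
    proof -
      have "multiplicity p d > 0" using p d0 by (simp add: prime_multiplicity_gt_zero_iff)
      then have "p \<in> P" "multiplicity p d = e p" using mult[OF p(1)] by (auto split: if_splits)
      then show ?thesis using mem(3) assms(1) by (auto simp: S_set_mod_eq)
    qed
    ultimately have "vanishes ?f A d" using PV unfolding products_vanish_def by blast
    then show "cyclotomic (\<Prod>p\<in>P. p ^ e p) dvd mask_poly A"
      using assms(1) d0 by (simp add: cyclotomic_dvd_mask_poly_iff d_def)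
  qed
qed

section \<open>Tilings by sets and tilings by families\<close>

lemma tiles_mod_imp_tiling:
  assumes "tiles_mod N A" "finite A" "N > 0"
  shows "\<exists>B :: int set. tiling N (\<lambda>a. a) A (\<lambda>b. b) B"
proof -
  from assms(1) obtain B where B: "B \<subseteq> {0..<int N} \<and>
      (\<forall>g\<in>{0..<int N}. \<exists>!x. x \<in> A \<times> B \<and> [fst x + snd x = g] (mod int N))"
    unfolding tiles_mod_def by (rule exE)
  have *: "\<exists>!x. x \<in> A \<times> B \<and> [fst x + snd x = c] (mod int N)" for c
  proof -
    have "c mod int N \<in> {0..<int N}" using assms(3) by simp
    from bspec[OF conjunct2[OF B] this] show ?thesis unfolding cong_def by (simp only: mod_mod_trivial)
  qed
  have fin: "finite B" using conjunct1[OF B] by (rule finite_subset) simp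
  have "tiling N (\<lambda>a. a) A (\<lambda>b. b) B" unfolding tiling_def
    by (intro conjI allI assms fin *)
  then show ?thesis by (rule exI)
qed

lemma tiling_imp_tiles_mod:
  fixes A :: "int set"
  assumes til: "tiling N (\<lambda>a. a) A g J"
  shows "tiles_mod N A"
proof -
  note N = tilingD(1)[OF til]
  let ?B = "(\<lambda>y. g y mod int N) ` J"
  have *: "\<exists>!x. x \<in> A \<times> ?B \<and> [fst x + snd x = c] (mod int N)" for c
  proof -
    obtain a y where ay: "a \<in> A" "y \<in> J" "[a + g y = c] (mod int N)"
      using tiling_ex[OF til] by metis
    show ?thesis
    proof (rule ex1I[of _ "(a, g y mod int N)"])
      show "(a, g y mod int N) \<in> A \<times> ?B \<and>
          [fst (a, g y mod int N) + snd (a, g y mod int N) = c] (mod int N)"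
        using ay by (simp add: cong_def mod_add_right_eq)
    next
      fix x assume x: "x \<in> A \<times> ?B \<and> [fst x + snd x = c] (mod int N)"
      then have "snd x \<in> ?B" "fst x \<in> A" by (simp_all only: mem_Times_iff)
      then obtain y' where y': "y' \<in> J" "snd x = g y' mod int N" by (elim imageE)
      have "(fst x + g y' mod int N) mod int N = (a + g y) mod int N"
        using x y'(2) ay(3) unfolding cong_def by simp
      then have "[fst x + g y' = a + g y] (mod int N)"
        by (simp only: cong_def mod_add_right_eq)
      from tiling_inj[OF til \<open>fst x \<in> A\<close> ay(1) y'(1) ay(2) this]
      show "x = (a, g y mod int N)" using y'(2) by (simp add: prod_eq_iff)
    qed
  qed
  have "?B \<subseteq> {0..<int N}" using N by auto
  then show ?thesis unfolding tiles_mod_def by (intro exI[of _ ?B] conjI ballI *)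
qed

text \<open>The complement is extended N-periodically; for given a the second summand must be c - a,
  and the tiling modulo N decides which a is admissible.\<close>

lemma tiling_imp_tiles_int:
  assumes til: "tiling N (\<lambda>a. a) A (g :: 'b \<Rightarrow> int) J"
  shows "tiles_int A"
proof -
  let ?B = "{b. \<exists>y\<in>J. [g y = b] (mod int N)}"
  have *: "\<exists>!x. x \<in> A \<times> ?B \<and> fst x + snd x = c" for c
  proof -
    obtain a y where ay: "a \<in> A" "y \<in> J" "[a + g y = c] (mod int N)"
      using tiling_ex[OF til] by metis
    show ?thesis
    proof (rule ex1I[of _ "(a, c - a)"])
      have "[g y = c - a] (mod int N)"
        using ay(3) by (simp add: cong_iff_dvd_diff algebra_simps)
      then show "(a, c - a) \<in> A \<times> ?B \<and> fst (a, c - a) + snd (a, c - a) = c"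
        using ay(1,2) by (simp add: bexI[of _ y])
    next
      fix x assume x: "x \<in> A \<times> ?B \<and> fst x + snd x = c"
      then have fx: "fst x \<in> A" and "snd x \<in> ?B" by (simp_all only: mem_Times_iff)
      then obtain y' where y': "y' \<in> J" "[g y' = snd x] (mod int N)" by blast
      have "[fst x + g y' = fst x + snd x] (mod int N)"
        by (rule cong_add[OF cong_refl y'(2)])
      then have "[fst x + g y' = a + g y] (mod int N)"
        unfolding conjunct2[OF x] by (rule cong_trans[OF _ cong_sym[OF ay(3)]])
      from tiling_inj[OF til fx ay(1) y'(1) ay(2) this]
      show "x = (a, c - a)" using conjunct2[OF x] by (simp add: prod_eq_iff)
    qed
  qed
  show ?thesis unfolding tiles_int_def by (intro exI[of _ ?B] allI *)
qed

text \<open>With e the exponent of p in d and M the p-free part of N, these are the exponents of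
  \<Phi>_(p^e)(X^M). The power \<open>z ^ w\<close> has order exactly p, because d divides w * p but
  not w, and a full geometric sum vanishes there.\<close>

lemma power_sum_eq_0:
  fixes z :: complex
  assumes p: "prime p" "p dvd d" and d: "d dvd N" "N > 0" and z: "z \<in> primitive_roots_unity d"
  defines "w \<equiv> (N div p ^ multiplicity p N) * p ^ (multiplicity p d - 1)"
  shows "(\<Sum>i<p. z ^ (i * w)) = 0"
proof -
  have d0: "d > 0" using d dvd_pos_nat by blast
  have unit: "\<not> is_unit p" using prime_gt_1_nat[OF p(1)] by simp
  define v where "v = multiplicity p N"
  define e where "e = multiplicity p d"
  define M where "M = N div p ^ v"
  have e: "e > 0" using p d0 by (simp add: e_def prime_multiplicity_gt_zero_iff)
  have w: "w = M * p ^ (e - 1)" by (simp add: w_def M_def v_def e_def)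
  have NM: "N = p ^ v * M" by (simp add: M_def v_def multiplicity_dvd)
  have pM: "\<not> p dvd M"
    using d(2) unit unfolding M_def v_def by (intro multiplicity_decompose) auto
  obtain d' where d': "d = p ^ e * d'" "\<not> p dvd d'"
    using multiplicity_decompose'[OF _ unit, of d] d0 unfolding e_def by blast
  have "coprime d' (p ^ v)"
    using d'(2) p(1) by (metis coprime_commute coprime_power_right_iff prime_imp_coprime)
  moreover have "d' dvd p ^ v * M" using d(1) d'(1) NM by (metis dvd_mult_right)
  ultimately have "d' dvd M" by (simp add: coprime_dvd_mult_right_iff)
  then have "p ^ e * d' dvd p ^ e * M" by simp
  moreover have "w * p = p ^ e * M" using e by (cases e) (simp_all add: w)
  ultimately have "d dvd w * p" using d'(1) by simp
  then have 1: "(z ^ w) ^ p = 1"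
    using primitive_root_power_eq_1_iff[OF d0 z] by (simp flip: power_mult)
  have "\<not> d dvd w"
  proof
    assume "d dvd w"
    then have "p ^ e dvd M * p ^ (e - 1)" using d'(1) w by (metis dvd_mult_left)
    then have "p * p ^ (e - 1) dvd M * p ^ (e - 1)" using e by (cases e) simp_all
    then show False using pM p(1) prime_gt_0_nat by simp
  qed
  then have "z ^ w \<noteq> 1" using primitive_root_power_eq_1_iff[OF d0 z] by simp
  then show ?thesis
    using 1 by (simp add: mult.commute[of _ w] power_mult geometric_sum)
qed

text \<open>
  The complement of \<open>A\<close> has the mask polynomial \<open>\<Prod> \<Phi>\<^sub>s(X\<^sup>t\<^sup>(\<^sup>s\<^sup>))\<close>, where \<open>s\<close> ranges over the prime powers that
  divide \<open>N\<close> and do not belong to \<open>S\<^sub>A\<close>, and \<open>t(s)\<close> is the largest divisor of \<open>N\<close> that is coprime to \<open>s\<close>.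
\<close>

lemma T1_T2_imp_tiling:
  fixes f :: "'a \<Rightarrow> int"
  assumes N: "N > 0" and I: "finite I"
    and T1: "card I = (\<Prod>s | s \<in> primepow_factors N \<and> vanishes f I s. aprimedivisor s)"
    and T2: "products_vanish N f I"
  shows "\<exists>(g :: (nat \<Rightarrow> nat) \<Rightarrow> int) J. tiling N f I g J"
proof -
  let ?p = "aprimedivisor :: nat \<Rightarrow> nat"
  define S where "S = {s \<in> primepow_factors N. vanishes f I s}"
  define T where "T = {s \<in> primepow_factors N. \<not> vanishes f I s}"
  \<comment> \<open>The exponents i * w s with i < p are those of the factor belonging to s.\<close>
  define w where "w s = (N div ?p s ^ multiplicity (?p s) N) * ?p s ^ (multiplicity (?p s) s - 1)" for s
  \<comment> \<open>An index chooses one exponent from each factor, so the exponential sum of g is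
    the product of the factors.\<close>
  define J where "J = PiE T (\<lambda>s. {..<?p s})"
  define g where "g j = int (\<Sum>s\<in>T. j s * w s)" for j
  have fin: "finite (primepow_factors N)" using N by (simp add: finite_primepow_factors)
  then have finST: "finite S" "finite T" by (auto simp: S_def T_def)
  have finJ: "finite J" unfolding J_def using finST by (intro finite_PiE) auto
  have "card I * card J = prod ?p S * prod ?p T"
    unfolding J_def using finST T1 by (simp add: card_PiE S_def)
  also have "\<dots> = prod ?p (S \<union> T)"
    using finST by (intro prod.union_disjoint[symmetric]) (auto simp: S_def T_def)
  also have "S \<union> T = primepow_factors N" by (auto simp: S_def T_def)
  finally have card: "card I * card J = N"
    using N by (simp add: prod_aprimedivisor_primepow_factors)
  have char_g: "char_sum g J z = (\<Prod>s\<in>T. \<Sum>i<?p s. z ^ (i * w s))" for z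
  proof -
    have "char_sum g J z = (\<Sum>j\<in>J. \<Prod>s\<in>T. z ^ (j s * w s))"
      unfolding char_sum_def g_def by (simp add: power_sum del: of_nat_sum)
    also have "\<dots> = (\<Prod>s\<in>T. \<Sum>i<?p s. z ^ (i * w s))"
      unfolding J_def using finST(2) by (intro prod_sum_PiE[symmetric]) auto
    finally show ?thesis .
  qed
  have "char_sum f I z * char_sum g J z = 0" if z: "z ^ N = 1" "z \<noteq> 1" for z
  proof -
    obtain d where d: "d dvd N" "z \<in> primitive_roots_unity d"
      using roots_unity_eq_UN_primitive[OF N] z(1) by blast
    have d0: "d > 0" using d N dvd_pos_nat by blast
    have "d \<noteq> 1" using d(2) z(2) by (auto simp: primitive_roots_unity_def)
    then have d1: "d > 1" using d0 by simp
    show ?thesis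
    proof (cases "\<forall>p. prime p \<longrightarrow> p dvd d \<longrightarrow> vanishes f I (p ^ multiplicity p d)")
      case True
      then have "vanishes f I d" using T2 d d1 unfolding products_vanish_def by blast
      then show ?thesis using d(2) by (simp add: vanishes_def)
    next
      case False
      then obtain p where p: "prime p" "p dvd d" "\<not> vanishes f I (p ^ multiplicity p d)" by blast
      let ?s = "p ^ multiplicity p d"
      have m: "multiplicity p d > 0" using p d0 by (simp add: prime_multiplicity_gt_zero_iff)
      have "?s dvd N" using multiplicity_dvd d(1) by (rule dvd_trans)
      \<comment> \<open>A prime power part of d outside S_A contributes a factor of the complement,
        and that factor vanishes at z.\<close>
      then have sT: "?s \<in> T" using p m by (simp add: T_def primepow_factors_def)
      have "(\<Sum>i<?p ?s. z ^ (i * w ?s)) = 0"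
        using power_sum_eq_0[OF p(1,2) d(1) N d(2)] p(1) m
        by (simp add: w_def aprimedivisor_prime_power)
      then have "char_sum g J z = 0" unfolding char_g using sT finST by (intro prod_zero) auto
      then show ?thesis by simp
    qed
  qed
  then have "tiling N f I g J"
    using card N I finJ by (subst tiling_iff_char_sum) auto
  then show ?thesis by blast
qed

section \<open>The four implications for sets of integers\<close>

lemma T1_T2_imp_tiles_mod:
  assumes "finite A" "N > 0" "T1_mod N A" "T2_mod N A"
  shows "tiles_mod N A"
proof -
  have "card A = (\<Prod>s | s \<in> primepow_factors N \<and> vanishes (\<lambda>a. a) A s. aprimedivisor s)"
    using assms(3) unfolding T1_mod_iff unfolding S_set_mod_eq[OF assms(1)] .
  moreover have "products_vanish N (\<lambda>a. a) A"
    using assms(4) unfolding T2_mod_iff[OF assms(1,2)] .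
  ultimately obtain g :: "(nat \<Rightarrow> nat) \<Rightarrow> int" and J where "tiling N (\<lambda>a. a) A g J"
    using T1_T2_imp_tiling[OF assms(2,1)] by metis
  then show ?thesis by (rule tiling_imp_tiles_mod)
qed

lemma tiles_mod_imp_T1:
  assumes "finite A" "N > 0" "tiles_mod N A"
  shows "T1_mod N A"
proof -
  obtain B :: "int set" where "tiling N (\<lambda>a. a) A (\<lambda>b. b) B"
    using tiles_mod_imp_tiling[OF assms(3,1,2)] by metis
  from tiling_primepow(1)[OF this] show ?thesis
    unfolding T1_mod_iff unfolding S_set_mod_eq[OF assms(1)] .
qed

lemma tiles_mod_imp_T2:
  assumes "finite A" "N > 0" "tiles_mod N A" "card (prime_factors (card A)) \<le> 2"
  shows "T2_mod N A"
proof -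
  obtain B :: "int set" where "tiling N (\<lambda>a. a) A (\<lambda>b. b) B"
    using tiles_mod_imp_tiling[OF assms(3,1,2)] by metis
  from products_vanish_card_prime_factors[OF this assms(4)] show ?thesis
    unfolding T2_mod_iff[OF assms(1,2)] .
qed

lemma tiles_mod_imp_tiles_int:
  assumes "finite A" "N > 0" "tiles_mod N A"
  shows "tiles_int A"
  using tiles_mod_imp_tiling[OF assms(3,1,2)] tiling_imp_tiles_int by blast

text \<open>(T2) only gets weaker when S_A shrinks to S_A^N. The equation (T1) has no such
  monotonicity.\<close>

lemma T2_imp_T2_mod: "T2 A \<Longrightarrow> T2_mod N A"
  unfolding cond_T2_def by (auto simp: S_set_def S_set_mod_def)

section \<open>Compiling arithmetic terms with bounded sums\<close>

definition runs :: "com \<Rightarrow> state \<Rightarrow> nat \<Rightarrow> state \<Rightarrow> bool" where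
  "runs c s b s' \<longleftrightarrow> (\<exists>t\<le>b. exec c s t s')"

lemma runs_mono: "runs c s b s' \<Longrightarrow> b \<le> b' \<Longrightarrow> runs c s b' s'"
  unfolding runs_def using le_trans by blast

lemma runs_Seq: "runs c s b s' \<Longrightarrow> runs c' s' b' s'' \<Longrightarrow> runs (Seq c c') s (b + b') s''"
  unfolding runs_def by (blast intro: exec.Seq add_mono)

lemma runs_Const: "runs (Const i n) (r, m) 1 (r(i := n), m)"
  unfolding runs_def by (blast intro: exec.Const)

lemma runs_Add: "runs (Add i j k) (r, m) 1 (r(i := r j + r k), m)"
  unfolding runs_def by (blast intro: exec.Add)

lemma runs_Sub: "runs (Sub i j k) (r, m) 1 (r(i := r j - r k), m)"
  unfolding runs_def by (blast intro: exec.Sub)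

lemma runs_Load: "runs (Load i j) (r, m) 1 (r(i := m (r j)), m)"
  unfolding runs_def by (blast intro: exec.Load)

lemma runs_Store: "runs (Store i j) (r, m) 1 (r, m(r i := r j))"
  unfolding runs_def by (blast intro: exec.Store)

text \<open>Register k counts the rounds down and P i describes the state after i of them. Each
  round pays 1 for the test, and leaving the loop pays 1 more.\<close>

lemma runs_While:
  assumes step: "\<And>i r m. i < n \<Longrightarrow> P i r m \<Longrightarrow> r k = n - i \<Longrightarrow>
      \<exists>r' m'. runs c (r, m) B (r', m') \<and> P (Suc i) r' m' \<and> r' k = n - Suc i"
    and start: "P 0 r m" "r k = n"
  shows "\<exists>r' m'. runs (WhilePos k c) (r, m) (n * (B + 1) + 1) (r', m') \<and> P n r' m' \<and> r' k = 0"
proof -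
  have "\<exists>r' m'. runs (WhilePos k c) (r, m) (j * (B + 1) + 1) (r', m') \<and> P n r' m' \<and> r' k = 0"
    if "j \<le> n" "P (n - j) r m" "r k = j" for j r m
    using that
  proof (induction j arbitrary: r m)
    case 0
    then have "runs (WhilePos k c) (r, m) 1 (r, m)"
      unfolding runs_def by (blast intro: exec.WhileFalse)
    moreover have "P n r m" "r k = 0" using 0 by simp_all
    ultimately show ?case unfolding mult_0 add_0 by blast
  next
    case (Suc j)
    have "n - Suc j < n" "r k = n - (n - Suc j)" using Suc.prems by auto
    from step[OF this(1) Suc.prems(2) this(2)]
    obtain r1 m1 where 1: "runs c (r, m) B (r1, m1)" "P (Suc (n - Suc j)) r1 m1"
      "r1 k = n - Suc (n - Suc j)"
      by (elim exE conjE)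
    have "n - j = Suc (n - Suc j)" using Suc.prems(1) by simp
    with 1 Suc.prems(1) have Pj: "P (n - j) r1 m1" and rk: "r1 k = j" by simp_all
    have "j \<le> n" using Suc.prems(1) by simp
    from Suc.IH[OF this Pj rk]
    obtain r2 m2 where 2: "runs (WhilePos k c) (r1, m1) (j * (B + 1) + 1) (r2, m2)"
      "P n r2 m2" "r2 k = 0"
      by (elim exE conjE)
    obtain t1 where t1: "t1 \<le> B" "exec c (r, m) t1 (r1, m1)" using 1(1) by (auto simp: runs_def)
    obtain t2 where t2: "t2 \<le> j * (B + 1) + 1" "exec (WhilePos k c) (r1, m1) t2 (r2, m2)"
      using 2(1) by (auto simp: runs_def)
    have "exec (WhilePos k c) (r, m) (1 + t1 + t2) (r2, m2)"
      using Suc.prems(3) t1(2) t2(2) by (intro exec.WhileTrue) auto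
    moreover have "1 + t1 + t2 \<le> Suc j * (B + 1) + 1" using t1(1) t2(1) by simp
    ultimately have "runs (WhilePos k c) (r, m) (Suc j * (B + 1) + 1) (r2, m2)"
      unfolding runs_def by blast
    with 2(2,3) show ?case by blast
  qed
  from this[of n r m] start show ?thesis by (simp only: diff_self_eq_0 le_refl simp_thms)
qed

text \<open>Bounded quantifiers are bounded sums of truth values, so the test of both conditions is
  a single term. Terms never write to memory; filling the table is left to a separate loop.\<close>

datatype tm =
    Var nat
  | Num nat
  | Plus tm tm
  | Minus tm tm
  | Times tm tm
  | Mem tm
  | Sum nat tm tm

fun tval :: "tm \<Rightarrow> (nat \<Rightarrow> nat) \<Rightarrow> (nat \<Rightarrow> nat) \<Rightarrow> nat" where
  "tval (Var v) r m = r v"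
| "tval (Num n) r m = n"
| "tval (Plus a b) r m = tval a r m + tval b r m"
| "tval (Minus a b) r m = tval a r m - tval b r m"
| "tval (Times a b) r m = tval a r m * tval b r m"
| "tval (Mem a) r m = m (tval a r m)"
| "tval (Sum v b t) r m = (\<Sum>i<tval b r m. tval t (r(v := i)) m)"

text \<open>Bound variables count as well, because a sum overwrites their register: they all have to
  stay below the scratch registers.\<close>

fun vars_below :: "nat \<Rightarrow> tm \<Rightarrow> bool" where
  "vars_below j (Var v) \<longleftrightarrow> v < j"
| "vars_below j (Num n) \<longleftrightarrow> True"
| "vars_below j (Plus a b) \<longleftrightarrow> vars_below j a \<and> vars_below j b"
| "vars_below j (Minus a b) \<longleftrightarrow> vars_below j a \<and> vars_below j b"
| "vars_below j (Times a b) \<longleftrightarrow> vars_below j a \<and> vars_below j b"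
| "vars_below j (Mem a) \<longleftrightarrow> vars_below j a"
| "vars_below j (Sum v b t) \<longleftrightarrow> v < j \<and> vars_below j b \<and> vars_below j t"

text \<open>
  Turns register \<open>k\<close> from a number of iterations into the sum of the results that \<open>c\<close> leaves in register \<open>k + 4\<close>
  when register \<open>v\<close> runs through the values below that number; register \<open>k + 3\<close> saves the old value of \<open>v\<close>.
\<close>
definition sum_com :: "nat \<Rightarrow> nat \<Rightarrow> com \<Rightarrow> com" where
  "sum_com v k c = Seq (Const (k + 1) 0) (Seq (Const (k + 2) 1) (Seq (Add (k + 3) v (k + 1))
     (Seq (Const v 0)
     (Seq (WhilePos k (Seq c (Seq (Add (k + 1) (k + 1) (k + 4))
       (Seq (Add v v (k + 2)) (Sub k k (k + 2))))))
     (Seq (Add v (k + 3) k) (Add k k (k + 1)))))))"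

text \<open>
  The variables of a term are registers. \<open>compile t k\<close> leaves the value of \<open>t\<close> in register \<open>k\<close> and preserves
  the registers below \<open>k\<close>.
\<close>
fun compile :: "tm \<Rightarrow> nat \<Rightarrow> com" where
  "compile (Var v) k = Seq (Const (k + 1) 0) (Add k v (k + 1))"
| "compile (Num n) k = Const k n"
| "compile (Plus a b) k = Seq (compile a k) (Seq (compile b (k + 1)) (Add k k (k + 1)))"
| "compile (Minus a b) k = Seq (compile a k) (Seq (compile b (k + 1)) (Sub k k (k + 1)))"
| "compile (Times a b) k = Seq (compile a k) (Seq (compile b (k + 1))
     (Seq (Const (k + 2) 0) (Seq (Const (k + 3) 1)
     (Seq (WhilePos k (Seq (Add (k + 2) (k + 2) (k + 1)) (Sub k k (k + 3))))
     (Add k k (k + 2))))))"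
| "compile (Mem a) k = Seq (compile a k) (Load k k)"
| "compile (Sum v b t) k = Seq (compile b k) (sum_com v k (compile t (k + 4)))"

text \<open>X bounds the registers and memory cells that are read; inside a sum the index has to be
  covered too, hence X + \<open>val_bound b X\<close>.\<close>

fun val_bound :: "tm \<Rightarrow> nat \<Rightarrow> nat" where
  "val_bound (Var v) X = X"
| "val_bound (Num n) X = n"
| "val_bound (Plus a b) X = val_bound a X + val_bound b X"
| "val_bound (Minus a b) X = val_bound a X"
| "val_bound (Times a b) X = val_bound a X * val_bound b X"
| "val_bound (Mem a) X = X"
| "val_bound (Sum v b t) X = val_bound b X * val_bound t (X + val_bound b X)"

fun cost_bound :: "tm \<Rightarrow> nat \<Rightarrow> nat" where
  "cost_bound (Var v) X = 2"
| "cost_bound (Num n) X = 1"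
| "cost_bound (Plus a b) X = cost_bound a X + cost_bound b X + 1"
| "cost_bound (Minus a b) X = cost_bound a X + cost_bound b X + 1"
| "cost_bound (Times a b) X = cost_bound a X + cost_bound b X + 4 + 3 * val_bound a X"
| "cost_bound (Mem a) X = cost_bound a X + 1"
| "cost_bound (Sum v b t) X =
     cost_bound b X + 7 + val_bound b X * (cost_bound t (X + val_bound b X) + 4)"

text \<open>The term is fixed while X varies, so nested sums merely multiply and compose finitely
  many polynomials.\<close>

lemma val_bound_poly: "\<exists>p :: nat poly. \<forall>X. val_bound t X = poly p X"
proof (induction t)
  case (Var v)
  show ?case by (intro exI[of _ "[:0, 1:]"]) simp
next
  case (Num n)
  show ?case by (intro exI[of _ "[:n:]"]) simp
next
  case (Plus a b)
  then obtain p q :: "nat poly" where "\<forall>X. val_bound a X = poly p X" "\<forall>X. val_bound b X = poly q X"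
    by blast
  then show ?case by (intro exI[of _ "p + q"]) simp
next
  case (Times a b)
  then obtain p q :: "nat poly" where "\<forall>X. val_bound a X = poly p X" "\<forall>X. val_bound b X = poly q X"
    by blast
  then show ?case by (intro exI[of _ "p * q"]) simp
next
  case (Mem a)
  show ?case by (intro exI[of _ "[:0, 1:]"]) simp
next
  case (Sum v a b)
  then obtain p q :: "nat poly" where "\<forall>X. val_bound a X = poly p X" "\<forall>X. val_bound b X = poly q X"
    by blast
  then show ?case by (intro exI[of _ "p * pcompose q ([:0, 1:] + p)"]) (simp add: poly_pcompose)
qed simp

lemma cost_bound_poly: "\<exists>p :: nat poly. \<forall>X. cost_bound t X = poly p X"
proof (induction t)
  case (Var v)
  show ?case by (intro exI[of _ "[:2:]"]) simp
next
  case (Num n)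
  show ?case by (intro exI[of _ "[:1:]"]) simp
next
  case (Plus a b)
  then obtain p q :: "nat poly" where "\<forall>X. cost_bound a X = poly p X" "\<forall>X. cost_bound b X = poly q X"
    by blast
  then show ?case by (intro exI[of _ "p + q + [:1:]"]) simp
next
  case (Minus a b)
  then obtain p q :: "nat poly" where "\<forall>X. cost_bound a X = poly p X" "\<forall>X. cost_bound b X = poly q X"
    by blast
  then show ?case by (intro exI[of _ "p + q + [:1:]"]) simp
next
  case (Times a b)
  then obtain p q :: "nat poly" where "\<forall>X. cost_bound a X = poly p X" "\<forall>X. cost_bound b X = poly q X"
    by blast
  moreover obtain v :: "nat poly" where "\<forall>X. val_bound a X = poly v X"
    using val_bound_poly by blast
  ultimately show ?case by (intro exI[of _ "p + q + [:4:] + smult 3 v"]) simp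
next
  case (Mem a)
  then obtain p :: "nat poly" where "\<forall>X. cost_bound a X = poly p X" by blast
  then show ?case by (intro exI[of _ "p + [:1:]"]) simp
next
  case (Sum v a b)
  then obtain p q :: "nat poly" where "\<forall>X. cost_bound a X = poly p X" "\<forall>X. cost_bound b X = poly q X"
    by blast
  moreover obtain v :: "nat poly" where "\<forall>X. val_bound a X = poly v X"
    using val_bound_poly by blast
  ultimately show ?case
    by (intro exI[of _ "p + [:7:] + v * (pcompose q ([:0, 1:] + v) + [:4:])"])
      (simp add: poly_pcompose)
qed

lemma tval_cong:
  assumes "vars_below j t" "\<forall>i<j. r i = r' i"
  shows "tval t r m = tval t r' m"
  using assms
proof (induction t arbitrary: r r')
  case (Sum v b t)
  have "\<forall>l<j. (r(v := i)) l = (r'(v := i)) l" for i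
    using Sum.prems(2) by simp
  then have "tval t (r(v := i)) m = tval t (r'(v := i)) m" for i
    using Sum.prems(1) by (intro Sum.IH(2)) simp_all
  moreover have "tval b r m = tval b r' m"
    using Sum.prems by (intro Sum.IH(1)) simp_all
  ultimately show ?case by simp
next
  case (Plus a b)
  have "tval a r m = tval a r' m" "tval b r m = tval b r' m"
    using Plus.prems by (intro Plus.IH; simp)+
  then show ?case by simp
next
  case (Minus a b)
  have "tval a r m = tval a r' m" "tval b r m = tval b r' m"
    using Minus.prems by (intro Minus.IH; simp)+
  then show ?case by simp
next
  case (Times a b)
  have "tval a r m = tval a r' m" "tval b r m = tval b r' m"
    using Times.prems by (intro Times.IH; simp)+
  then show ?case by simp
next
  case (Mem a)
  have "tval a r m = tval a r' m"
    using Mem.prems by (intro Mem.IH) simp_all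
  then show ?case by simp
qed simp_all

lemma tval_le_val_bound:
  assumes "vars_below j t" "\<forall>i<j. r i \<le> X" "\<forall>a. m a \<le> X"
  shows "tval t r m \<le> val_bound t X"
  using assms
proof (induction t arbitrary: r X)
  case (Sum v b t)
  have b: "tval b r m \<le> val_bound b X"
    using Sum.prems by (intro Sum.IH(1)) simp_all
  have t: "tval t (r(v := i)) m \<le> val_bound t (X + val_bound b X)" if "i < tval b r m" for i
  proof (rule Sum.IH(2))
    show "\<forall>l<j. (r(v := i)) l \<le> X + val_bound b X"
      using Sum.prems(2) b that by (simp add: trans_le_add1)
    show "\<forall>a. m a \<le> X + val_bound b X" using Sum.prems(3) by (simp add: trans_le_add1)
  qed (use Sum.prems(1) in simp)
  have "(\<Sum>i<tval b r m. tval t (r(v := i)) m) \<le>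
      of_nat (card {..<tval b r m}) * val_bound t (X + val_bound b X)"
    using t by (intro sum_bounded_above) simp
  also have "\<dots> \<le> val_bound b X * val_bound t (X + val_bound b X)"
    using b by simp
  finally show ?case by simp
next
  case (Minus a b)
  have "tval a r m \<le> val_bound a X"
    using Minus.prems by (intro Minus.IH(1)) simp_all
  then show ?case by simp
next
  case (Plus a b)
  have "tval a r m \<le> val_bound a X" "tval b r m \<le> val_bound b X"
    using Plus.prems by (intro Plus.IH; simp)+
  then show ?case by simp
next
  case (Times a b)
  have "tval a r m \<le> val_bound a X" "tval b r m \<le> val_bound b X"
    using Times.prems by (intro Times.IH; simp)+
  then show ?case by (simp add: mult_le_mono)
qed simp_all

text \<open>Memory comes back unchanged and only registers from k on may differ, so subterms can be
  evaluated one after another at growing k.\<close>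

definition computes :: "com \<Rightarrow> nat \<Rightarrow> state \<Rightarrow> nat \<Rightarrow> nat \<Rightarrow> bool" where
  "computes c k s b x \<longleftrightarrow> (\<exists>r. runs c s b (r, snd s) \<and> r k = x \<and> (\<forall>i<k. r i = fst s i))"

lemma computesI:
  "runs c (r, m) b (r', m) \<Longrightarrow> r' k = x \<Longrightarrow> (\<And>i. i < k \<Longrightarrow> r' i = r i) \<Longrightarrow> computes c k (r, m) b x"
  unfolding computes_def by auto

lemma computesE:
  assumes "computes c k (r, m) b x"
  obtains r' where "runs c (r, m) b (r', m)" "r' k = x" "\<And>i. i < k \<Longrightarrow> r' i = r i"
  using assms unfolding computes_def by auto

lemma computes_mono: "computes c k s b x \<Longrightarrow> b \<le> b' \<Longrightarrow> computes c k s b' x"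
  unfolding computes_def using runs_mono by blast

lemma computes_two:
  assumes a: "computes ca k (r, m) ta x"
    and b: "\<And>r1. \<forall>i<k. r1 i = r i \<Longrightarrow> computes cb (k + 1) (r1, m) tb y"
    and c: "\<And>r2. r2 k = x \<Longrightarrow> r2 (k + 1) = y \<Longrightarrow> \<forall>i<k. r2 i = r i \<Longrightarrow> computes c k (r2, m) t z"
  shows "computes (Seq ca (Seq cb c)) k (r, m) (ta + (tb + t)) z"
proof -
  obtain r1 where 1: "runs ca (r, m) ta (r1, m)" "r1 k = x" "\<And>i. i < k \<Longrightarrow> r1 i = r i"
    using a by (rule computesE) blast
  then have "\<forall>i<k. r1 i = r i" by blast
  from b[OF this] obtain r2 where 2: "runs cb (r1, m) tb (r2, m)" "r2 (k + 1) = y"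
    "\<And>i. i < k + 1 \<Longrightarrow> r2 i = r1 i"
    by (rule computesE) blast
  have "r2 k = x" using 1(2) 2(3)[of k] by simp
  moreover have r2: "\<forall>i<k. r2 i = r i" using 1(3) 2(3) by simp
  ultimately have "computes c k (r2, m) t z" using c 2(2) by blast
  then obtain r3 where 3: "runs c (r2, m) t (r3, m)" "r3 k = z" "\<And>i. i < k \<Longrightarrow> r3 i = r2 i"
    by (rule computesE) blast
  show ?thesis
  proof (rule computesI)
    show "runs (Seq ca (Seq cb c)) (r, m) (ta + (tb + t)) (r3, m)"
      by (rule runs_Seq[OF 1(1)], rule runs_Seq[OF 2(1)], rule 3(1))
  qed (use 3 r2 in simp_all)
qed

text \<open>Repeated addition costs three steps per unit of the first factor, which is why
  \<open>cost_bound\<close> refers to \<open>val_bound\<close>. The counter k ends at 0, so the last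
  addition moves the product there.\<close>

lemma computes_times:
  assumes "r k = x" "r (k + 1) = y"
  shows "computes (Seq (Const (k + 2) 0) (Seq (Const (k + 3) 1)
     (Seq (WhilePos k (Seq (Add (k + 2) (k + 2) (k + 1)) (Sub k k (k + 3))))
     (Add k k (k + 2))))) k (r, m) (4 + 3 * x) (x * y)"
proof -
  let ?r = "r(k + 2 := 0, k + 3 := 1)"
  let ?body = "Seq (Add (k + 2) (k + 2) (k + 1)) (Sub k k (k + 3))"
  let ?P = "\<lambda>i r' m'. m' = m \<and> r' (k + 2) = i * y \<and> r' (k + 1) = y \<and>
    r' (k + 3) = 1 \<and> (\<forall>i<k. r' i = r i)"
  have "\<exists>r' m'. runs (WhilePos k ?body) (?r, m) (x * ((1 + 1) + 1) + 1) (r', m') \<and> ?P x r' m' \<and>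
      r' k = 0"
  proof (rule runs_While)
    fix i r' m' assume *: "i < x" "?P i r' m'" "r' k = x - i"
    let ?s = "r'(k + 2 := r' (k + 2) + r' (k + 1))"
    let ?s' = "?s(k := ?s k - ?s (k + 3))"
    have A: "runs ?body (r', m') (1 + 1) (?s', m')"
      by (rule runs_Seq[OF runs_Add runs_Sub])
    have B: "?P (Suc i) ?s' m'" using *(2) by simp
    have C: "?s' k = x - Suc i" using *(2,3) by simp
    show "\<exists>r'' m''. runs ?body (r', m') (1 + 1) (r'', m'') \<and> ?P (Suc i) r'' m'' \<and>
        r'' k = x - Suc i"
      by (rule exI[of _ ?s'], rule exI[of _ m'], rule conjI[OF A conjI[OF B C]])
  qed (use assms in simp_all)
  then obtain r' m' where r': "runs (WhilePos k ?body) (?r, m) (x * ((1 + 1) + 1) + 1) (r', m')"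
    "?P x r' m'" "r' k = 0" by (elim exE conjE) blast
  have "m' = m" using r'(2) by simp
  have "computes (Seq (Const (k + 2) 0) (Seq (Const (k + 3) 1) (Seq (WhilePos k ?body)
      (Add k k (k + 2))))) k (r, m) (1 + (1 + ((x * ((1 + 1) + 1) + 1) + 1))) (x * y)"
  proof (rule computesI)
    show "runs (Seq (Const (k + 2) 0) (Seq (Const (k + 3) 1) (Seq (WhilePos k ?body)
        (Add k k (k + 2))))) (r, m) (1 + (1 + ((x * ((1 + 1) + 1) + 1) + 1)))
        (r'(k := r' k + r' (k + 2)), m)"
      by (rule runs_Seq[OF runs_Const], rule runs_Seq[OF runs_Const],
        rule runs_Seq[OF r'(1)], unfold \<open>m' = m\<close>, rule runs_Add)
  qed (use r'(2,3) in simp_all)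
  then show ?thesis by (rule computes_mono) simp
qed

lemma computes_sum:
  assumes "v < k" "r k = n"
    and step: "\<And>r' i. i < n \<Longrightarrow> r' v = i \<Longrightarrow> \<forall>l<k. l \<noteq> v \<longrightarrow> r' l = r l \<Longrightarrow>
      computes ct (k + 4) (r', m) B (x i)"
  shows "computes (sum_com v k ct) k (r, m) (7 + n * (B + 4)) (\<Sum>i<n. x i)"
proof -
  let ?r2 = "r(k + 1 := 0, k + 2 := 1)"
  let ?r3 = "?r2(k + 3 := ?r2 v + ?r2 (k + 1))"
  let ?r4 = "?r3(v := 0)"
  let ?body = "Seq ct (Seq (Add (k + 1) (k + 1) (k + 4)) (Seq (Add v v (k + 2)) (Sub k k (k + 2))))"
  let ?B = "B + (1 + (1 + 1))"
  let ?P = "\<lambda>i r' m'. m' = m \<and> r' (k + 1) = (\<Sum>l<i. x l) \<and> r' (k + 2) = 1 \<and>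
    r' (k + 3) = r v \<and> r' v = i \<and> (\<forall>l<k. l \<noteq> v \<longrightarrow> r' l = r l)"
  have "\<exists>r' m'. runs (WhilePos k ?body) (?r4, m) (n * (?B + 1) + 1) (r', m') \<and> ?P n r' m' \<and> r' k = 0"
  proof (rule runs_While)
    fix i r' m' assume *: "i < n" "?P i r' m'" "r' k = n - i"
    have "computes ct (k + 4) (r', m) B (x i)"
      using * by (intro step) simp_all
    then obtain s where s: "runs ct (r', m) B (s, m)" "s (k + 4) = x i" "\<And>l. l < k + 4 \<Longrightarrow> s l = r' l"
      by (rule computesE) blast
    have s_eq: "s (k + 1) = r' (k + 1)" "s (k + 2) = r' (k + 2)" "s (k + 3) = r' (k + 3)" "s k = r' k"
      "s v = r' v" "\<forall>l<k. s l = r' l"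
      using s(3) assms(1) by simp_all
    let ?s1 = "s(k + 1 := s (k + 1) + s (k + 4))"
    let ?s2 = "?s1(v := ?s1 v + ?s1 (k + 2))"
    let ?s3 = "?s2(k := ?s2 k - ?s2 (k + 2))"
    have "m' = m" using *(2) by simp
    have A: "runs ?body (r', m') ?B (?s3, m)"
      unfolding \<open>m' = m\<close>
      by (rule runs_Seq[OF s(1)], rule runs_Seq[OF runs_Add], rule runs_Seq[OF runs_Add runs_Sub])
    have B: "?P (Suc i) ?s3 m" using *(2) s_eq s(2) assms(1) by simp
    have C: "?s3 k = n - Suc i" using *(2,3) s_eq assms(1) by simp
    show "\<exists>r'' m''. runs ?body (r', m') ?B (r'', m'') \<and> ?P (Suc i) r'' m'' \<and>
        r'' k = n - Suc i"
      by (rule exI[of _ ?s3], rule exI[of _ m], rule conjI[OF A conjI[OF B C]])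
  qed (use assms(1,2) in simp_all)
  then obtain r5 m' where 5: "runs (WhilePos k ?body) (?r4, m) (n * (?B + 1) + 1) (r5, m')"
    "?P n r5 m'" "r5 k = 0" by (elim exE conjE) blast
  have "m' = m" using 5(2) by simp
  \<comment> \<open>Register k is 0 after the loop, so adding it restores the saved value of v
    unchanged.\<close>
  let ?r6 = "r5(v := r5 (k + 3) + r5 k)"
  have "computes (Seq (Const (k + 1) 0) (Seq (Const (k + 2) 1) (Seq (Add (k + 3) v (k + 1))
     (Seq (Const v 0) (Seq (WhilePos k ?body) (Seq (Add v (k + 3) k) (Add k k (k + 1)))))))) k (r, m)
     (1 + (1 + (1 + (1 + ((n * (?B + 1) + 1) + (1 + 1)))))) (\<Sum>i<n. x i)"
  proof (rule computesI)
    show "runs (Seq (Const (k + 1) 0) (Seq (Const (k + 2) 1) (Seq (Add (k + 3) v (k + 1))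
      (Seq (Const v 0) (Seq (WhilePos k ?body) (Seq (Add v (k + 3) k) (Add k k (k + 1)))))))) (r, m)
      (1 + (1 + (1 + (1 + ((n * (?B + 1) + 1) + (1 + 1))))))
      (?r6(k := ?r6 k + ?r6 (k + 1)), m)"
      by (rule runs_Seq[OF runs_Const], rule runs_Seq[OF runs_Const], rule runs_Seq[OF runs_Add],
        rule runs_Seq[OF runs_Const], rule runs_Seq[OF 5(1)], unfold \<open>m' = m\<close>,
        rule runs_Seq[OF runs_Add runs_Add])
    show "(?r6(k := ?r6 k + ?r6 (k + 1))) k = (\<Sum>i<n. x i)" using 5(2,3) assms(1) by simp
    show "(?r6(k := ?r6 k + ?r6 (k + 1))) i = r i" if "i < k" for i
      using 5(2,3) assms(1) that by simp
  qed
  then show ?thesis unfolding sum_com_def by (rule computes_mono) (simp add: algebra_simps)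
qed

text \<open>The bound j on variables is fixed while k grows with nesting, so scratch space never
  meets a variable. X is generalized in the induction because the body of a sum is run with a larger
  bound.\<close>

lemma computes_compile:
  assumes "vars_below j t" "j \<le> k" "\<forall>i<j. r i \<le> X" "\<forall>a. m a \<le> X"
  shows "computes (compile t k) k (r, m) (cost_bound t X) (tval t r m)"
  using assms
proof (induction t arbitrary: k r X)
  case (Var v)
  show ?case
    unfolding compile.simps
  proof (rule computesI)
    show "runs (Seq (Const (k + 1) 0) (Add k v (k + 1))) (r, m) (cost_bound (Var v) X)
        (r(k + 1 := 0, k := (r(k + 1 := 0)) v + (r(k + 1 := 0)) (k + 1)), m)"
      by (rule runs_mono[OF runs_Seq[OF runs_Const runs_Add]]) simp
  qed (use Var in simp_all)
next
  case (Num n)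
  show ?case
    unfolding compile.simps by (rule computesI[OF runs_mono[OF runs_Const]]) simp_all
next
  case (Plus a b)
  have a: "computes (compile a k) k (r, m) (cost_bound a X) (tval a r m)"
    using Plus.prems by (intro Plus.IH(1)) simp_all
  have b: "computes (compile b (k + 1)) (k + 1) (r1, m) (cost_bound b X) (tval b r m)"
    if "\<forall>i<k. r1 i = r i" for r1
  proof -
    have eq: "\<forall>i<j. r1 i = r i" using that Plus.prems(2) by simp
    have "computes (compile b (k + 1)) (k + 1) (r1, m) (cost_bound b X) (tval b r1 m)"
      using Plus.prems eq by (intro Plus.IH(2)) simp_all
    moreover have "tval b r1 m = tval b r m" using Plus.prems(1) eq by (intro tval_cong) simp_all
    ultimately show ?thesis by simp
  qed
  have c: "computes (Add k k (k + 1)) k (r2, m) 1 (tval a r m + tval b r m)"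
    if "r2 k = tval a r m" "r2 (k + 1) = tval b r m" for r2
    using that by (intro computesI[OF runs_Add]) simp_all
  show ?case
    unfolding compile.simps tval.simps
    by (rule computes_mono[OF computes_two[OF a b c]]) simp_all
next
  case (Minus a b)
  have a: "computes (compile a k) k (r, m) (cost_bound a X) (tval a r m)"
    using Minus.prems by (intro Minus.IH(1)) simp_all
  have b: "computes (compile b (k + 1)) (k + 1) (r1, m) (cost_bound b X) (tval b r m)"
    if "\<forall>i<k. r1 i = r i" for r1
  proof -
    have eq: "\<forall>i<j. r1 i = r i" using that Minus.prems(2) by simp
    have "computes (compile b (k + 1)) (k + 1) (r1, m) (cost_bound b X) (tval b r1 m)"
      using Minus.prems eq by (intro Minus.IH(2)) simp_all
    moreover have "tval b r1 m = tval b r m" using Minus.prems(1) eq by (intro tval_cong) simp_all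
    ultimately show ?thesis by simp
  qed
  have c: "computes (Sub k k (k + 1)) k (r2, m) 1 (tval a r m - tval b r m)"
    if "r2 k = tval a r m" "r2 (k + 1) = tval b r m" for r2
    using that by (intro computesI[OF runs_Sub]) simp_all
  show ?case
    unfolding compile.simps tval.simps
    by (rule computes_mono[OF computes_two[OF a b c]]) simp_all
next
  case (Times a b)
  have a: "computes (compile a k) k (r, m) (cost_bound a X) (tval a r m)"
    using Times.prems by (intro Times.IH(1)) simp_all
  have b: "computes (compile b (k + 1)) (k + 1) (r1, m) (cost_bound b X) (tval b r m)"
    if "\<forall>i<k. r1 i = r i" for r1
  proof -
    have eq: "\<forall>i<j. r1 i = r i" using that Times.prems(2) by simp
    have "computes (compile b (k + 1)) (k + 1) (r1, m) (cost_bound b X) (tval b r1 m)"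
      using Times.prems eq by (intro Times.IH(2)) simp_all
    moreover have "tval b r1 m = tval b r m" using Times.prems(1) eq by (intro tval_cong) simp_all
    ultimately show ?thesis by simp
  qed
  have le: "tval a r m \<le> val_bound a X"
    using Times.prems by (intro tval_le_val_bound[of j]) simp_all
  show ?case
    unfolding compile.simps tval.simps
    by (rule computes_mono[OF computes_two[OF a b computes_times]]) (use le in simp_all)
next
  case (Mem a)
  have "computes (compile a k) k (r, m) (cost_bound a X) (tval a r m)"
    using Mem.prems by (intro Mem.IH) simp_all
  then obtain r1 where 1: "runs (compile a k) (r, m) (cost_bound a X) (r1, m)" "r1 k = tval a r m"
    "\<And>i. i < k \<Longrightarrow> r1 i = r i"
    by (rule computesE) blast
  show ?case
    unfolding compile.simps tval.simps cost_bound.simps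
    by (rule computesI[OF runs_Seq[OF 1(1) runs_Load]]) (use 1 in simp_all)
next
  case (Sum v b t)
  let ?Y = "X + val_bound b X"
  have "computes (compile b k) k (r, m) (cost_bound b X) (tval b r m)"
    using Sum.prems by (intro Sum.IH(1)) simp_all
  then obtain r1 where 1: "runs (compile b k) (r, m) (cost_bound b X) (r1, m)" "r1 k = tval b r m"
    "\<And>i. i < k \<Longrightarrow> r1 i = r i"
    by (rule computesE) blast
  have n: "tval b r m \<le> val_bound b X"
    using Sum.prems by (intro tval_le_val_bound[of j]) simp_all
  have v: "v < k" using Sum.prems by simp
  have step: "computes (compile t (k + 4)) (k + 4) (r', m) (cost_bound t ?Y) (tval t (r(v := i)) m)"
    if "i < tval b r m" "r' v = i" "\<forall>l<k. l \<noteq> v \<longrightarrow> r' l = r1 l" for r' i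
  proof -
    have eq: "r' l = (r(v := i)) l" if "l < j" for l
      using \<open>r' v = i\<close> \<open>\<forall>l<k. l \<noteq> v \<longrightarrow> r' l = r1 l\<close> 1(3)[of l] that Sum.prems(2) by simp
    have "r' l \<le> ?Y" if "l < j" for l
      using eq[OF that] Sum.prems(3) that \<open>i < tval b r m\<close> n
      by (cases "l = v") (simp_all add: trans_le_add1)
    then have "computes (compile t (k + 4)) (k + 4) (r', m) (cost_bound t ?Y) (tval t r' m)"
      using Sum.prems by (intro Sum.IH(2)) (simp_all add: trans_le_add1)
    moreover have "tval t r' m = tval t (r(v := i)) m"
      using Sum.prems(1) eq by (intro tval_cong[of j]) simp_all
    ultimately show ?thesis by simp
  qed
  have "computes (sum_com v k (compile t (k + 4))) k (r1, m)
      (7 + tval b r m * (cost_bound t ?Y + 4)) (\<Sum>i<tval b r m. tval t (r(v := i)) m)"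
    using v 1(2) step by (rule computes_sum)
  then obtain r2 where 2: "runs (sum_com v k (compile t (k + 4))) (r1, m)
      (7 + tval b r m * (cost_bound t ?Y + 4)) (r2, m)"
    "r2 k = (\<Sum>i<tval b r m. tval t (r(v := i)) m)" "\<And>i. i < k \<Longrightarrow> r2 i = r1 i"
    by (rule computesE) blast
  show ?case
    unfolding compile.simps tval.simps
  proof (rule computesI[OF runs_mono[OF runs_Seq[OF 1(1) 2(1)]] 2(2)])
    have "tval b r m * (cost_bound t ?Y + 4) \<le> val_bound b X * (cost_bound t ?Y + 4)"
      using n by (rule mult_le_mono1)
    then show "cost_bound b X + (7 + tval b r m * (cost_bound t ?Y + 4)) \<le> cost_bound (Sum v b t) X"
      by simp
  qed (use 1(3) 2(3) in simp)
qed

section \<open>An arithmetic criterion for divisibility by cyclotomic polynomials\<close>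

definition energy :: "int set \<Rightarrow> nat \<Rightarrow> real" where
  "energy A d = (\<Sum>z\<in>primitive_roots_unity d. (cmod (char_sum (\<lambda>a. a) A z))\<^sup>2)"

definition pair_count :: "int set \<Rightarrow> nat \<Rightarrow> nat" where
  "pair_count A d = (\<Sum>a\<in>A. \<Sum>b\<in>A. of_bool (int d dvd a - b))"

definition energy_nat :: "int set \<Rightarrow> nat \<Rightarrow> nat" where
  "energy_nat A d = nat \<lfloor>energy A d\<rfloor>"

lemma energy_nonneg: "energy A d \<ge> 0"
  unfolding energy_def by (rule sum_nonneg) simp

lemma energy_eq_0_iff: "d > 0 \<Longrightarrow> energy A d = 0 \<longleftrightarrow> vanishes (\<lambda>a. a) A d"
  unfolding energy_def vanishes_def
  by (subst sum_nonneg_eq_0_iff) (auto intro: finite_primitive_roots_unity)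

text \<open>On the unit circle conjugation is inversion, so |A(z)|^2 is the sum of z^(a - b) over
  all pairs; orthogonality keeps those with d dividing a - b.\<close>

lemma sum_energy_divisors:
  assumes "finite A" "d > 0"
  shows "(\<Sum>e | e dvd d. energy A e) = real (d * pair_count A d)"
proof -
  let ?Z = "{z :: complex. z ^ d = 1}"
  have pos: "e > 0" if "e dvd d" for e using that assms(2) dvd_pos_nat by blast
  have "(\<Sum>e | e dvd d. energy A e) = (\<Sum>z\<in>?Z. (cmod (char_sum (\<lambda>a. a) A z))\<^sup>2)"
    unfolding energy_def roots_unity_eq_UN_primitive[OF assms(2)]
    using assms(2) pos primitive_roots_unity_disjoint finite_primitive_roots_unity
    by (intro sum.UNION_disjoint[symmetric]) auto
  then have "complex_of_real (\<Sum>e | e dvd d. energy A e) =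
      (\<Sum>z\<in>?Z. complex_of_real ((cmod (char_sum (\<lambda>a. a) A z))\<^sup>2))" by simp
  also have "\<dots> = (\<Sum>z\<in>?Z. \<Sum>a\<in>A. \<Sum>b\<in>A. z powi (a - b))"
  proof (rule sum.cong)
    fix z assume z: "z \<in> ?Z"
    then have z0: "z \<noteq> 0" using root_unity_nonzero assms(2) by blast
    have "cmod z ^ d = 1" using z by (simp flip: norm_power)
    then have "cmod z = 1" using assms(2) power_eq_imp_eq_base[of "cmod z" d 1] by simp
    then have "z * cnj z = 1" using complex_norm_square[of z] by simp
    then have cnj: "cnj z = inverse z" using z0 by (simp add: field_simps)
    have "cnj (char_sum (\<lambda>a. a) A z) = (\<Sum>b\<in>A. z powi (- b))"
      by (simp add: char_sum_def cnj power_int_minus power_int_inverse)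
    then have "complex_of_real ((cmod (char_sum (\<lambda>a. a) A z))\<^sup>2) =
        (\<Sum>a\<in>A. z powi a) * (\<Sum>b\<in>A. z powi (- b))"
      using complex_norm_square[of "char_sum (\<lambda>a. a) A z"] by (simp add: char_sum_def)
    also have "\<dots> = (\<Sum>a\<in>A. \<Sum>b\<in>A. z powi (a - b))"
      using z0 by (simp add: sum_product flip: power_int_add)
    finally show "complex_of_real ((cmod (char_sum (\<lambda>a. a) A z))\<^sup>2) =
      (\<Sum>a\<in>A. \<Sum>b\<in>A. z powi (a - b))" .
  qed simp
  also have "\<dots> = (\<Sum>a\<in>A. \<Sum>b\<in>A. \<Sum>z\<in>?Z. z powi (a - b))"
    by (subst sum.swap, subst (2) sum.swap) simp
  also have "\<dots> = (\<Sum>a\<in>A. \<Sum>b\<in>A. of_nat d * of_bool (int d dvd a - b))"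
    using assms(2) by (intro sum.cong refl) (simp add: sum_roots_unity_powi)
  also have "\<dots> = complex_of_real (real (d * pair_count A d))"
    by (auto simp: pair_count_def sum_distrib_left intro!: sum.cong)
  finally show ?thesis by (simp only: of_real_eq_iff)
qed

lemma energy_eq:
  assumes "finite A" "d > 0"
  shows "energy A d = real (d * pair_count A d) - (\<Sum>e | e dvd d \<and> e < d. energy A e)"
proof -
  have "{e. e dvd d} = insert d {e. e dvd d \<and> e < d}"
    using assms(2) by (auto dest: dvd_imp_le)
  then have "(\<Sum>e | e dvd d. energy A e) = energy A d + (\<Sum>e | e dvd d \<and> e < d. energy A e)"
    using assms(2) by (simp add: sum.insert)
  with sum_energy_divisors[OF assms] show ?thesis by simp
qed

text \<open>Integrality follows by induction from \<open>energy_eq\<close> and nonnegativity from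
  the definition, so the floor loses nothing.\<close>

lemma real_energy_nat:
  assumes "finite A"
  shows "d > 0 \<Longrightarrow> real (energy_nat A d) = energy A d"
proof (induction d rule: less_induct)
  case (less d)
  have "real (energy_nat A e) = energy A e" if "e dvd d \<and> e < d" for e
    using that less dvd_pos_nat by blast
  then have "(\<Sum>e | e dvd d \<and> e < d. energy A e) = (\<Sum>e | e dvd d \<and> e < d. real (energy_nat A e))"
    by (intro sum.cong) auto
  then have "energy A d = of_int (int (d * pair_count A d) - int (\<Sum>e | e dvd d \<and> e < d. energy_nat A e))"
    unfolding energy_eq[OF assms less.prems] by simp
  then have "energy A d \<in> \<int>" by (metis Ints_of_int)
  then show ?case using energy_nonneg[of A d] by (auto simp: energy_nat_def elim: Ints_cases)
qed

lemma energy_nat_eq_0_iff: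
  assumes "finite A" "d > 0"
  shows "energy_nat A d = 0 \<longleftrightarrow> vanishes (\<lambda>a. a) A d"
  using real_energy_nat[OF assms] energy_eq_0_iff[OF assms(2)] by (metis of_nat_eq_0_iff)

text \<open>The truncated subtraction is exact because its result is an energy. Divisors are
  selected by a 0/1 factor, as a term can do.\<close>

lemma energy_nat_rec:
  assumes "finite A"
  shows "energy_nat A d =
    d * pair_count A d - (\<Sum>e<d. of_bool (e dvd d) * energy_nat A e)"
proof (cases "d = 0")
  case True
  \<comment> \<open>Every z satisfies \<open>z ^ 0 = 1\<close>. The sum over an infinite set is 0 by
    convention, which agrees with the right side; the table starts at d = 0.\<close>
  have "primitive_roots_unity 0 = UNIV" by (simp add: primitive_roots_unity_def)
  moreover have "\<not> finite (UNIV :: complex set)" by (rule infinite_UNIV_char_0)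
  ultimately have "energy A 0 = 0" unfolding energy_def by simp
  then show ?thesis using True by (simp add: energy_nat_def)
next
  case False
  have eq: "real (energy_nat A e) = energy A e" if "e dvd d" for e
    using real_energy_nat[OF assms] that False dvd_pos_nat by blast
  have "(\<Sum>e<d. of_bool (e dvd d) * energy_nat A e) = (\<Sum>e | e dvd d \<and> e < d. energy_nat A e)"
    by (rule sum.mono_neutral_cong_right) auto
  then have "real (\<Sum>e<d. of_bool (e dvd d) * energy_nat A e) = (\<Sum>e | e dvd d \<and> e < d. energy A e)"
    using eq by simp
  then have "real (energy_nat A d) =
      real (d * pair_count A d) - real (\<Sum>e<d. of_bool (e dvd d) * energy_nat A e)"
    using energy_eq[OF assms, of d] eq[of d] False by simp
  then have "energy_nat A d + (\<Sum>e<d. of_bool (e dvd d) * energy_nat A e) = d * pair_count A d"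
    by linarith
  then show ?thesis by simp
qed

text \<open>This keeps the table entries polynomial in N and is the source of the cube in the time
  bound.\<close>

lemma energy_nat_le:
  assumes "A \<subseteq> {0..<int N}" "d \<le> N"
  shows "energy_nat A d \<le> N ^ 3"
proof -
  have fin: "finite A" using assms(1) finite_subset by blast
  have card: "card A \<le> N" using card_mono[OF _ assms(1)] by simp
  have "pair_count A d \<le> (\<Sum>a\<in>A. \<Sum>b\<in>A. 1)"
    unfolding pair_count_def by (intro sum_mono) simp
  also have "\<dots> = card A * card A" by simp
  also have "\<dots> \<le> N * N" using card by (intro mult_le_mono)
  finally have "d * pair_count A d \<le> N * (N * N)" using assms(2) by (intro mult_le_mono)
  then show ?thesis
    unfolding energy_nat_rec[OF fin, of d] by (simp add: power3_eq_cube mult.assoc)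
qed

section \<open>Arithmetic forms of the two conditions\<close>

text \<open>For a prime p this says that s is a positive power of p, using only divisibility and a
  bounded quantifier.\<close>

definition power_of :: "nat \<Rightarrow> nat \<Rightarrow> bool" where
  "power_of s p \<longleftrightarrow> 1 < s \<and> (\<forall>x<s + 1. 1 < x \<and> x dvd s \<longrightarrow> p dvd x)"

lemma power_of_iff_ex:
  assumes "prime p"
  shows "power_of s p \<longleftrightarrow> (\<exists>k>0. s = p ^ k)"
proof
  assume s: "power_of s p"
  then have s1: "s > 1" by (simp add: power_of_def)
  obtain y where y: "s = p ^ multiplicity p s * y" "\<not> p dvd y"
    using multiplicity_decompose'[of s p] s1 prime_gt_1_nat[OF assms] by auto
  \<comment> \<open>The p-free part y is a divisor of s that p does not divide, so it must be
    1.\<close>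
  have ys: "y dvd s" using y(1) by (metis dvd_triv_right)
  moreover have "y \<noteq> 0" using y(2) by (metis dvd_0_right)
  moreover have "y < s + 1" using dvd_imp_le[OF ys] s1 by simp
  ultimately have "\<not> 1 < y"
    using s y(2) unfolding power_of_def by blast
  with \<open>y \<noteq> 0\<close> have "y = 1" by simp
  from y(1) have "s = p ^ multiplicity p s" unfolding \<open>y = 1\<close> mult_1_right .
  moreover from this s1 have "multiplicity p s > 0" by (metis gr0I less_irrefl_nat power_0)
  ultimately show "\<exists>k>0. s = p ^ k" by blast
next
  assume "\<exists>k>0. s = p ^ k"
  then obtain k where k: "k > 0" "s = p ^ k" by blast
  have "p dvd x" if x: "1 < x" "x dvd s" for x
  proof -
    obtain j where j: "x = p ^ j" using x(2) k assms by (auto simp: divides_primepow_nat)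
    have "j \<noteq> 0"
    proof
      assume "j = 0"
      then show False using x(1) j by simp
    qed
    then show ?thesis using j by simp
  qed
  moreover have "1 < s"
    unfolding k(2) using prime_gt_1_nat[OF assms] k(1) by (rule one_less_power)
  ultimately show "power_of s p" unfolding power_of_def by blast
qed

lemma power_of_iff:
  assumes "prime p"
  shows "power_of s p \<longleftrightarrow> primepow s \<and> aprimedivisor s = p"
proof
  assume "power_of s p"
  then show "primepow s \<and> aprimedivisor s = p"
    using assms by (auto simp: power_of_iff_ex aprimedivisor_prime_power)
next
  assume s: "primepow s \<and> aprimedivisor s = p"
  then obtain q k where "prime q" "k > 0" "s = q ^ k" by (auto simp: primepow_def)
  with s show "power_of s p"
    using assms by (auto simp: power_of_iff_ex aprimedivisor_prime_power)
qed

text \<open>The exact power of p in d, described without exponentiation so that a term can recognize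
  it.\<close>

lemma power_of_exact_iff:
  assumes "prime p" "d > 0"
  shows "power_of s p \<and> s dvd d \<and> \<not> s * p dvd d \<longleftrightarrow> p dvd d \<and> s = p ^ multiplicity p d"
proof
  assume s: "power_of s p \<and> s dvd d \<and> \<not> s * p dvd d"
  then obtain k where k: "k > 0" "s = p ^ k" using assms(1) power_of_iff_ex by blast
  have "multiplicity p d = k"
    using s k by (intro multiplicity_eqI) (simp_all add: mult.commute)
  moreover have "p dvd d" using s k by (metis dvd_power dvd_trans)
  ultimately show "p dvd d \<and> s = p ^ multiplicity p d" using k by simp
next
  assume s: "p dvd d \<and> s = p ^ multiplicity p d"
  then have "multiplicity p d > 0" using assms by (simp add: prime_multiplicity_gt_zero_iff)
  then have "power_of s p" using s assms(1) power_of_iff_ex by blast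
  moreover have "\<not> p ^ Suc (multiplicity p d) dvd d"
    using assms(2) prime_gt_1_nat[OF assms(1)] by (subst power_dvd_iff_le_multiplicity) auto
  ultimately show "power_of s p \<and> s dvd d \<and> \<not> s * p dvd d"
    using s multiplicity_dvd by (simp add: mult.commute)
qed

text \<open>Each prime power contributes one prime factor, so the multiplicity of p in a product is
  a count. This replaces products, which terms do not offer, by sums.\<close>

lemma prod_aprimedivisor_eq_iff:
  assumes "finite S" "finite T" and pp: "\<And>s :: nat. s \<in> S \<union> T \<Longrightarrow> primepow s"
  shows "(\<Prod>s\<in>S. aprimedivisor s) = (\<Prod>s\<in>T. aprimedivisor s) \<longleftrightarrow>
    (\<forall>p. prime p \<longrightarrow> card {s \<in> S. aprimedivisor s = p} = card {s \<in> T. aprimedivisor s = p})"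
proof -
  have prime: "prime (aprimedivisor s)" if "s \<in> S \<union> T" for s
    using pp[OF that] by (auto simp: primepow_def aprimedivisor_prime_power)
  have mult: "multiplicity p (\<Prod>s\<in>U. aprimedivisor s) = card {s \<in> U. aprimedivisor s = p}"
    if "prime p" "U \<subseteq> S \<union> T" "finite U" for p and U :: "nat set"
  proof -
    have pos: "aprimedivisor s > 0" if "s \<in> U" for s
    proof -
      have "s \<in> S \<union> T" using that \<open>U \<subseteq> S \<union> T\<close> by (rule subsetD[rotated])
      from prime[OF this] show ?thesis by (rule prime_gt_0_nat)
    qed
    have nz: "0 \<notin> aprimedivisor ` U"
    proof
      assume "0 \<in> aprimedivisor ` U"
      then obtain s where "s \<in> U" "0 = aprimedivisor s" by (elim imageE)
      with pos[of s] show False by simp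
    qed
    have "multiplicity p (\<Prod>s\<in>U. aprimedivisor s) = (\<Sum>s\<in>U. multiplicity p (aprimedivisor s))"
      using prime_imp_prime_elem[OF that(1)] nz that(3)
      by (rule prime_elem_multiplicity_prod_distrib)
    also have "\<dots> = (\<Sum>s\<in>U. if aprimedivisor s = p then 1 else 0)"
    proof (rule sum.cong)
      fix s assume "s \<in> U"
      then have "s \<in> S \<union> T" using that(2) by (rule subsetD[rotated])
      then have ps: "prime (aprimedivisor s)" by (rule prime)
      show "multiplicity p (aprimedivisor s) = (if aprimedivisor s = p then 1 else 0)"
      proof (cases "aprimedivisor s = p")
        case True
        then show ?thesis using prime_gt_1_nat[OF that(1)] by (simp add: multiplicity_self)
      next
        case False
        then show ?thesis using prime_multiplicity_other[OF that(1) ps] by simp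
      qed
    qed simp
    also have "\<dots> = card {s \<in> U. aprimedivisor s = p}"
      using that(3) by (simp add: sum.If_cases Int_def)
    finally show ?thesis .
  qed
  have pos: "(\<Prod>s\<in>U. aprimedivisor s) > 0" if "U \<subseteq> S \<union> T" for U :: "nat set"
  proof (rule prod_pos)
    fix s assume "s \<in> U"
    then have "s \<in> S \<union> T" using that by (rule subsetD[rotated])
    from prime[OF this] show "aprimedivisor s > 0" by (rule prime_gt_0_nat)
  qed
  show ?thesis
  proof
    assume eq: "\<forall>p. prime p \<longrightarrow> card {s \<in> S. aprimedivisor s = p} = card {s \<in> T. aprimedivisor s = p}"
    show "(\<Prod>s\<in>S. aprimedivisor s) = (\<Prod>s\<in>T. aprimedivisor s)"
    proof (rule multiplicity_eq_nat)
      fix p :: nat assume p: "prime p"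
      show "multiplicity p (\<Prod>s\<in>S. aprimedivisor s) = multiplicity p (\<Prod>s\<in>T. aprimedivisor s)"
        using mult[OF p Un_upper1 assms(1)] mult[OF p Un_upper2 assms(2)] eq p by simp
    qed (rule pos[OF Un_upper1], rule pos[OF Un_upper2])
  next
    assume eq: "(\<Prod>s\<in>S. aprimedivisor s) = (\<Prod>s\<in>T. aprimedivisor s)"
    show "\<forall>p. prime p \<longrightarrow> card {s \<in> S. aprimedivisor s = p} = card {s \<in> T. aprimedivisor s = p}"
    proof (intro allI impI)
      fix p :: nat assume "prime p"
      then show "card {s \<in> S. aprimedivisor s = p} = card {s \<in> T. aprimedivisor s = p}"
        using mult[OF _ Un_upper1 assms(1)] mult[OF _ Un_upper2 assms(2)] eq by simp
    qed
  qed
qed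

lemma sum_of_bool_lessThan: "(\<Sum>s<n. of_bool (P s)) = card {s \<in> {..<n :: nat}. P s}"
  by (simp add: Int_def)

text \<open>|A| is the product of the primes below its own prime power divisors, so (T1^N) asks for
  equally many powers of every prime among these and in S_A^N.\<close>

lemma T1_mod_iff_counts:
  assumes "A \<subseteq> {0..<int N}" "A \<noteq> {}" "N > 0"
  shows "T1_mod N A \<longleftrightarrow> (\<forall>p<N + 1. prime p \<longrightarrow>
    (\<Sum>s<N + 1. of_bool (power_of s p \<and> s dvd card A)) =
    (\<Sum>s<N + 1. of_bool (power_of s p \<and> s dvd N \<and> energy_nat A s = 0) :: nat))"
proof -
  have fin: "finite A" using assms(1) finite_subset by blast
  have cA: "card A > 0" "card A \<le> N"
    using fin assms(2) card_mono[OF _ assms(1)] by (auto simp: card_gt_0_iff)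
  define S where "S = primepow_factors (card A)"
  define T where "T = S_set_mod N A"
  have T: "T = {s. primepow s \<and> s dvd N \<and> energy_nat A s = 0}"
    unfolding T_def S_set_mod_eq[OF fin] primepow_factors_def
    using energy_nat_eq_0_iff[OF fin primepow_gt_0_nat] by blast
  have sub: "S \<subseteq> {..N}" "T \<subseteq> {..N}"
    using dvd_imp_le[OF _ cA(1)] dvd_imp_le[OF _ assms(3)] cA(2) le_trans
    unfolding S_def T primepow_factors_def by blast+
  have finST: "finite S" "finite T" using sub finite_subset by blast+
  have pp: "primepow s" if "s \<in> S \<union> T" for s
    using that by (auto simp: S_def T primepow_factors_def)
  have cS: "card {s \<in> S. aprimedivisor s = p} = (\<Sum>s<N + 1. of_bool (power_of s p \<and> s dvd card A))"
    if "prime p" for p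
  proof -
    have "{s \<in> S. aprimedivisor s = p} = {s \<in> {..<N + 1}. power_of s p \<and> s dvd card A}"
      using sub(1) that by (auto simp: S_def primepow_factors_def power_of_iff)
    then show ?thesis by (simp only: sum_of_bool_lessThan)
  qed
  have cT: "card {s \<in> T. aprimedivisor s = p} =
      (\<Sum>s<N + 1. of_bool (power_of s p \<and> s dvd N \<and> energy_nat A s = 0))"
    if "prime p" for p
  proof -
    have "{s \<in> T. aprimedivisor s = p} =
        {s \<in> {..<N + 1}. power_of s p \<and> s dvd N \<and> energy_nat A s = 0}"
      using sub(2) that by (auto simp: T power_of_iff)
    then show ?thesis by (simp only: sum_of_bool_lessThan)
  qed
  \<comment> \<open>Both sets consist of numbers up to N, so a prime above N has count 0 on either
    side.\<close>
  have large: "{s \<in> U. aprimedivisor s = p} = {}"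
    if "U \<subseteq> {..N}" "U \<subseteq> S \<union> T" "N < p" for U and p :: nat
  proof -
    have "aprimedivisor s \<noteq> p" if s: "s \<in> U" for s
    proof -
      have "s \<le> N" using s \<open>U \<subseteq> {..N}\<close> by (simp add: subset_eq)
      have "s \<in> S \<union> T" using \<open>U \<subseteq> S \<union> T\<close> s by (rule subsetD)
      then have ps: "primepow s" by (rule pp)
      then obtain q k where q: "prime q" "k > 0" "s = q ^ k" by (auto simp: primepow_def)
      then have "aprimedivisor s = q" by (simp add: aprimedivisor_prime_power)
      moreover have "q dvd s" using q(2,3) by simp
      then have "q \<le> s" using primepow_gt_0_nat[OF ps] by (rule dvd_imp_le)
      ultimately show ?thesis using \<open>s \<le> N\<close> \<open>N < p\<close> by linarith
    qed
    then show ?thesis by blast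
  qed
  have "T1_mod N A \<longleftrightarrow> (\<Prod>s\<in>S. aprimedivisor s) = (\<Prod>s\<in>T. aprimedivisor s)"
    using cA(1) by (simp add: T1_mod_iff S_def T_def prod_aprimedivisor_primepow_factors)
  also have "\<dots> \<longleftrightarrow> (\<forall>p. prime p \<longrightarrow>
      card {s \<in> S. aprimedivisor s = p} = card {s \<in> T. aprimedivisor s = p})"
    using finST pp by (rule prod_aprimedivisor_eq_iff)
  also have "\<dots> \<longleftrightarrow> (\<forall>p<N + 1. prime p \<longrightarrow>
      card {s \<in> S. aprimedivisor s = p} = card {s \<in> T. aprimedivisor s = p})"
  proof (intro iffI allI impI)
    fix p :: nat
    assume *: "\<forall>p<N + 1. prime p \<longrightarrow>
        card {s \<in> S. aprimedivisor s = p} = card {s \<in> T. aprimedivisor s = p}" and "prime p"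
    show "card {s \<in> S. aprimedivisor s = p} = card {s \<in> T. aprimedivisor s = p}"
    proof (cases "p < N + 1")
      case False
      then have "N < p" by simp
      show ?thesis
        by (simp only: large[OF sub(1) Un_upper1 \<open>N < p\<close>] large[OF sub(2) Un_upper2 \<open>N < p\<close>])
    qed (use * \<open>prime p\<close> in blast)
  qed blast
  finally show ?thesis using cS cT by simp
qed

text \<open>For each prime p dividing d exactly one s qualifies, namely the exact power of p in d,
  and for other primes none does.\<close>

lemma T2_mod_iff_energy:
  assumes "finite A" "N > 0"
  shows "T2_mod N A \<longleftrightarrow> (\<forall>d<N + 1. 1 < d \<and> d dvd N \<and>
    (\<forall>p<N + 1. prime p \<longrightarrow>
      (\<forall>s<N + 1. power_of s p \<and> s dvd d \<and> \<not> s * p dvd d \<longrightarrow> energy_nat A s = 0)) \<longrightarrow>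
    energy_nat A d = 0)"
proof -
  have "(\<forall>p<N + 1. prime p \<longrightarrow>
      (\<forall>s<N + 1. power_of s p \<and> s dvd d \<and> \<not> s * p dvd d \<longrightarrow> energy_nat A s = 0)) \<longleftrightarrow>
    (\<forall>p. prime p \<longrightarrow> p dvd d \<longrightarrow> vanishes (\<lambda>a. a) A (p ^ multiplicity p d))"
    if d: "1 < d" "d dvd N" for d
  proof -
    have dN: "d \<le> N" using d assms(2) by (simp add: dvd_imp_le)
    have "p < N + 1" "p ^ multiplicity p d < N + 1" if "p dvd d" for p
      using dvd_imp_le[OF that] dvd_imp_le[OF multiplicity_dvd, of d p] d dN by auto
    moreover have "energy_nat A (p ^ k) = 0 \<longleftrightarrow> vanishes (\<lambda>a. a) A (p ^ k)" if "prime p" for p k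
      using energy_nat_eq_0_iff[OF assms(1)] prime_gt_0_nat[OF that] by simp
    moreover have "power_of s p \<and> s dvd d \<and> \<not> s * p dvd d \<longleftrightarrow> p dvd d \<and> s = p ^ multiplicity p d"
      if "prime p" for s p
      using that d by (intro power_of_exact_iff) auto
    ultimately show ?thesis by (smt (verit, best))
  qed
  moreover have "d < N + 1" if "d dvd N" for d
    using dvd_imp_le[OF that assms(2)] by simp
  moreover have "energy_nat A d = 0 \<longleftrightarrow> vanishes (\<lambda>a. a) A d" if "1 < d" for d
    using energy_nat_eq_0_iff[OF assms(1)] that by simp
  ultimately show ?thesis
    unfolding T2_mod_iff[OF assms] products_vanish_def by (smt (verit, best))
qed

section \<open>The decision procedure\<close>

text \<open>Nonzero means true, and every connective returns 0 or 1; the double negations below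
  normalize values so that sums can count them.\<close>

definition tNot :: "tm \<Rightarrow> tm" where
  "tNot a = Minus (Num 1) a"

definition tAnd :: "tm \<Rightarrow> tm \<Rightarrow> tm" where
  "tAnd a b = tNot (tNot (Times a b))"

definition tImp :: "tm \<Rightarrow> tm \<Rightarrow> tm" where
  "tImp a b = tNot (tAnd a (tNot b))"

text \<open>One of the truncated differences is 0, so their sum is the absolute difference.\<close>

definition tEq :: "tm \<Rightarrow> tm \<Rightarrow> tm" where
  "tEq a b = tNot (Plus (Minus a b) (Minus b a))"

definition tLess :: "tm \<Rightarrow> tm \<Rightarrow> tm" where
  "tLess a b = tNot (tNot (Minus b a))"

definition tAll :: "nat \<Rightarrow> tm \<Rightarrow> tm \<Rightarrow> tm" where
  "tAll v b t = tNot (Sum v b (tNot t))"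

text \<open>Register \<open>19\<close> is reserved for the quotient in \<open>tDvd\<close>, register \<open>18\<close> for divisors and elements.\<close>

definition tDvd :: "tm \<Rightarrow> tm \<Rightarrow> tm" where
  "tDvd a b = tNot (tAll 19 (Plus b (Num 1)) (tNot (tEq (Times a (Var 19)) b)))"

lemma vars_below_connectives [simp]:
  "vars_below j (tNot a) \<longleftrightarrow> vars_below j a"
  "vars_below j (tAnd a b) \<longleftrightarrow> vars_below j a \<and> vars_below j b"
  "vars_below j (tImp a b) \<longleftrightarrow> vars_below j a \<and> vars_below j b"
  "vars_below j (tEq a b) \<longleftrightarrow> vars_below j a \<and> vars_below j b"
  "vars_below j (tLess a b) \<longleftrightarrow> vars_below j a \<and> vars_below j b"
  "vars_below j (tAll v b a) \<longleftrightarrow> v < j \<and> vars_below j b \<and> vars_below j a"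
  "vars_below j (tDvd a b) \<longleftrightarrow> 19 < j \<and> vars_below j a \<and> vars_below j b"
  by (auto simp: tNot_def tAnd_def tImp_def tEq_def tLess_def tAll_def tDvd_def)

lemma tval_tNot [simp]: "tval (tNot a) r m = of_bool (tval a r m = 0)"
  by (simp add: tNot_def)

lemma tval_tAnd [simp]: "tval (tAnd a b) r m = of_bool (tval a r m \<noteq> 0 \<and> tval b r m \<noteq> 0)"
  by (simp add: tAnd_def)

lemma tval_tImp [simp]: "tval (tImp a b) r m = of_bool (tval a r m \<noteq> 0 \<longrightarrow> tval b r m \<noteq> 0)"
  by (auto simp: tImp_def)

lemma tval_tEq [simp]: "tval (tEq a b) r m = of_bool (tval a r m = tval b r m)"
  by (auto simp: tEq_def)

lemma tval_tLess [simp]: "tval (tLess a b) r m = of_bool (tval a r m < tval b r m)"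
  by (auto simp: tLess_def)

lemma tval_tAll [simp]:
  "tval (tAll v b t) r m = of_bool (\<forall>i<tval b r m. tval t (r(v := i)) m \<noteq> 0)"
  by (auto simp: tAll_def)

text \<open>The quotient can be as large as b (for a = 1), and b = 0 still needs the candidate
  0.\<close>

lemma dvd_iff_bounded: "a dvd b \<longleftrightarrow> (\<exists>w<b + 1. a * w = (b :: nat))"
proof
  assume "a dvd b"
  then obtain w where w: "b = a * w" by (elim dvdE)
  show "\<exists>w<b + 1. a * w = b"
  proof (cases "b = 0")
    case False
    then have "w \<le> b" using w by (cases a) auto
    then show ?thesis using w[symmetric] by (intro exI[of _ w]) simp
  qed auto
qed auto

text \<open>The search for the quotient overwrites register 19, so the arguments must not read
  it.\<close>

lemma tval_tDvd [simp]:
  assumes "vars_below 19 a" "vars_below 19 b"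
  shows "tval (tDvd a b) r m = of_bool (tval a r m dvd tval b r m)"
proof -
  have "tval a (r(19 := w)) m = tval a r m" "tval b (r(19 := w)) m = tval b r m" for w
    using assms by (auto intro!: tval_cong[of 19])
  then show ?thesis by (simp add: tDvd_def dvd_iff_bounded[of "tval a r m"])
qed

definition tPrime :: "nat \<Rightarrow> tm" where
  "tPrime p = tAnd (tLess (Num 1) (Var p))
     (tAll 18 (Var p) (tImp (tLess (Num 1) (Var 18)) (tNot (tDvd (Var 18) (Var p)))))"

definition tPower_of :: "nat \<Rightarrow> nat \<Rightarrow> tm" where
  "tPower_of s p = tAnd (tLess (Num 1) (Var s))
     (tAll 18 (Plus (Var s) (Num 1))
       (tImp (tAnd (tLess (Num 1) (Var 18)) (tDvd (Var 18) (Var s))) (tDvd (Var p) (Var 18))))"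

text \<open>
  Register \<open>0\<close> holds \<open>N\<close>, memory cell \<open>i < N\<close> the truth value of \<open>i \<in> A\<close>, and cell \<open>N + d\<close> the number
  \<open>energy_nat A d\<close> once it has been computed.
\<close>

definition tEnergy :: "tm \<Rightarrow> tm" where
  "tEnergy a = Mem (Plus (Var 0) a)"

definition tCard :: tm where
  "tCard = Sum 18 (Var 0) (Mem (Var 18))"

text \<open>The right side of \<open>energy_nat_rec\<close> for d in register 1, with the smaller
  energies read from the table.\<close>

definition tTable :: tm where
  "tTable = Minus
     (Times (Var 1) (Sum 6 (Var 0) (Sum 7 (Var 0) (Times (Times (Mem (Var 6)) (Mem (Var 7)))
       (tDvd (Var 1) (Plus (Minus (Var 6) (Var 7)) (Minus (Var 7) (Var 6))))))))
     (Sum 5 (Var 1) (Times (tDvd (Var 5) (Var 1)) (tEnergy (Var 5))))"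

definition tT1 :: tm where
  "tT1 = tAll 5 (Plus (Var 0) (Num 1)) (tImp (tPrime 5)
     (tEq (Sum 6 (Plus (Var 0) (Num 1)) (tAnd (tPower_of 6 5) (tDvd (Var 6) tCard)))
       (Sum 6 (Plus (Var 0) (Num 1))
         (tAnd (tPower_of 6 5) (tAnd (tDvd (Var 6) (Var 0)) (tNot (tEnergy (Var 6))))))))"

definition tT2 :: tm where
  "tT2 = tAll 7 (Plus (Var 0) (Num 1)) (tImp
     (tAnd (tLess (Num 1) (Var 7)) (tAnd (tDvd (Var 7) (Var 0))
       (tAll 5 (Plus (Var 0) (Num 1)) (tImp (tPrime 5)
         (tAll 6 (Plus (Var 0) (Num 1)) (tImp
           (tAnd (tPower_of 6 5) (tAnd (tDvd (Var 6) (Var 7)) (tNot (tDvd (Times (Var 6) (Var 5)) (Var 7)))))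
           (tNot (tEnergy (Var 6)))))))))
     (tNot (tEnergy (Var 7))))"

lemma tval_tPrime [simp]:
  assumes "p < 18"
  shows "tval (tPrime p) r m = of_bool (prime (r p))"
proof -
  have "prime (r p) \<longleftrightarrow> 1 < r p \<and> (\<forall>x<r p. 1 < x \<longrightarrow> \<not> x dvd r p)"
  proof
    assume "prime (r p)"
    then show "1 < r p \<and> (\<forall>x<r p. 1 < x \<longrightarrow> \<not> x dvd r p)"
      by (auto simp: prime_nat_iff)
  next
    assume *: "1 < r p \<and> (\<forall>x<r p. 1 < x \<longrightarrow> \<not> x dvd r p)"
    show "prime (r p)"
      unfolding prime_nat_iff
    proof (intro conjI allI impI)
      fix x assume x: "x dvd r p"
      then have "x \<le> r p" using * by (intro dvd_imp_le) auto
      moreover have "x \<noteq> 0" using x * by (metis dvd_0_left_iff not_less_zero)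
      ultimately show "x = 1 \<or> x = r p" using * x by (meson le_neq_implies_less nat_neq_iff less_one)
    qed (use * in simp)
  qed
  then show ?thesis using assms by (simp add: tPrime_def) blast
qed

lemma tval_tPower_of [simp]:
  "p < 18 \<Longrightarrow> s < 18 \<Longrightarrow> tval (tPower_of s p) r m = of_bool (power_of (r s) (r p))"
  by (simp add: tPower_of_def power_of_def) blast

lemma tval_tEnergy [simp]: "tval (tEnergy a) r m = m (r 0 + tval a r m)"
  by (simp add: tEnergy_def)

lemma vars_below_terms [simp]:
  "vars_below j (tPrime p) \<longleftrightarrow> p < j \<and> 19 < j"
  "vars_below j (tPower_of s p) \<longleftrightarrow> s < j \<and> p < j \<and> 19 < j"
  "vars_below j (tEnergy a) \<longleftrightarrow> 0 < j \<and> vars_below j a"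
  "vars_below j tCard \<longleftrightarrow> 18 < j"
  by (auto simp: tPrime_def tPower_of_def tEnergy_def tCard_def)

lemma sum_int_subset:
  fixes h :: "int \<Rightarrow> nat"
  assumes "A \<subseteq> {0..<int N}"
  shows "(\<Sum>a\<in>A. h a) = (\<Sum>i<N. of_bool (int i \<in> A) * h (int i))"
proof -
  have "(\<Sum>a\<in>A. h a) = (\<Sum>a\<in>int ` {i \<in> {..<N}. int i \<in> A}. h a)"
  proof (rule sum.cong)
    show "A = int ` {i \<in> {..<N}. int i \<in> A}"
    proof (intro equalityI subsetI)
      fix a assume "a \<in> A"
      then show "a \<in> int ` {i \<in> {..<N}. int i \<in> A}"
        using assms by (intro image_eqI[of _ _ "nat a"]) (auto simp: nat_less_iff)
    qed auto
  qed simp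
  also have "\<dots> = (\<Sum>i | i \<in> {..<N} \<and> int i \<in> A. h (int i))"
    by (subst sum.reindex) auto
  also have "\<dots> = (\<Sum>i<N. of_bool (int i \<in> A) * h (int i))"
    by (rule sum.mono_neutral_cong_left) auto
  finally show ?thesis .
qed

text \<open>The memory after i rounds of tabulation: i = 0 is the input, and i = N + 1 holds all
  energies for d from 0 to N.\<close>

definition table :: "nat \<Rightarrow> int set \<Rightarrow> nat \<Rightarrow> nat \<Rightarrow> nat" where
  "table N A i = (\<lambda>j. if j < N then of_bool (int j \<in> A) else
     if j < N + i then energy_nat A (j - N) else 0)"

lemma table_Suc: "(table N A i)(N + i := energy_nat A i) = table N A (Suc i)"
  by (auto simp: table_def fun_eq_iff)

lemma table_le:
  assumes "A \<subseteq> {0..<int N}" "i \<le> N + 1"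
  shows "table N A i j \<le> N ^ 3 + 1"
proof -
  have "energy_nat A (j - N) \<le> N ^ 3" if "j < N + i"
    using that assms(2) by (intro energy_nat_le[OF assms(1)]) simp
  then show ?thesis by (simp add: table_def trans_le_add1 le_SucI)
qed

lemma int_dvd_diff_iff: "int d dvd int a - int b \<longleftrightarrow> d dvd (a - b) + (b - a)"
proof (cases "a \<le> b")
  case True
  then have "int a - int b = - int ((a - b) + (b - a))" by simp
  then show ?thesis by (simp only: dvd_minus_iff int_dvd_int_iff)
next
  case False
  then have "int a - int b = int ((a - b) + (b - a))" by simp
  then show ?thesis by (simp only: int_dvd_int_iff)
qed

text \<open>When register 1 holds d, exactly the entries below d are present, as the recursion
  requires.\<close>

lemma tval_tTable:
  assumes A: "A \<subseteq> {0..<int N}" and "r 0 = N"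
  shows "tval tTable r (table N A (r 1)) = energy_nat A (r 1)"
proof -
  let ?m = "table N A (r 1)"
  have fin: "finite A" using A finite_subset by blast
  have "pair_count A (r 1) = (\<Sum>a<N. \<Sum>b<N. ?m a * ?m b * of_bool (r 1 dvd (a - b) + (b - a)))"
    unfolding pair_count_def sum_int_subset[OF A]
    by (intro sum.cong refl)
      (simp add: sum_distrib_left table_def int_dvd_diff_iff mult.assoc)
  moreover have "(\<Sum>e<r 1. of_bool (e dvd r 1) * ?m (N + e)) =
      (\<Sum>e<r 1. of_bool (e dvd r 1) * energy_nat A e)"
    by (intro sum.cong) (auto simp: table_def)
  ultimately show ?thesis
    unfolding energy_nat_rec[OF fin, of "r 1"] using assms(2) by (simp add: tTable_def)
qed

lemma tval_tT1:
  assumes A: "A \<subseteq> {0..<int N}" "A \<noteq> {}" and N: "N > 0" and r: "r 0 = N"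
  shows "tval tT1 r (table N A (N + 1)) = of_bool (T1_mod N A)"
proof -
  let ?m = "table N A (N + 1)"
  have "card A = (\<Sum>i<N. of_bool (int i \<in> A))"
    using sum_int_subset[OF A(1), of "\<lambda>_. 1"] by simp
  then have card: "(\<Sum>i<N. ?m i) = card A" by (simp add: table_def)
  have energy: "?m (N + s) = energy_nat A s" if "s < N + 1" for s
    using that by (simp add: table_def)
  have tC: "tval tCard r' ?m = card A" if "r' 0 = N" for r' using that card by (simp add: tCard_def)
  show ?thesis
    unfolding T1_mod_iff_counts[OF A N] tT1_def
    using r energy tC by simp
qed

lemma tval_tT2:
  assumes A: "A \<subseteq> {0..<int N}" and N: "N > 0" and r: "r 0 = N"
  shows "tval tT2 r (table N A (N + 1)) = of_bool (T2_mod N A)"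
proof -
  let ?m = "table N A (N + 1)"
  have fin: "finite A" using A finite_subset by blast
  have energy: "?m (N + s) = energy_nat A s" if "s < N + 1" for s
    using that by (simp add: table_def)
  have "tval tT2 r ?m = of_bool (\<forall>d<N + 1. 1 < d \<and> d dvd N \<and>
    (\<forall>p<N + 1. prime p \<longrightarrow>
      (\<forall>s<N + 1. power_of s p \<and> s dvd d \<and> \<not> s * p dvd d \<longrightarrow> ?m (N + s) = 0)) \<longrightarrow>
    ?m (N + d) = 0)"
    unfolding tT2_def using r
    by (simp only: tval_tAll tval_tImp tval_tAnd tval_tNot tval_tLess tval_tDvd tval_tPrime
        tval_tPower_of tval_tEnergy tval.simps vars_below.simps fun_upd_apply of_bool_eq_0_iff
        not_not if_True if_False) simp
  also have "\<dots> = of_bool (T2_mod N A)"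
    unfolding T2_mod_iff_energy[OF fin N] using energy by (simp cong: conj_cong)
  finally show ?thesis .
qed

text \<open>Register 1 holds the current d, 2 the rounds left, 3 the constant 1, and 4 the address N
  + d.\<close>

definition table_com :: com where
  "table_com = Seq (Const 3 1) (Seq (Add 2 0 3) (WhilePos 2
     (Seq (compile tTable 20) (Seq (Add 4 0 1) (Seq (Store 4 20) (Seq (Add 1 1 3) (Sub 2 2 3)))))))"

definition decision_com :: com where
  "decision_com = Seq table_com (Seq (compile (tAnd tT1 tT2) 20) (Seq (Const 1 0) (Add 0 20 1)))"

text \<open>X dominates the cells (at most N^3 + 1), the counters (at most N + 1) and the address
  (at most 2 N). The 5 covers the four instructions after the term and the loop test.\<close>

lemma runs_table_com:
  assumes A: "A \<subseteq> {0..<int N}"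
  defines "X \<equiv> N ^ 3 + 2 * N + 2"
  shows "\<exists>r. runs table_com (input_state N A)
      (3 + (N + 1) * (cost_bound tTable X + 5)) (r, table N A (N + 1)) \<and> r 0 = N \<and> (\<forall>i<20. r i \<le> X)"
proof -
  let ?r0 = "(\<lambda>i. if i = 0 then N else 0) :: nat \<Rightarrow> nat"
  let ?r1 = "?r0(3 := 1)"
  let ?r2 = "?r1(2 := ?r1 0 + ?r1 3)"
  let ?body = "Seq (compile tTable 20) (Seq (Add 4 0 1) (Seq (Store 4 20) (Seq (Add 1 1 3) (Sub 2 2 3))))"
  let ?B = "cost_bound tTable X + (1 + (1 + (1 + 1)))"
  \<comment> \<open>Registers 5 to 19 include the bound variables of the terms; they remain 0
    between rounds because compiled code restores every register below 20.\<close>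
  let ?P = "\<lambda>i (r :: nat \<Rightarrow> nat) m. m = table N A i \<and> r 0 = N \<and> r 1 = i \<and> r 3 = 1 \<and> r 4 \<le> 2 * N \<and>
    (\<forall>l<20. 4 < l \<longrightarrow> r l = 0)"
  have X: "N \<le> X" "2 * N \<le> X" "N + 1 \<le> X" "1 \<le> X" "N ^ 3 + 1 \<le> X" by (simp_all add: X_def)
  have input: "input_state N A = (?r0, table N A 0)"
    using A by (auto simp: input_state_def table_def fun_eq_iff subset_eq)
  have bound: "r l \<le> X" if "?P i r m" "i \<le> N + 1" "r 2 \<le> N + 1" "l < 20" for i r m and l :: nat
  proof -
    have "r 0 = N" "r 1 = i" "r 3 = 1" "r 4 \<le> 2 * N" using that(1) by blast+
    then have le: "r 0 \<le> X" "r 1 \<le> X" "r 2 \<le> X" "r 3 \<le> X" "r 4 \<le> X"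
      using that(2,3) X by linarith+
    consider "l = 0" | "l = 1" | "l = 2" | "l = 3" | "l = 4" | "4 < l" by linarith
    then show ?thesis
    proof cases
      case 6
      then have "r l = 0" using that(1,4) by blast
      then show ?thesis by simp
    qed (simp_all only: le)
  qed
  have "\<exists>r m. runs (WhilePos 2 ?body) (?r2, table N A 0) ((N + 1) * (?B + 1) + 1) (r, m) \<and>
      ?P (N + 1) r m \<and> r 2 = 0"
  proof (rule runs_While[where P = ?P and n = "N + 1"])
    fix i r m assume *: "i < N + 1" "?P i r m" "r 2 = N + 1 - i"
    have m: "m = table N A i" and r: "r 0 = N" "r 1 = i" "r 3 = 1" using *(2) by simp_all
    have vars: "vars_below 20 tTable" by (simp add: tTable_def)
    have "i \<le> N + 1" "r 2 \<le> N + 1" using *(1,3) by simp_all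
    then have r_le: "\<forall>l<20. r l \<le> X" using bound[OF *(2)] by blast
    have m_le: "\<forall>a. m a \<le> X"
      unfolding m by (intro allI le_trans[OF table_le[OF A \<open>i \<le> N + 1\<close>] X(5)])
    have "tval tTable r m = energy_nat A i"
      using tval_tTable[of A N r, OF A r(1)] unfolding r(2) m .
    with computes_compile[OF vars order_refl r_le m_le]
    have "computes (compile tTable 20) 20 (r, m) (cost_bound tTable X) (energy_nat A i)"
      by (simp only:)
    then obtain s where s: "runs (compile tTable 20) (r, m) (cost_bound tTable X) (s, m)"
      "s 20 = energy_nat A i" "\<And>l. l < 20 \<Longrightarrow> s l = r l"
      by (rule computesE) blast
    have s_eq: "s 0 = N" "s 1 = i" "s 2 = N + 1 - i" "s 3 = 1"
      using s(3) r *(3) by simp_all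
    let ?s1 = "s(4 := s 0 + s 1)"
    let ?m = "m(?s1 4 := ?s1 20)"
    let ?s2 = "?s1(1 := ?s1 1 + ?s1 3)"
    let ?s3 = "?s2(2 := ?s2 2 - ?s2 3)"
    have A: "runs ?body (r, m) ?B (?s3, ?m)"
      by (rule runs_Seq[OF s(1)], rule runs_Seq[OF runs_Add], rule runs_Seq[OF runs_Store],
        rule runs_Seq[OF runs_Add runs_Sub])
    have "?m = table N A (Suc i)" using s(2) s_eq m by (simp add: table_Suc)
    then have B: "?P (Suc i) ?s3 ?m" using * s_eq s(3) by simp
    have C: "?s3 2 = N + 1 - Suc i" using s_eq by simp
    show "\<exists>r' m'. runs ?body (r, m) ?B (r', m') \<and> ?P (Suc i) r' m' \<and> r' 2 = N + 1 - Suc i"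
      by (rule exI[of _ ?s3], rule exI[of _ ?m], rule conjI[OF A conjI[OF B C]])
  qed simp_all
  then obtain r m where r: "runs (WhilePos 2 ?body) (?r2, table N A 0) ((N + 1) * (?B + 1) + 1) (r, m)"
    "?P (N + 1) r m" "r 2 = 0" by (elim exE conjE) blast
  have "runs table_com (input_state N A) (1 + (1 + ((N + 1) * (?B + 1) + 1))) (r, m)"
    unfolding table_com_def input
    by (rule runs_Seq[OF runs_Const], rule runs_Seq[OF runs_Add], rule r(1))
  moreover have "1 + (1 + ((N + 1) * (?B + 1) + 1)) \<le> 3 + (N + 1) * (cost_bound tTable X + 5)"
    by (simp add: algebra_simps)
  ultimately have "runs table_com (input_state N A) (3 + (N + 1) * (cost_bound tTable X + 5)) (r, m)"
    by (rule runs_mono)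
  moreover have "r l \<le> X" if "l < 20" for l using bound[OF r(2) _ _ that] r(3) by simp
  ultimately show ?thesis using r(2) by blast
qed

section \<open>The complete program and its running time\<close>

lemma runs_decision_com:
  assumes A: "A \<subseteq> {0..<int N}" "A \<noteq> {}" and N: "N > 0"
  defines "X \<equiv> N ^ 3 + 2 * N + 2"
  shows "decides_within decision_com (input_state N A)
    (5 + (N + 1) * (cost_bound tTable X + 5) + cost_bound (tAnd tT1 tT2) X)
    (T1_mod N A \<and> T2_mod N A)"
proof -
  let ?Q = "T1_mod N A \<and> T2_mod N A" and ?m = "table N A (N + 1)"
  obtain r where r: "runs table_com (input_state N A) (3 + (N + 1) * (cost_bound tTable X + 5)) (r, ?m)"
    "r 0 = N" "\<forall>i<20. r i \<le> X"
    using runs_table_com[OF A(1)] unfolding X_def by blast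
  have "computes (compile (tAnd tT1 tT2) 20) 20 (r, ?m) (cost_bound (tAnd tT1 tT2) X)
      (tval (tAnd tT1 tT2) r ?m)"
  proof (rule computes_compile[of 20])
    have "N ^ 3 + 1 \<le> X" by (simp add: X_def)
    then show "\<forall>a. ?m a \<le> X" by (intro allI le_trans[OF table_le[OF A(1)]]) simp_all
  qed (use r(3) in \<open>simp_all add: tT1_def tT2_def\<close>)
  also have "tval (tAnd tT1 tT2) r ?m = of_bool ?Q"
    using tval_tT1[of A N r, OF A N r(2)] tval_tT2[of A N r, OF A(1) N r(2)] by simp
  finally obtain s where s: "runs (compile (tAnd tT1 tT2) 20) (r, ?m) (cost_bound (tAnd tT1 tT2) X) (s, ?m)"
    "s 20 = of_bool ?Q" by (rule computesE) blast
  let ?s1 = "s(1 := 0)"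
  let ?s2 = "?s1(0 := ?s1 20 + ?s1 1)"
  have "runs decision_com (input_state N A)
      ((3 + (N + 1) * (cost_bound tTable X + 5)) + (cost_bound (tAnd tT1 tT2) X + (1 + 1))) (?s2, ?m)"
    unfolding decision_com_def
    by (rule runs_Seq[OF r(1)], rule runs_Seq[OF s(1)], rule runs_Seq[OF runs_Const runs_Add])
  then have "runs decision_com (input_state N A)
      (5 + (N + 1) * (cost_bound tTable X + 5) + cost_bound (tAnd tT1 tT2) X) (?s2, ?m)"
    by (rule runs_mono) simp
  moreover have "?s2 0 = (if ?Q then 1 else 0)" using s(2) by simp
  ultimately show ?thesis unfolding decides_within_def runs_def by blast
qed

lemma polynomial_time:
  "\<exists>p :: nat poly. \<forall>N. 5 + (N + 1) * (cost_bound tTable (N ^ 3 + 2 * N + 2) + 5) +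
    cost_bound (tAnd tT1 tT2) (N ^ 3 + 2 * N + 2) = poly p N"
proof -
  obtain p q :: "nat poly" where p: "\<And>X. cost_bound tTable X = poly p X"
    and q: "\<And>X. cost_bound (tAnd tT1 tT2) X = poly q X"
    using cost_bound_poly by metis
  \<comment> \<open>The coefficients of 2 + 2 X + X^3, to be substituted into the polynomial cost
    bounds.\<close>
  define B :: "nat poly" where "B = [:2, 2, 0, 1:]"
  have B: "poly B N = N ^ 3 + 2 * N + 2" for N
    by (simp add: B_def power3_eq_cube algebra_simps)
  show ?thesis
    by (intro exI[of _ "[:5:] + [:1, 1:] * (pcompose p B + [:5:]) + pcompose q B"])
      (simp add: p q poly_pcompose B)
qed

theorem theorem3p1:
  shows "(\<forall>(A :: int set) (N :: nat). finite A \<and> A \<noteq> {} \<and> N > 0 \<longrightarrow>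
            (T1_mod N A \<and> T2_mod N A \<longrightarrow> tiles_mod N A) \<and>
            (tiles_mod N A \<longrightarrow> T1_mod N A) \<and>
            ((tiles_int A \<longrightarrow> T1 A \<and> T2 A) \<longrightarrow> (tiles_mod N A \<longrightarrow> T1_mod N A \<and> T2_mod N A)) \<and>
            (card (prime_factors (card A)) \<le> 2 \<and> tiles_mod N A \<longrightarrow> T1_mod N A \<and> T2_mod N A)) \<and>
         (\<exists>(c :: com) (p :: nat poly). \<forall>(N :: nat) (A :: int set).
            N > 0 \<and> A \<noteq> {} \<and> A \<subseteq> {0..<int N} \<longrightarrow>
            decides_within c (input_state N A) (poly p N) (T1_mod N A \<and> T2_mod N A) \<and>
            (card (prime_factors (card A)) \<le> 2 \<longrightarrow>
               decides_within c (input_state N A) (poly p N) (tiles_mod N A)))"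
proof (intro conjI allI impI)
  fix A :: "int set" and N :: nat
  assume AN: "finite A \<and> A \<noteq> {} \<and> N > 0"
  {
    assume "T1_mod N A \<and> T2_mod N A"
    then show "tiles_mod N A" using AN T1_T2_imp_tiles_mod by blast
  next
    assume "tiles_mod N A"
    then show "T1_mod N A" using AN tiles_mod_imp_T1 by blast
  next
    \<comment> \<open>Only (T2) is taken from the integers; (T1^N) holds because A tiles modulo
      N.\<close>
    assume "tiles_int A \<longrightarrow> T1 A \<and> T2 A" "tiles_mod N A"
    then show "T1_mod N A" "T2_mod N A"
      using AN tiles_mod_imp_T1 tiles_mod_imp_tiles_int T2_imp_T2_mod by blast+
  next
    assume "card (prime_factors (card A)) \<le> 2 \<and> tiles_mod N A"
    then show "T1_mod N A" "T2_mod N A"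
      using AN tiles_mod_imp_T1 tiles_mod_imp_T2 by blast+
  }
next
  obtain p :: "nat poly" where p: "\<And>N. 5 + (N + 1) * (cost_bound tTable (N ^ 3 + 2 * N + 2) + 5) +
      cost_bound (tAnd tT1 tT2) (N ^ 3 + 2 * N + 2) = poly p N"
    using polynomial_time by metis
  show "\<exists>(c :: com) (p :: nat poly). \<forall>(N :: nat) (A :: int set).
      N > 0 \<and> A \<noteq> {} \<and> A \<subseteq> {0..<int N} \<longrightarrow>
      decides_within c (input_state N A) (poly p N) (T1_mod N A \<and> T2_mod N A) \<and>
      (card (prime_factors (card A)) \<le> 2 \<longrightarrow>
         decides_within c (input_state N A) (poly p N) (tiles_mod N A))"
  proof (rule exI[of _ decision_com], rule exI[of _ p], intro allI impI)
    fix N :: nat and A :: "int set"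
    assume A: "N > 0 \<and> A \<noteq> {} \<and> A \<subseteq> {0..<int N}"
    then have fin: "finite A" using finite_subset by blast
    have dec: "decides_within decision_com (input_state N A) (poly p N) (T1_mod N A \<and> T2_mod N A)"
      using runs_decision_com[of A N] A p by simp
    have eq: "(T1_mod N A \<and> T2_mod N A) = tiles_mod N A" if "card (prime_factors (card A)) \<le> 2"
      using that fin A T1_T2_imp_tiles_mod tiles_mod_imp_T1 tiles_mod_imp_T2 by blast
    show "decides_within decision_com (input_state N A) (poly p N) (T1_mod N A \<and> T2_mod N A) \<and>
      (card (prime_factors (card A)) \<le> 2 \<longrightarrow>
         decides_within decision_com (input_state N A) (poly p N) (tiles_mod N A))"
    proof (intro conjI impI)
      assume "card (prime_factors (card A)) \<le> 2"
      from dec[unfolded eq[OF this]]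
      show "decides_within decision_com (input_state N A) (poly p N) (tiles_mod N A)" .
    qed (rule dec)
  qed
qed

end
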